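(* Let $\delta\in(0,\frac12)$. There is a constant $C>0$ depending only on $\delta$ such that for every $R>0$, every $f\in L^2(\mathbb{R}^3)$ with $\operatorname{supp}f\subseteq B(0,R)$, every $t>0$ and every $k\in\mathbb{Z}$, $$\Big\|\dot P_k\frac{\sin(t|\nabla|)}{|\nabla|}f\Big\|_{L^\infty(\mathbb{R}^3)}\le C\,2^{\frac12k}(1+2^kt)^{-1}\langle2^kR\rangle^{1+\delta}\|f\|_{L^2(\mathbb{R}^3)},$$ $$\|\dot P_k\cos(t|\nabla|)f\|_{L^\infty(\mathbb{R}^3)}\le C\,2^{\frac32k}(1+2^kt)^{-1}\langle2^kR\rangle^{1+\delta}\|f\|_{L^2(\mathbb{R}^3)}.$$
   Context: $\langle y\rangle=(1+|y|^2)^{1/2}$; $B(0,R)=\{y\in\mathbb{R}^3:|y|\le R\}$. $\frac{\sin(t|\nabla|)}{|\nabla|}$ and $\cos(t|\nabla|)$ are the Fourier multipliers on $\mathbb{R}^3$ with symbols $\frac{\sin(t|\xi|)}{|\xi|}$ and $\cos(t|\xi|)$. Fix a smooth $\psi:\mathbb{R}\to[0,1]$ equal to $1$ on $[-5/4,5/4]$ and vanishing outside $[-8/5,8/5]$; for $k\in\mathbb{Z}$, $\dot P_k$ is the Fourier multiplier with symbol $\psi(|\xi|/2^k)-\psi(|\xi|/2^{k-1})$. *)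

theory Defs
  imports "HOL-Probability.Probability"
begin

text \<open>
  Functions on \<open>\<real>\<^sup>3\<close> are functions on \<^typ>\<open>real^3\<close> that represent their classes modulo
  equality almost everywhere.
\<close>

definition square_integrable :: "(real^3 \<Rightarrow> complex) \<Rightarrow> bool" where
  "square_integrable f \<longleftrightarrow>
     f \<in> borel_measurable lebesgue \<and> integrable lebesgue (\<lambda>x. (cmod (f x))\<^sup>2)"

definition L2_norm :: "(real^3 \<Rightarrow> complex) \<Rightarrow> real" where
  "L2_norm f = sqrt (\<integral>x. (cmod (f x))\<^sup>2 \<partial>lebesgue)"

definition Linf_norm :: "(real^3 \<Rightarrow> complex) \<Rightarrow> ereal" where
  "Linf_norm f = esssup lebesgue (\<lambda>x. ereal (cmod (f x)))"

text \<open>The support of a class: the complement of the largest open set on which it vanishes.\<close>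

definition ess_support :: "(real^3 \<Rightarrow> complex) \<Rightarrow> (real^3) set" where
  "ess_support f = - \<Union>{U. open U \<and> (AE x in lebesgue. x \<in> U \<longrightarrow> f x = 0)}"

text \<open>
  The convention is \<open>\<integral> exp (-i x\<cdot>\<xi>) f(x) dx\<close>, for which the gradient has symbol \<open>i \<xi>\<close>.
\<close>

definition fourier_integral :: "(real^3 \<Rightarrow> complex) \<Rightarrow> real^3 \<Rightarrow> complex" where
  "fourier_integral f \<xi> = (\<integral>x. cis (- (x \<bullet> \<xi>)) * f x \<partial>lebesgue)"

text \<open>
  The Fourier--Plancherel transform on \<open>L\<^sup>2\<close>: the limit in \<open>L\<^sup>2\<close> of the Fourier integrals of the
  truncations of \<open>f\<close> to balls (these truncations are integrable). By Plancherel's theorem the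
  limit exists for every square integrable \<open>f\<close>, and it is unique up to null sets. The distance is
  written as a nonnegative integral, so that a non-integrable integrand counts as infinitely far.
\<close>

definition is_L2_fourier :: "(real^3 \<Rightarrow> complex) \<Rightarrow> (real^3 \<Rightarrow> complex) \<Rightarrow> bool" where
  "is_L2_fourier f F \<longleftrightarrow> square_integrable F \<and>
     (\<lambda>n. \<integral>\<^sup>+\<xi>. ennreal ((cmod (fourier_integral
              (\<lambda>x. indicator (cball 0 (real n)) x *\<^sub>R f x) \<xi> - F \<xi>))\<^sup>2) \<partial>lebesgue)
       \<longlonglongrightarrow> 0"

definition L2_fourier :: "(real^3 \<Rightarrow> complex) \<Rightarrow> real^3 \<Rightarrow> complex" where
  "L2_fourier f = (SOME F. is_L2_fourier f F)"

definition L2_inverse_fourier :: "(real^3 \<Rightarrow> complex) \<Rightarrow> real^3 \<Rightarrow> complex" where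
  "L2_inverse_fourier F x = L2_fourier F (- x) /\<^sub>R (2 * pi) ^ 3"

definition fourier_multiplier ::
    "(real^3 \<Rightarrow> real) \<Rightarrow> (real^3 \<Rightarrow> complex) \<Rightarrow> real^3 \<Rightarrow> complex" where
  "fourier_multiplier m f = L2_inverse_fourier (\<lambda>\<xi>. m \<xi> *\<^sub>R L2_fourier f \<xi>)"

text \<open>At \<open>\<xi> = 0\<close>, a null set, the symbol takes the value 0 instead of the limit \<open>t\<close>.\<close>

definition sin_multiplier :: "real \<Rightarrow> (real^3 \<Rightarrow> complex) \<Rightarrow> real^3 \<Rightarrow> complex" where
  "sin_multiplier t = fourier_multiplier (\<lambda>\<xi>. sin (t * norm \<xi>) / norm \<xi>)"

definition cos_multiplier :: "real \<Rightarrow> (real^3 \<Rightarrow> complex) \<Rightarrow> real^3 \<Rightarrow> complex" where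
  "cos_multiplier t = fourier_multiplier (\<lambda>\<xi>. cos (t * norm \<xi>))"

definition admissible_cutoff :: "(real \<Rightarrow> real) \<Rightarrow> bool" where
  "admissible_cutoff \<psi> \<longleftrightarrow>
     (\<forall>n x. ((deriv ^^ n) \<psi>) differentiable (at x)) \<and>
     range \<psi> \<subseteq> {0..1} \<and>
     (\<forall>x\<in>{-5/4..5/4}. \<psi> x = 1) \<and>
     (\<forall>x. x \<notin> {-8/5..8/5} \<longrightarrow> \<psi> x = 0)"

definition LP_projection ::
    "(real \<Rightarrow> real) \<Rightarrow> int \<Rightarrow> (real^3 \<Rightarrow> complex) \<Rightarrow> real^3 \<Rightarrow> complex" where
  "LP_projection \<psi> k =
     fourier_multiplier (\<lambda>\<xi>. \<psi> (norm \<xi> / 2 powi k) - \<psi> (norm \<xi> / 2 powi (k - 1)))"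

definition japanese_bracket :: "'a::real_normed_vector \<Rightarrow> real" where
  "japanese_bracket y = sqrt (1 + (norm y)\<^sup>2)"

end

theory Submission
  imports Defs
begin

text \<open>
  For \<open>f\<close> supported in the ball of radius \<open>R\<close>, both functions are convolutions \<open>K * f\<close>, where
  \<open>K\<close> is the inverse Fourier transform of a radial symbol supported where
  \<open>|\<xi>|\<close> is comparable to \<open>\<mu> = 2\<^sup>k\<close>. In dimension 3 such a transform is an explicit
  one-dimensional integral, and two integrations by parts bound \<open>|K(x)|\<close> by a power of \<open>\<mu>\<close> divided by
  \<open>(1 + \<mu>t) sqrt (1 + (\<mu>(|x| - t))\<^sup>2)\<close>: the square of the kernel is concentrated on a shell of width \<open>1/\<mu>\<close>.
  A ball of radius \<open>R\<close> meets that shell in a set of measure \<open>O(R\<^sup>2/\<mu>)\<close>, so the Cauchy-Schwarz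
  inequality gives the estimate, even with the factor \<open>\<mu>R\<close> in place of the bracket.

  The multipliers are defined through the \<open>L\<^sup>2\<close> Fourier transform, so the convolution formula
  needs Plancherel's theory: Bessel's inequality comes from damping with Gaussians, it extends the
  transform to \<open>L\<^sup>2\<close>, and inversion follows from the Gaussian mollification of continuous functions.
\<close>

section \<open>Fourier integrals and Gaussians\<close>

text \<open>How the decay is spent, in units where \<open>\<mu> = 1\<close>: with
  \<open>w = sqrt (1 + (t - r)\<^sup>2)\<close>, two integrations by parts give
  \<open>1 / w\<^sup>2\<close> and the radial formula gives \<open>1 / r\<close>. For
  \<open>r > 1\<close> one has \<open>1 + t \<le> 3 * (r * w)\<close>, so \<open>1 / r\<close> and
  one factor \<open>1 / w\<close> pay for \<open>1 / (1 + t)\<close>. The other factor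
  \<open>1 / w\<close> is squared by Cauchy-Schwarz, and \<open>1 / w\<^sup>2\<close> has an
  arctangent as primitive, which is why the shell integral is finite uniformly in \<open>t\<close>.

  The projection and the wave operator are two separate multipliers, and the symbol of the inner one
  has no compact support. The pair becomes one convolution only after L2 inversion, used in the form
  "transform after inverse transform". As \<open>L2_fourier\<close> is a \<open>SOME\<close> choice
  fixed up to null sets, continuity of the transform is expressed by an inequality between squared
  distances of arbitrary representatives, \<open>is_L2_fourier_diff\<close>.\<close>

lemma borel_measurable_cis [measurable]: "cis \<in> borel_measurable borel"
  by (intro borel_measurable_continuous_onI continuous_intros)

text \<open>Fubini and product-measure facts concern \<open>lborel\<close> and Borel functions, the
  L2 notions its completion \<open>lebesgue\<close>. A Borel representative is the passage between
  the two.\<close>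

lemma complex_lebesgue_borel_version:
  fixes f :: "'a::euclidean_space \<Rightarrow> complex"
  assumes "f \<in> borel_measurable lebesgue"
  obtains g where "g \<in> borel_measurable borel" "AE x in lebesgue. f x = g x"
proof -
  have "(\<lambda>x. Re (f x)) \<in> borel_measurable lebesgue" "(\<lambda>x. Im (f x)) \<in> borel_measurable lebesgue"
    using assms by simp_all
  from this[THEN completion_ex_borel_measurable_real] obtain u v
    where uv: "u \<in> borel_measurable lborel" "v \<in> borel_measurable lborel"
      "AE x in lborel. Re (f x) = u x" "AE x in lborel. Im (f x) = v x"
    by blast
  have "AE x in lborel. f x = Complex (u x) (v x)"
    using uv(3,4) by eventually_elim (simp add: complex_eq_iff)
  moreover have "(\<lambda>x. Complex (u x) (v x)) \<in> borel_measurable borel"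
    using uv(1,2) by (simp add: borel_measurable_complex_iff)
  ultimately show ?thesis using that by (metis AE_completion)
qed

lemma fourier_integral_cong_AE:
  assumes "f \<in> borel_measurable lebesgue" "AE x in lebesgue. f x = g x"
  shows "fourier_integral f = fourier_integral g"
proof
  fix \<xi> :: "real^3"
  have g: "g \<in> borel_measurable lebesgue"
    using assms borel_measurable_AE by blast
  have c: "(\<lambda>x. cis (- (x \<bullet> \<xi>))) \<in> borel_measurable lebesgue"
    by (rule measurable_completion) measurable
  show "fourier_integral f \<xi> = fourier_integral g \<xi>"
    unfolding fourier_integral_def
    by (rule integral_cong_AE) (use assms g c in auto)
qed

lemma fourier_integral_lborel:
  assumes "f \<in> borel_measurable borel"
  shows "fourier_integral f \<xi> = (\<integral>x. cis (- (x \<bullet> \<xi>)) * f x \<partial>lborel)"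
  unfolding fourier_integral_def by (rule integral_completion) (use assms in measurable)

text \<open>Borel even for a merely Lebesgue measurable \<open>f\<close>: a Borel version has the
  same Fourier integral at every frequency, and that integral depends measurably on its
  parameter.\<close>

lemma borel_measurable_fourier_integral [measurable]:
  assumes "f \<in> borel_measurable lebesgue"
  shows "fourier_integral f \<in> borel_measurable borel"
proof -
  obtain g where [measurable]: "g \<in> borel_measurable borel" and fg: "AE x in lebesgue. f x = g x"
    using assms complex_lebesgue_borel_version by blast
  have "fourier_integral f = (\<lambda>\<xi>. \<integral>x. cis (- (x \<bullet> \<xi>)) * g x \<partial>lborel)"
    using fourier_integral_cong_AE[OF assms fg] fourier_integral_lborel by auto
  also have "\<dots> \<in> borel_measurable borel"
    by measurable
  finally show ?thesis .
qed

lemma integrable_cis_mult: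
  fixes f :: "'a::euclidean_space \<Rightarrow> complex"
  assumes "integrable lebesgue f"
  shows "integrable lebesgue (\<lambda>x. cis (- (x \<bullet> \<xi>)) * f x)"
proof -
  have c: "(\<lambda>x. cis (- (x \<bullet> \<xi>))) \<in> borel_measurable lebesgue"
    by (rule measurable_completion) measurable
  show ?thesis
    by (rule Bochner_Integration.integrable_bound[OF assms]) (use c assms in \<open>auto simp: norm_mult\<close>)
qed

lemma fourier_integral_diff:
  assumes "integrable lebesgue f" "integrable lebesgue g"
  shows "fourier_integral (\<lambda>x. f x - g x) \<xi> = fourier_integral f \<xi> - fourier_integral g \<xi>"
  unfolding fourier_integral_def using assms
  by (simp add: ring_distribs integrable_cis_mult)

lemma norm_fourier_integral_le:
  shows "cmod (fourier_integral f \<xi>) \<le> (\<integral>x. cmod (f x) \<partial>lebesgue)"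
  unfolding fourier_integral_def
  by (rule order_trans[OF integral_norm_bound]) (simp add: norm_mult)

lemma integrable_lborel_product:
  fixes f g :: "'a::euclidean_space \<Rightarrow> complex"
  assumes f: "integrable lborel f" and g: "integrable lborel g"
  shows "integrable (lborel \<Otimes>\<^sub>M lborel) (\<lambda>(x, y). f x * g y)"
proof (rule lborel_pair.Fubini_integrable)
  show "(\<lambda>(x, y). f x * g y) \<in> borel_measurable (lborel \<Otimes>\<^sub>M lborel)"
    using f g by measurable
qed (use f g in \<open>auto simp: norm_mult\<close>)

text \<open>Fubini; the phase has modulus 1, so \<open>f y * m \<xi>\<close> dominates. It serves
  three times: a Gaussian \<open>m\<close> gives mollification, a Gaussian times the conjugate
  transform gives Bessel's inequality, and the symbol of the multiplier gives the convolution
  kernel.\<close>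

lemma integral_cis_mult_fourier_integral:
  assumes f: "integrable lborel f" and m: "integrable lborel m"
  shows "(\<integral>\<xi>. cis (x \<bullet> \<xi>) * m \<xi> * fourier_integral f \<xi> \<partial>lborel)
       = (\<integral>y. f y * (\<integral>\<xi>. cis ((x - y) \<bullet> \<xi>) * m \<xi> \<partial>lborel) \<partial>lborel)"
proof -
  have [measurable]: "f \<in> borel_measurable borel" "m \<in> borel_measurable borel"
    using f m by auto
  have int: "integrable (lborel \<Otimes>\<^sub>M lborel) (\<lambda>(y, \<xi>). cis ((x - y) \<bullet> \<xi>) * (f y * m \<xi>))"
    by (rule Bochner_Integration.integrable_bound[OF integrable_lborel_product[OF f m]])
       (auto simp: norm_mult split_beta)
  have "(\<integral>\<xi>. cis (x \<bullet> \<xi>) * m \<xi> * fourier_integral f \<xi> \<partial>lborel)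
      = (\<integral>\<xi>. (\<integral>y. cis ((x - y) \<bullet> \<xi>) * (f y * m \<xi>) \<partial>lborel) \<partial>lborel)"
  proof (rule Bochner_Integration.integral_cong[OF refl])
    fix \<xi>
    have "cis (x \<bullet> \<xi>) * m \<xi> * fourier_integral f \<xi>
        = (\<integral>y. cis (x \<bullet> \<xi>) * m \<xi> * (cis (- (y \<bullet> \<xi>)) * f y) \<partial>lborel)"
      by (simp add: fourier_integral_lborel)
    also have "\<dots> = (\<integral>y. cis ((x - y) \<bullet> \<xi>) * (f y * m \<xi>) \<partial>lborel)"
      by (intro Bochner_Integration.integral_cong refl)
         (simp add: inner_diff_left cis_mult)
    finally show "cis (x \<bullet> \<xi>) * m \<xi> * fourier_integral f \<xi>
        = (\<integral>y. cis ((x - y) \<bullet> \<xi>) * (f y * m \<xi>) \<partial>lborel)" .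
  qed
  also have "\<dots> = (\<integral>y. (\<integral>\<xi>. cis ((x - y) \<bullet> \<xi>) * (f y * m \<xi>) \<partial>lborel) \<partial>lborel)"
    by (rule lborel_pair.Fubini_integral) (use int in simp)
  also have "\<dots> = (\<integral>y. f y * (\<integral>\<xi>. cis ((x - y) \<bullet> \<xi>) * m \<xi> \<partial>lborel) \<partial>lborel)"
    by (intro Bochner_Integration.integral_cong refl)
       (subst integral_mult_right_zero[symmetric], simp add: ac_simps)
  finally show ?thesis .
qed

section \<open>Gaussian Fourier integrals, from one dimension to several\<close>

lemma integral_lborel_prod:
  fixes f :: "'a::euclidean_space \<Rightarrow> real \<Rightarrow> complex"
  assumes "\<And>b. b \<in> Basis \<Longrightarrow> integrable lborel (f b)"
  shows "(\<integral>x. (\<Prod>b\<in>Basis. f b (x \<bullet> b)) \<partial>lborel) = (\<Prod>b\<in>Basis. \<integral>x. f b x \<partial>lborel)"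
    and "integrable lborel (\<lambda>x. \<Prod>b\<in>Basis. f b (x \<bullet> b))"
proof -
  interpret product_sigma_finite "\<lambda>_::'a. lborel :: real measure" ..
  have [measurable]: "\<And>b. b \<in> Basis \<Longrightarrow> f b \<in> borel_measurable borel"
    using assms by (auto dest: borel_measurable_integrable)
  have [measurable]: "(\<lambda>x::'a. \<Prod>b\<in>Basis. f b (x \<bullet> b)) \<in> borel_measurable borel"
    by (rule borel_measurable_prod) measurable
  have eq: "(\<Prod>b\<in>Basis. f b ((\<Sum>c\<in>Basis. g c *\<^sub>R c) \<bullet> b)) = (\<Prod>b\<in>Basis. f b (g b))" for g :: "'a \<Rightarrow> real"
    by (intro prod.cong) auto
  show "(\<integral>x. (\<Prod>b\<in>Basis. f b (x \<bullet> b)) \<partial>lborel) = (\<Prod>b\<in>Basis. \<integral>x. f b x \<partial>lborel)"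
    unfolding lborel_eq[where ?'a='a]
    by (subst integral_distr) (simp_all add: eq product_integral_prod assms)
  show "integrable lborel (\<lambda>x. \<Prod>b\<in>Basis. f b (x \<bullet> b))"
    unfolding lborel_eq[where ?'a='a]
    by (subst integrable_distr_eq) (simp_all add: eq product_integrable_prod assms)
qed

text \<open>This is the characteristic function of the standard normal distribution, rescaled by the
  factor \<open>s\<close>.\<close>

lemma gaussian_fourier_real:
  fixes s t :: real assumes s: "s > 0"
  shows "integrable lborel (\<lambda>x. cis (t * x) * complex_of_real (exp (- (s * x)\<^sup>2 / 2)))"
    and "(\<integral>x. cis (t * x) * complex_of_real (exp (- (s * x)\<^sup>2 / 2)) \<partial>lborel)
        = complex_of_real (sqrt (2 * pi) / s * exp (- (t / s)\<^sup>2 / 2))"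
proof -
  have base: "(\<integral>x. cis (u * x) * complex_of_real (exp (- x\<^sup>2 / 2)) \<partial>lborel)
        = complex_of_real (sqrt (2 * pi) * exp (- u\<^sup>2 / 2))" for u
  proof -
    have "complex_of_real (exp (- u\<^sup>2 / 2)) = (\<integral>x. std_normal_density x *\<^sub>R iexp (u * x) \<partial>lborel)"
      unfolding char_std_normal_distribution[THEN fun_cong, of u, symmetric] char_def
      by (subst integral_density) auto
    also have "\<dots> = (\<integral>x. complex_of_real (1 / sqrt (2 * pi)) * (cis (u * x) * complex_of_real (exp (- x\<^sup>2 / 2))) \<partial>lborel)"
      by (intro Bochner_Integration.integral_cong refl)
         (simp add: std_normal_density_def cis_conv_exp scaleR_conv_of_real ac_simps)
    also have "\<dots> = complex_of_real (1 / sqrt (2 * pi)) * (\<integral>x. cis (u * x) * complex_of_real (exp (- x\<^sup>2 / 2)) \<partial>lborel)"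
      by simp
    finally show ?thesis by (simp add: field_simps)
  qed
  have "integrable lborel (\<lambda>x. sqrt (2 * pi) * std_normal_density x)"
    by (intro integrable_mult_right) auto
  then have "integrable lborel (\<lambda>x::real. exp (- x\<^sup>2 / 2))"
    by (simp add: std_normal_density_def)
  then have "integrable lborel (\<lambda>x::real. exp (- (0 + s * x)\<^sup>2 / 2))"
    by (rule lborel_integrable_real_affine) (use s in auto)
  then show int: "integrable lborel (\<lambda>x. cis (t * x) * complex_of_real (exp (- (s * x)\<^sup>2 / 2)))"
    by (rule Bochner_Integration.integrable_bound) (auto simp: norm_mult)
  have "complex_of_real (sqrt (2 * pi) * exp (- (t / s)\<^sup>2 / 2)) =
     s *\<^sub>R (\<integral>x. cis (t / s * (0 + s * x)) * complex_of_real (exp (- (0 + s * x)\<^sup>2 / 2)) \<partial>lborel)"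
    using s by (subst base[symmetric], subst lborel_integral_real_affine[where c=s and t=0]) auto
  then show "(\<integral>x. cis (t * x) * complex_of_real (exp (- (s * x)\<^sup>2 / 2)) \<partial>lborel)
        = complex_of_real (sqrt (2 * pi) / s * exp (- (t / s)\<^sup>2 / 2))"
    using s by (simp add: scaleR_conv_of_real field_simps)
qed

lemma gaussian_fourier:
  fixes x :: "'a::euclidean_space" assumes s: "s > 0"
  shows "integrable lborel (\<lambda>\<xi>::'a. cis (x \<bullet> \<xi>) * complex_of_real (exp (- (s * norm \<xi>)\<^sup>2 / 2)))"
    and "(\<integral>\<xi>. cis (x \<bullet> \<xi>) * complex_of_real (exp (- (s * norm \<xi>)\<^sup>2 / 2)) \<partial>lborel)
        = complex_of_real ((sqrt (2 * pi) / s) ^ DIM('a) * exp (- (norm x / s)\<^sup>2 / 2))"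
proof -
  have sq: "(norm y)\<^sup>2 = (\<Sum>b\<in>Basis. (y \<bullet> b)\<^sup>2)" for y :: 'a
    by (subst power2_norm_eq_inner, subst euclidean_inner) (simp add: power2_eq_square)
  have e: "exp (- (c * norm y)\<^sup>2 / 2) = (\<Prod>b\<in>Basis. exp (- (c * (y \<bullet> b))\<^sup>2 / 2))" for y :: 'a and c :: real
    by (simp add: power_mult_distrib sq sum_distrib_left sum_divide_distrib sum_negf[symmetric] exp_sum[symmetric])
  have eq: "cis (x \<bullet> \<xi>) * complex_of_real (exp (- (s * norm \<xi>)\<^sup>2 / 2)) =
     (\<Prod>b\<in>Basis. cis ((x \<bullet> b) * (\<xi> \<bullet> b)) * complex_of_real (exp (- (s * (\<xi> \<bullet> b))\<^sup>2 / 2)))" for \<xi> :: 'a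
    unfolding e of_real_prod prod.distrib
    by (simp add: euclidean_inner[of x \<xi>] cis_conv_exp sum_distrib_left exp_sum)
  show "integrable lborel (\<lambda>\<xi>::'a. cis (x \<bullet> \<xi>) * complex_of_real (exp (- (s * norm \<xi>)\<^sup>2 / 2)))"
    unfolding eq by (intro integral_lborel_prod(2) gaussian_fourier_real s)
  have "(\<integral>\<xi>. cis (x \<bullet> \<xi>) * complex_of_real (exp (- (s * norm \<xi>)\<^sup>2 / 2)) \<partial>lborel)
     = (\<Prod>b\<in>Basis. complex_of_real (sqrt (2 * pi) / s * exp (- ((x \<bullet> b) / s)\<^sup>2 / 2)))"
    unfolding eq by (subst integral_lborel_prod(1), rule gaussian_fourier_real(1)[OF s])
      (simp only: gaussian_fourier_real(2)[OF s])
  also have "\<dots> = complex_of_real ((sqrt (2 * pi) / s) ^ DIM('a) * exp (- (norm x / s)\<^sup>2 / 2))"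
  proof -
    have e': "exp (- (norm x / s)\<^sup>2 / 2) = (\<Prod>b\<in>Basis. exp (- ((x \<bullet> b) / s)\<^sup>2 / 2))"
      using e[of "1 / s" x] by simp
    show ?thesis
      unfolding of_real_prod[symmetric] prod.distrib prod_constant e' ..
  qed
  finally show "(\<integral>\<xi>. cis (x \<bullet> \<xi>) * complex_of_real (exp (- (s * norm \<xi>)\<^sup>2 / 2)) \<partial>lborel)
     = complex_of_real ((sqrt (2 * pi) / s) ^ DIM('a) * exp (- (norm x / s)\<^sup>2 / 2))" .
qed

section \<open>Bessel's inequality\<close>

lemma borel_measurable_cnj [measurable]: "cnj \<in> borel_measurable borel"
  by (intro borel_measurable_continuous_onI continuous_intros)

text \<open>Fatou's lemma, packaged so that bounds on approximants pass to a pointwise limit.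
  Bessel's inequality, completeness and inversion for continuous functions all end with it.\<close>

lemma nn_integral_le_of_tendsto:
  fixes u :: "nat \<Rightarrow> 'a \<Rightarrow> ennreal"
  assumes [measurable]: "\<And>n. u n \<in> borel_measurable M"
    and lim: "AE x in M. (\<lambda>n. u n x) \<longlonglongrightarrow> v x"
    and le: "\<And>n. (\<integral>\<^sup>+x. u n x \<partial>M) \<le> c n" and c: "c \<longlonglongrightarrow> d"
  shows "(\<integral>\<^sup>+x. v x \<partial>M) \<le> d"
proof -
  have "(\<integral>\<^sup>+x. v x \<partial>M) = (\<integral>\<^sup>+x. liminf (\<lambda>n. u n x) \<partial>M)"
    by (rule nn_integral_cong_AE) (use lim in \<open>eventually_elim, auto dest!: lim_imp_Liminf[rotated]\<close>)
  also have "\<dots> \<le> liminf (\<lambda>n. \<integral>\<^sup>+x. u n x \<partial>M)"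
    by (rule nn_integral_liminf) measurable
  also have "\<dots> \<le> liminf c"
    by (rule Liminf_mono) (use le in auto)
  also have "\<dots> = d"
    using c by (simp add: lim_imp_Liminf)
  finally show ?thesis .
qed

text \<open>Kept squared and in \<open>ennreal\<close>: infinite values need no integrability side
  conditions, and the limit in \<open>is_L2_fourier\<close> has exactly this form.\<close>

definition L2_sq :: "(real^3 \<Rightarrow> complex) \<Rightarrow> ennreal" where
  "L2_sq f = (\<integral>\<^sup>+x. ennreal ((cmod (f x))\<^sup>2) \<partial>lebesgue)"

lemma L2_sq_lborel: "L2_sq f = (\<integral>\<^sup>+x. ennreal ((cmod (f x))\<^sup>2) \<partial>lborel)"
  by (simp add: L2_sq_def nn_integral_completion)

lemma L2_sq_cong_AE: "AE x in lebesgue. f x = g x \<Longrightarrow> L2_sq f = L2_sq g"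
  unfolding L2_sq_def by (rule nn_integral_cong_AE) auto

text \<open>This is the Fourier integral of the damping factor
  \<open>exp (- (s * norm \<xi>)\<^sup>2 / 2)\<close> without normalisation; hence its total mass is
  \<open>(2 * pi) ^ 3\<close>. It concentrates at the origin as \<open>s\<close> tends to 0.\<close>

definition gauss_kernel :: "real \<Rightarrow> real^3 \<Rightarrow> real" where
  "gauss_kernel s y = (sqrt (2 * pi) / s) ^ 3 * exp (- (norm y / s)\<^sup>2 / 2)"

lemma borel_measurable_gauss_kernel [measurable]: "gauss_kernel s \<in> borel_measurable borel"
  unfolding gauss_kernel_def by measurable

lemma gauss_kernel_nonneg: "s > 0 \<Longrightarrow> 0 \<le> gauss_kernel s y"
  by (simp add: gauss_kernel_def)

lemma gauss_kernel_minus_commute: "gauss_kernel s (x - y) = gauss_kernel s (y - x)"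
  by (simp add: gauss_kernel_def norm_minus_commute)

lemma integrable_gaussian:
  assumes s: "s > 0"
  shows "integrable lborel (\<lambda>y::'a::euclidean_space. exp (- (s * norm y)\<^sup>2 / 2))"
  using integrable_norm[OF gaussian_fourier(1)[OF s, where x="0::'a"]]
  by (simp add: norm_mult)

lemma
  assumes s: "s > 0"
  shows integrable_gauss_kernel: "integrable lborel (gauss_kernel s)"
    and integral_gauss_kernel: "(\<integral>y. gauss_kernel s y \<partial>lborel) = (2 * pi) ^ 3"
proof -
  have s': "1 / s > 0" using s by simp
  show "integrable lborel (gauss_kernel s)"
    using integrable_gaussian[OF s', where 'a="real^3"] unfolding gauss_kernel_def
    by (intro integrable_mult_right) simp
  have "complex_of_real (\<integral>y. gauss_kernel s y \<partial>lborel)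
      = (sqrt (2 * pi) / s) ^ 3 * complex_of_real ((sqrt (2 * pi) * s) ^ 3)"
    using gaussian_fourier(2)[OF s', where x="0::real^3"] unfolding gauss_kernel_def
    by simp
  also have "\<dots> = complex_of_real ((2 * pi) ^ 3)"
    using s by (simp add: power3_eq_cube field_simps flip: of_real_mult)
  finally show "(\<integral>y. gauss_kernel s y \<partial>lborel) = (2 * pi) ^ 3"
    unfolding of_real_eq_iff .
qed

lemma nn_integral_gauss_kernel:
  assumes s: "s > 0"
  shows "(\<integral>\<^sup>+y. ennreal (gauss_kernel s (x - y)) \<partial>lborel) = ennreal ((2 * pi) ^ 3)"
proof -
  have "(\<integral>\<^sup>+y. ennreal (gauss_kernel s (x - y)) \<partial>lborel) = (\<integral>\<^sup>+y. ennreal (gauss_kernel s y) \<partial>lborel)"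
    by (subst (2) lborel_affine[where c="-1" and t=x])
       (simp_all add: nn_integral_density nn_integral_distr)
  also have "\<dots> = ennreal ((2 * pi) ^ 3)"
    by (subst nn_integral_eq_integral)
       (auto intro!: integrable_gauss_kernel gauss_kernel_nonneg simp: s integral_gauss_kernel)
  finally show ?thesis .
qed

text \<open>Damping the Fourier transform by a Gaussian mollifies \<open>f\<close>.\<close>

lemma damped_inversion:
  assumes f: "integrable lborel f" and s: "s > 0"
  shows "(\<integral>\<xi>. cis (x \<bullet> \<xi>) * complex_of_real (exp (- (s * norm \<xi>)\<^sup>2 / 2)) * fourier_integral f \<xi> \<partial>lborel)
    = (\<integral>y. f y * complex_of_real (gauss_kernel s (x - y)) \<partial>lborel)"
proof -
  have g: "complex_of_real (gauss_kernel s z)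
      = (\<integral>\<xi>. cis (z \<bullet> \<xi>) * complex_of_real (exp (- (s * norm \<xi>)\<^sup>2 / 2)) \<partial>lborel)" for z
    unfolding gaussian_fourier(2)[OF s] gauss_kernel_def by simp
  have i: "integrable lborel (\<lambda>\<xi>::real^3. complex_of_real (exp (- (s * norm \<xi>)\<^sup>2 / 2)))"
    by (intro integrable_of_real integrable_gaussian s)
  show ?thesis
    unfolding g by (rule integral_cis_mult_fourier_integral[OF f i])
qed

lemma ennreal_norm_integral_le:
  fixes f :: "'a \<Rightarrow> 'b::{banach, second_countable_topology}"
  shows "ennreal (norm (\<integral>x. f x \<partial>M)) \<le> (\<integral>\<^sup>+x. ennreal (norm (f x)) \<partial>M)"
  by (cases "integrable M f") (auto simp: integral_norm_bound_ennreal not_integrable_integral_eq)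

text \<open>The left side is the pairing of \<open>f\<close> with its Gaussian mollification. Since
  \<open>cmod (f y) * cmod (f z)\<close> is at most half the sum of the squares, and the kernel has
  mass \<open>(2 * pi) ^ 3\<close> in either variable, Schur's argument bounds the pairing. The
  damping makes the integrals converge while \<open>fourier_integral f\<close> is only known to be
  bounded.\<close>

lemma bessel_damped:
  assumes f: "integrable lborel f" and s: "s > 0"
  shows "(\<integral>\<^sup>+\<xi>. ennreal ((cmod (fourier_integral f \<xi>))\<^sup>2 * exp (- (s * norm \<xi>)\<^sup>2 / 2)) \<partial>lborel)
     \<le> ennreal ((2 * pi) ^ 3) * L2_sq f"
proof -
  have [measurable]: "f \<in> borel_measurable borel"
    using f by auto
  have [measurable]: "fourier_integral f \<in> borel_measurable borel"
    by (rule borel_measurable_fourier_integral, rule measurable_completion) simp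
  have bd: "cmod (fourier_integral f \<xi>) \<le> (\<integral>x. cmod (f x) \<partial>lebesgue)" (is "_ \<le> ?B") for \<xi>
    by (rule norm_fourier_integral_le)
  have B: "0 \<le> ?B" by simp
  define E where "E = (\<lambda>\<xi>::real^3. exp (- (s * norm \<xi>)\<^sup>2 / 2))"
  have E: "integrable lborel E" "\<And>\<xi>. 0 \<le> E \<xi>" and [measurable]: "E \<in> borel_measurable borel"
    using integrable_gaussian[OF s, where 'a="real^3"] by (auto simp: E_def)
  have m: "integrable lborel (\<lambda>\<xi>. complex_of_real (E \<xi>) * cnj (fourier_integral f \<xi>))"
  proof (rule Bochner_Integration.integrable_bound)
    show "integrable lborel (\<lambda>\<xi>. ?B * E \<xi>)"
      using E by simp
    show "AE \<xi> in lborel. norm (complex_of_real (E \<xi>) * cnj (fourier_integral f \<xi>)) \<le> norm (?B * E \<xi>)"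
      using bd E B by (auto simp: norm_mult mult.commute mult_left_mono)
  qed measurable
  have "integrable lborel (\<lambda>\<xi>. (cmod (fourier_integral f \<xi>))\<^sup>2 * E \<xi>)"
  proof (rule Bochner_Integration.integrable_bound)
    show "integrable lborel (\<lambda>\<xi>. ?B\<^sup>2 * E \<xi>)"
      using E by simp
    show "AE \<xi> in lborel. norm ((cmod (fourier_integral f \<xi>))\<^sup>2 * E \<xi>) \<le> norm (?B\<^sup>2 * E \<xi>)"
      using bd E B by (auto simp: norm_mult intro!: mult_right_mono power_mono)
  qed measurable
  then have "(\<integral>\<^sup>+\<xi>. ennreal ((cmod (fourier_integral f \<xi>))\<^sup>2 * E \<xi>) \<partial>lborel)
     = ennreal (\<integral>\<xi>. (cmod (fourier_integral f \<xi>))\<^sup>2 * E \<xi> \<partial>lborel)"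
    using E by (intro nn_integral_eq_integral) auto
  \<comment> \<open>The factor \<open>cis (0 \<bullet> \<xi>)\<close>, equal to 1, is inserted to
    reach the shape of \<open>integral_cis_mult_fourier_integral\<close> at \<open>x = 0\<close>,
    with the conjugate transform as part of the symbol.\<close>
  also have "\<dots> = ennreal (cmod (\<integral>\<xi>. cis (0 \<bullet> \<xi>) * (complex_of_real (E \<xi>) * cnj (fourier_integral f \<xi>)) * fourier_integral f \<xi> \<partial>lborel))"
  proof -
    have "(\<integral>\<xi>. cis (0 \<bullet> \<xi>) * (complex_of_real (E \<xi>) * cnj (fourier_integral f \<xi>)) * fourier_integral f \<xi> \<partial>lborel)
        = (\<integral>\<xi>. complex_of_real ((cmod (fourier_integral f \<xi>))\<^sup>2 * E \<xi>) \<partial>lborel)"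
      by (intro Bochner_Integration.integral_cong refl)
         (simp add: complex_norm_square ac_simps del: of_real_power)
    also have "\<dots> = complex_of_real (\<integral>\<xi>. (cmod (fourier_integral f \<xi>))\<^sup>2 * E \<xi> \<partial>lborel)"
      by (rule integral_complex_of_real)
    finally show ?thesis
      using E by (simp add: Bochner_Integration.integral_nonneg)
  qed
  also have "\<dots> = ennreal (cmod (\<integral>y. f y * cnj (\<integral>z. f z * complex_of_real (gauss_kernel s (y - z)) \<partial>lborel) \<partial>lborel))"
  proof -
    have "(\<integral>\<xi>. cis ((0 - y) \<bullet> \<xi>) * (complex_of_real (E \<xi>) * cnj (fourier_integral f \<xi>)) \<partial>lborel)
        = cnj (\<integral>z. f z * complex_of_real (gauss_kernel s (y - z)) \<partial>lborel)" for y
      unfolding damped_inversion[OF f s, symmetric]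
      by (subst Bochner_Integration.integral_cnj[symmetric], intro Bochner_Integration.integral_cong refl)
         (simp add: cis_cnj E_def ac_simps)
    then show ?thesis
      by (subst integral_cis_mult_fourier_integral[OF f m]) simp
  qed
  also have "\<dots> \<le> (\<integral>\<^sup>+y. ennreal (cmod (f y * cnj (\<integral>z. f z * complex_of_real (gauss_kernel s (y - z)) \<partial>lborel))) \<partial>lborel)"
    by (rule ennreal_norm_integral_le)
  also have "\<dots> \<le> (\<integral>\<^sup>+y. (\<integral>\<^sup>+z. ennreal (((cmod (f y))\<^sup>2 + (cmod (f z))\<^sup>2) / 2 * gauss_kernel s (y - z)) \<partial>lborel) \<partial>lborel)"
  proof (rule nn_integral_mono)
    fix y
    have "ennreal (cmod (f y * cnj (\<integral>z. f z * complex_of_real (gauss_kernel s (y - z)) \<partial>lborel)))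
       = ennreal (cmod (\<integral>z. f y * (f z * complex_of_real (gauss_kernel s (y - z))) \<partial>lborel))"
      by (simp add: norm_mult)
    also have "\<dots> \<le> (\<integral>\<^sup>+z. ennreal (cmod (f y * (f z * complex_of_real (gauss_kernel s (y - z))))) \<partial>lborel)"
      by (rule ennreal_norm_integral_le)
    also have "\<dots> \<le> (\<integral>\<^sup>+z. ennreal (((cmod (f y))\<^sup>2 + (cmod (f z))\<^sup>2) / 2 * gauss_kernel s (y - z)) \<partial>lborel)"
    proof (intro nn_integral_mono ennreal_leI)
      fix z
      have "cmod (f y) * cmod (f z) \<le> ((cmod (f y))\<^sup>2 + (cmod (f z))\<^sup>2) / 2"
        using sum_squares_bound[of "cmod (f y)" "cmod (f z)"] by simp
      then have "cmod (f y) * cmod (f z) * gauss_kernel s (y - z) \<le> ((cmod (f y))\<^sup>2 + (cmod (f z))\<^sup>2) / 2 * gauss_kernel s (y - z)"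
        by (rule mult_right_mono) (rule gauss_kernel_nonneg[OF s])
      then show "cmod (f y * (f z * complex_of_real (gauss_kernel s (y - z)))) \<le> ((cmod (f y))\<^sup>2 + (cmod (f z))\<^sup>2) / 2 * gauss_kernel s (y - z)"
        by (simp add: norm_mult gauss_kernel_nonneg[OF s] ac_simps)
    qed
    finally show "ennreal (cmod (f y * cnj (\<integral>z. f z * complex_of_real (gauss_kernel s (y - z)) \<partial>lborel)))
       \<le> (\<integral>\<^sup>+z. ennreal (((cmod (f y))\<^sup>2 + (cmod (f z))\<^sup>2) / 2 * gauss_kernel s (y - z)) \<partial>lborel)" .
  qed
  \<comment> \<open>By symmetry of the kernel the second term is the first with the variables
    exchanged; each contributes half of the final constant.\<close>
  also have "\<dots> = (\<integral>\<^sup>+y. (\<integral>\<^sup>+z. ennreal ((cmod (f y))\<^sup>2 / 2) * ennreal (gauss_kernel s (y - z)) \<partial>lborel) \<partial>lborel)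
     + (\<integral>\<^sup>+y. (\<integral>\<^sup>+z. ennreal ((cmod (f z))\<^sup>2 / 2) * ennreal (gauss_kernel s (z - y)) \<partial>lborel) \<partial>lborel)"
    by (simp add: nn_integral_add[symmetric] gauss_kernel_nonneg[OF s] ennreal_mult[symmetric] ennreal_plus[symmetric]
        add_divide_distrib distrib_right gauss_kernel_minus_commute[of _ _ "_::real^3"] del: ennreal_plus)
  also have "(\<integral>\<^sup>+y. (\<integral>\<^sup>+z. ennreal ((cmod (f z))\<^sup>2 / 2) * ennreal (gauss_kernel s (z - y)) \<partial>lborel) \<partial>lborel)
     = (\<integral>\<^sup>+z. (\<integral>\<^sup>+y. ennreal ((cmod (f z))\<^sup>2 / 2) * ennreal (gauss_kernel s (z - y)) \<partial>lborel) \<partial>lborel)"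
    by (rule lborel_pair.Fubini') measurable
  also have "(\<integral>\<^sup>+y. (\<integral>\<^sup>+z. ennreal ((cmod (f y))\<^sup>2 / 2) * ennreal (gauss_kernel s (y - z)) \<partial>lborel) \<partial>lborel) + \<dots>
     = ennreal ((2 * pi) ^ 3) * L2_sq f"
  proof -
    have eq: "(\<integral>\<^sup>+z. (\<integral>\<^sup>+y. ennreal ((cmod (f z))\<^sup>2 / 2) * ennreal (gauss_kernel s (z - y)) \<partial>lborel) \<partial>lborel)
       = ennreal ((2 * pi) ^ 3 / 2) * L2_sq f"
    proof -
      have "(\<integral>\<^sup>+z. (\<integral>\<^sup>+y. ennreal ((cmod (f z))\<^sup>2 / 2) * ennreal (gauss_kernel s (z - y)) \<partial>lborel) \<partial>lborel)
         = (\<integral>\<^sup>+z. ennreal ((cmod (f z))\<^sup>2 / 2) * ennreal ((2 * pi) ^ 3) \<partial>lborel)"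
        by (subst nn_integral_cmult, measurable) (simp only: nn_integral_gauss_kernel[OF s])
      also have "\<dots> = (\<integral>\<^sup>+z. ennreal ((2 * pi) ^ 3 / 2) * ennreal ((cmod (f z))\<^sup>2) \<partial>lborel)"
        by (intro nn_integral_cong) (simp add: ennreal_mult[symmetric] mult.commute)
      also have "\<dots> = ennreal ((2 * pi) ^ 3 / 2) * L2_sq f"
        unfolding L2_sq_lborel by (rule nn_integral_cmult) measurable
      finally show ?thesis .
    qed
    show ?thesis
      unfolding eq by (subst distrib_right[symmetric], subst ennreal_plus[symmetric]) auto
  qed
  finally show ?thesis unfolding E_def .
qed

text \<open>Fatou removes the damping along \<open>s = inverse (real (Suc n))\<close>. An infinite
  \<open>L2_sq f\<close> is allowed and makes the claim trivial.\<close>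

lemma bessel_inequality:
  assumes f: "integrable lebesgue f"
  shows "L2_sq (fourier_integral f) \<le> ennreal ((2 * pi) ^ 3) * L2_sq f"
proof -
  have fm: "f \<in> borel_measurable lebesgue" using f by auto
  then obtain g where [measurable]: "g \<in> borel_measurable borel" and fg: "AE x in lebesgue. f x = g x"
    using complex_lebesgue_borel_version by blast
  have gm: "g \<in> borel_measurable lebesgue"
    using fm fg borel_measurable_AE by blast
  have g: "integrable lborel g"
    using f integrable_cong_AE[OF fm gm fg] by (simp add: integrable_completion)
  have [measurable]: "fourier_integral g \<in> borel_measurable borel"
    by (rule borel_measurable_fourier_integral[OF gm])
  have "L2_sq (fourier_integral g) \<le> ennreal ((2 * pi) ^ 3) * L2_sq g"
    unfolding L2_sq_lborel[of "fourier_integral g"]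
  proof (rule nn_integral_le_of_tendsto)
    show "(\<integral>\<^sup>+\<xi>. ennreal ((cmod (fourier_integral g \<xi>))\<^sup>2 * exp (- (inverse (real (Suc n)) * norm \<xi>)\<^sup>2 / 2)) \<partial>lborel)
      \<le> ennreal ((2 * pi) ^ 3) * L2_sq g" for n
      by (rule bessel_damped[OF g]) simp
    have "(\<lambda>n. ennreal ((cmod (fourier_integral g \<xi>))\<^sup>2 * exp (- (inverse (real (Suc n)) * norm \<xi>)\<^sup>2 / 2)))
      \<longlonglongrightarrow> ennreal ((cmod (fourier_integral g \<xi>))\<^sup>2 * exp (- (0 * norm \<xi>)\<^sup>2 / 2))" for \<xi>
      by (intro tendsto_intros LIMSEQ_inverse_real_of_nat) auto
    then show "AE \<xi> in lborel. (\<lambda>n. ennreal ((cmod (fourier_integral g \<xi>))\<^sup>2 * exp (- (inverse (real (Suc n)) * norm \<xi>)\<^sup>2 / 2)))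
      \<longlonglongrightarrow> ennreal ((cmod (fourier_integral g \<xi>))\<^sup>2)"
      by simp
  qed auto
  then show ?thesis
    using fourier_integral_cong_AE[OF fm fg] L2_sq_cong_AE[OF fg] by simp
qed

section \<open>The Fourier transform on \<open>L\<^sup>2\<close>\<close>

lemma L2_sq_minus_commute: "L2_sq (\<lambda>x. f x - g x) = L2_sq (\<lambda>x. g x - f x)"
  by (simp add: L2_sq_def norm_minus_commute)

lemma L2_sq_mono:
  "(\<And>x. cmod (f x) \<le> cmod (g x)) \<Longrightarrow> L2_sq f \<le> L2_sq g"
  unfolding L2_sq_def by (intro nn_integral_mono ennreal_leI power_mono) auto

text \<open>The factor 2 comes from \<open>2 * u * v \<le> u\<^sup>2 + v\<^sup>2\<close> and is the
  price for staying with squares. It is the source of the constants 4 and 8 in the density and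
  stability estimates.\<close>

lemma L2_sq_triangle:
  assumes [measurable]: "f \<in> borel_measurable lebesgue" "g \<in> borel_measurable lebesgue"
    "h \<in> borel_measurable lebesgue"
  shows "L2_sq (\<lambda>x. f x - h x) \<le> 2 * L2_sq (\<lambda>x. f x - g x) + 2 * L2_sq (\<lambda>x. g x - h x)"
proof -
  have "(cmod (a - c))\<^sup>2 \<le> 2 * (cmod (a - b))\<^sup>2 + 2 * (cmod (b - c))\<^sup>2" for a b c :: complex
  proof -
    have "(cmod (a - c))\<^sup>2 \<le> (cmod (a - b) + cmod (b - c))\<^sup>2"
      using norm_triangle_ineq[of "a - b" "b - c"] by (intro power_mono) auto
    also have "\<dots> \<le> 2 * (cmod (a - b))\<^sup>2 + 2 * (cmod (b - c))\<^sup>2"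
      using sum_squares_bound[of "cmod (a - b)" "cmod (b - c)"] by (simp add: power2_sum)
    finally show ?thesis .
  qed
  then have "L2_sq (\<lambda>x. f x - h x)
      \<le> (\<integral>\<^sup>+x. ennreal (2 * (cmod (f x - g x))\<^sup>2 + 2 * (cmod (g x - h x))\<^sup>2) \<partial>lebesgue)"
    unfolding L2_sq_def by (intro nn_integral_mono ennreal_leI) auto
  also have "\<dots> = 2 * L2_sq (\<lambda>x. f x - g x) + 2 * L2_sq (\<lambda>x. g x - h x)"
    unfolding L2_sq_def
    by (simp add: ennreal_mult nn_integral_add nn_integral_cmult)
  finally show ?thesis .
qed

lemma square_integrable_iff:
  "square_integrable f \<longleftrightarrow> f \<in> borel_measurable lebesgue \<and> L2_sq f < \<infinity>"
  by (auto simp: square_integrable_def L2_sq_def integrable_iff_bounded)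

lemma square_integrable_measurable: "square_integrable f \<Longrightarrow> f \<in> borel_measurable lebesgue"
  by (simp add: square_integrable_def)

lemma L2_sq_diff_eq_0_AE:
  assumes [measurable]: "f \<in> borel_measurable lebesgue" "g \<in> borel_measurable lebesgue"
    and "L2_sq (\<lambda>x. f x - g x) = 0"
  shows "AE x in lebesgue. f x = g x"
proof -
  have "AE x in lebesgue. ennreal ((cmod (f x - g x))\<^sup>2) = 0"
    using assms(3) unfolding L2_sq_def by (subst (asm) nn_integral_0_iff_AE) auto
  then show ?thesis by eventually_elim (auto simp: ennreal_eq_0_iff)
qed

lemma square_integrable_from_diff:
  assumes g: "square_integrable g" and f: "f \<in> borel_measurable lebesgue"
    and fin: "L2_sq (\<lambda>x. f x - g x) < \<infinity>"
  shows "square_integrable f"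
proof -
  have "L2_sq f \<le> 2 * L2_sq (\<lambda>x. f x - g x) + 2 * L2_sq g"
    using L2_sq_triangle[of f g "\<lambda>_. 0"] f g by (simp add: square_integrable_iff)
  also have "\<dots> < \<infinity>"
    using fin g by (simp add: square_integrable_iff ennreal_mult_less_top)
  finally show ?thesis using f by (simp add: square_integrable_iff)
qed

text \<open>Riesz-Fischer with an explicit rate: the Cauchy condition and the conclusion share the
  bound \<open>e m\<close>. A subsequence with consecutive squared distances at most
  \<open>(1/4) ^ n\<close> converges almost everywhere, and Fatou transfers the bound to its
  limit.\<close>

lemma L2_sq_complete:
  fixes g :: "nat \<Rightarrow> real^3 \<Rightarrow> complex" and e :: "nat \<Rightarrow> ennreal"
  assumes g [measurable]: "\<And>n. g n \<in> borel_measurable lebesgue"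
    and ge: "\<And>m n. m \<le> n \<Longrightarrow> L2_sq (\<lambda>x. g n x - g m x) \<le> e m"
    and e: "e \<longlonglongrightarrow> 0"
  obtains F where "F \<in> borel_measurable lebesgue" "\<And>m. L2_sq (\<lambda>x. g m x - F x) \<le> e m"
proof -
  have "\<exists>N. \<forall>m\<ge>N. e m < ennreal ((1/4) ^ n)" for n
    using order_tendstoD(2)[OF e, of "ennreal ((1/4) ^ n)"] by (auto simp: eventually_sequentially)
  then obtain N where N: "\<And>n m. N n \<le> m \<Longrightarrow> e m < ennreal ((1/4) ^ n)" by metis
  \<comment> \<open>Adding all thresholds up to \<open>n\<close> makes \<open>r\<close> increasing
    with both \<open>n \<le> r n\<close> and \<open>N n \<le> r n\<close>.\<close>
  define r where "r n = n + (\<Sum>i\<le>n. N i)" for n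
  have r: "r n \<le> r (Suc n)" "n \<le> r n" "N n \<le> r n" for n
    by (auto simp: r_def intro: trans_le_add2 member_le_sum)
  define d where "d n x = g (r (Suc n)) x - g (r n) x" for n x
  have [measurable]: "d n \<in> borel_measurable lebesgue" for n
    unfolding d_def by measurable
  have d: "L2_sq (d n) \<le> ennreal ((1/4) ^ n)" for n
    using order_trans[OF ge[OF r(1)] less_imp_le[OF N[OF r(3)]]] by (simp add: d_def[abs_def])
  \<comment> \<open>The weight \<open>2 ^ n\<close> still leaves a convergent series against
    \<open>(1/4) ^ n\<close>. Where the weighted sum is finite, the arithmetic-geometric inequality
    with weights \<open>2 powr (n/2)\<close> and its inverse bounds \<open>cmod (d n x)\<close> by a
    summable sequence.\<close>
  have "(\<integral>\<^sup>+x. (\<Sum>n. ennreal (2 ^ n * (cmod (d n x))\<^sup>2)) \<partial>lebesgue) = (\<Sum>n. ennreal (2 ^ n) * L2_sq (d n))"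
    unfolding L2_sq_def by (simp add: nn_integral_suminf nn_integral_cmult ennreal_mult)
  also have "\<dots> \<le> (\<Sum>n. ennreal ((1/2) ^ n))"
  proof (intro suminf_le allI)
    fix n
    have "ennreal (2 ^ n) * L2_sq (d n) \<le> ennreal (2 ^ n) * ennreal ((1/4) ^ n)"
      by (intro mult_left_mono d) auto
    also have "\<dots> = ennreal ((1/2) ^ n)"
      by (simp add: ennreal_mult[symmetric] power_mult_distrib[symmetric])
    finally show "ennreal (2 ^ n) * L2_sq (d n) \<le> ennreal ((1/2) ^ n)" .
  qed auto
  also have "\<dots> = ennreal (\<Sum>n. (1/2) ^ n)"
    by (rule suminf_ennreal2) (auto intro: summable_geometric)
  also have "\<dots> < \<infinity>" by simp
  finally have "AE x in lebesgue. (\<Sum>n. ennreal (2 ^ n * (cmod (d n x))\<^sup>2)) \<noteq> \<infinity>"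
    by (intro nn_integral_PInf_AE) (auto simp: less_top)
  then have lim: "AE x in lebesgue. (\<lambda>n. g (r n) x) \<longlonglongrightarrow> lim (\<lambda>n. g (r n) x)"
  proof eventually_elim
    fix x assume "(\<Sum>n. ennreal (2 ^ n * (cmod (d n x))\<^sup>2)) \<noteq> \<infinity>"
    then have "summable (\<lambda>n. 2 ^ n * (cmod (d n x))\<^sup>2)"
      by (intro summable_suminf_not_top) auto
    then have s: "summable (\<lambda>n. (2 ^ n * (cmod (d n x))\<^sup>2 + (1/2) ^ n) / 2)"
      by (intro summable_divide summable_add summable_geometric) auto
    have "summable (\<lambda>n. d n x)"
    proof (rule summable_comparison_test'[OF s])
      fix n :: nat
      have "2 * cmod (d n x) = 2 * (2 powr (n/2) * cmod (d n x)) * (2 powr (- (n/2)))"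
        by (simp add: powr_minus field_simps)
      also have "\<dots> \<le> (2 powr (n/2) * cmod (d n x))\<^sup>2 + (2 powr (- (n/2)))\<^sup>2"
        by (rule sum_squares_bound)
      also have "\<dots> = 2 ^ n * (cmod (d n x))\<^sup>2 + (1/2) ^ n"
        by (simp add: power_mult_distrib powr_power powr_realpow powr_minus_divide power_one_over)
      finally show "norm (d n x) \<le> (2 ^ n * (cmod (d n x))\<^sup>2 + (1/2) ^ n) / 2" by simp
    qed
    then have "convergent (\<lambda>n. \<Sum>i<n. d i x)"
      by (simp add: summable_iff_convergent)
    then have "convergent (\<lambda>n. (\<Sum>i<n. d i x) + g (r 0) x)"
      by (intro convergent_add convergent_const)
    moreover have "(\<Sum>i<n. d i x) + g (r 0) x = g (r n) x" for n
      unfolding d_def by (simp add: sum_lessThan_telescope[where f="\<lambda>n. g (r n) x"])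
    ultimately show "(\<lambda>n. g (r n) x) \<longlonglongrightarrow> lim (\<lambda>n. g (r n) x)"
      by (simp add: convergent_LIMSEQ_iff)
  qed
  show thesis
  proof
    show [measurable]: "(\<lambda>x. lim (\<lambda>n. g (r n) x)) \<in> borel_measurable lebesgue"
      by (rule borel_measurable_lim_metric) measurable
    fix m
    show "L2_sq (\<lambda>x. g m x - lim (\<lambda>n. g (r n) x)) \<le> e m"
      unfolding L2_sq_def
    proof (rule nn_integral_le_of_tendsto)
      \<comment> \<open>The index \<open>r (n + m)\<close> is at least \<open>m\<close>, so
        \<open>ge\<close> applies to every term of the shifted sequence.\<close>
      show "AE x in lebesgue. (\<lambda>n. ennreal ((cmod (g m x - g (r (n + m)) x))\<^sup>2))
          \<longlonglongrightarrow> ennreal ((cmod (g m x - lim (\<lambda>n. g (r n) x)))\<^sup>2)"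
        using lim by eventually_elim
          (intro tendsto_ennrealI tendsto_intros LIMSEQ_ignore_initial_segment)
      show "(\<integral>\<^sup>+x. ennreal ((cmod (g m x - g (r (n + m)) x))\<^sup>2) \<partial>lebesgue) \<le> e m" for n
        using ge[of m "r (n + m)"] r(2)[of "n + m"] L2_sq_minus_commute[of "g m" "g (r (n + m))"]
        by (simp add: L2_sq_def)
    qed auto
  qed
qed

section \<open>Truncations; existence, stability and uniqueness of the L2 transform\<close>

definition truncate :: "nat \<Rightarrow> (real^3 \<Rightarrow> complex) \<Rightarrow> real^3 \<Rightarrow> complex" where
  "truncate n f = (\<lambda>x. indicator (cball 0 (real n)) x *\<^sub>R f x)"

lemma is_L2_fourier_L2_sq:
  "is_L2_fourier f F \<longleftrightarrow> square_integrable F \<and>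
     (\<lambda>n. L2_sq (\<lambda>\<xi>. fourier_integral (truncate n f) \<xi> - F \<xi>)) \<longlonglongrightarrow> 0"
  by (simp add: is_L2_fourier_def L2_sq_def truncate_def)

text \<open>On a ball the constant 1 is integrable, and
  \<open>cmod z \<le> 1 + (cmod z)\<^sup>2\<close>. Thus truncations have classical Fourier
  integrals.\<close>

lemma square_integrable_bounded_support:
  assumes f: "square_integrable f" and S: "AE x in lebesgue. x \<notin> cball 0 R \<longrightarrow> f x = 0"
  shows "integrable lebesgue f"
proof (rule Bochner_Integration.integrable_bound)
  show "integrable lebesgue (\<lambda>x. indicator (cball 0 R :: (real^3) set) x + (cmod (f x))\<^sup>2)"
    using f by (intro Bochner_Integration.integrable_add)
      (auto simp: square_integrable_def lmeasurable_iff_integrable[symmetric])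
  have "cmod z \<le> 1 + (cmod z)\<^sup>2" for z
    using zero_le_power2[of "cmod z - 1/2"] by (simp add: power2_diff power_divide)
  then show "AE x in lebesgue. norm (f x) \<le> norm (indicator (cball 0 R :: (real^3) set) x + (cmod (f x))\<^sup>2)"
    using S by (auto simp: indicator_def)
qed (use f in \<open>simp add: square_integrable_def\<close>)

lemma truncate_measurable:
  "f \<in> borel_measurable lebesgue \<Longrightarrow> truncate n f \<in> borel_measurable lebesgue"
  unfolding truncate_def
  by (rule borel_measurable_scaleR, rule measurable_completion) (auto intro: borel_measurable_indicator)

lemma cmod_truncate_le: "cmod (truncate n f x) \<le> cmod (f x)"
  by (simp add: truncate_def indicator_def)

lemma square_integrable_mono:
  assumes "square_integrable f" "g \<in> borel_measurable lebesgue" "\<And>x. cmod (g x) \<le> cmod (f x)"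
  shows "square_integrable g"
  using assms L2_sq_mono[of g f] by (auto simp: square_integrable_iff intro: le_less_trans)

lemma square_integrable_truncate: "square_integrable f \<Longrightarrow> square_integrable (truncate n f)"
  by (rule square_integrable_mono)
     (auto intro: truncate_measurable cmod_truncate_le square_integrable_measurable)

lemma integrable_truncate: "square_integrable f \<Longrightarrow> integrable lebesgue (truncate n f)"
  by (rule square_integrable_bounded_support[of _ "real n"], rule square_integrable_truncate)
     (auto simp: truncate_def)

lemma L2_sq_dominated_tendsto:
  assumes [measurable]: "\<And>n. u n \<in> borel_measurable lebesgue" and F: "square_integrable F"
    and dom: "\<And>n x. cmod (u n x) \<le> cmod (F x)"
    and lim: "AE x in lebesgue. (\<lambda>n. u n x) \<longlonglongrightarrow> 0"
  shows "(\<lambda>n. L2_sq (u n)) \<longlonglongrightarrow> 0"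
proof -
  have [measurable]: "F \<in> borel_measurable lebesgue"
    using F by (rule square_integrable_measurable)
  have "(\<lambda>n. L2_sq (u n)) \<longlonglongrightarrow> (\<integral>\<^sup>+(x::real^3). 0 \<partial>lebesgue)"
    unfolding L2_sq_def
  proof (rule nn_integral_dominated_convergence[where w="\<lambda>x. ennreal ((cmod (F x))\<^sup>2)"])
    show "(\<integral>\<^sup>+x. ennreal ((cmod (F x))\<^sup>2) \<partial>lebesgue) < \<infinity>"
      using F by (simp add: square_integrable_iff L2_sq_def)
    show "AE x in lebesgue. (\<lambda>n. ennreal ((cmod (u n x))\<^sup>2)) \<longlonglongrightarrow> 0"
      using lim
    proof eventually_elim
      fix x assume "(\<lambda>n. u n x) \<longlonglongrightarrow> 0"
      then have "(\<lambda>n. ennreal ((cmod (u n x))\<^sup>2)) \<longlonglongrightarrow> ennreal ((cmod 0)\<^sup>2)"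
        by (intro tendsto_ennrealI tendsto_intros)
      then show "(\<lambda>n. ennreal ((cmod (u n x))\<^sup>2)) \<longlonglongrightarrow> 0" by simp
    qed
  qed (auto intro!: ennreal_leI power_mono dom)
  then show ?thesis by simp
qed

lemma truncate_tendsto: "(\<lambda>n. truncate n f x) \<longlonglongrightarrow> f x"
proof (rule tendsto_eventually)
  obtain N :: nat where "norm x \<le> real N"
    using real_arch_simple by blast
  then show "\<forall>\<^sub>F n in sequentially. truncate n f x = f x"
    by (auto simp: eventually_sequentially truncate_def intro!: exI[of _ N])
qed

lemma L2_sq_truncate_tendsto:
  assumes f: "square_integrable f"
  shows "(\<lambda>n. L2_sq (\<lambda>x. truncate n f x - f x)) \<longlonglongrightarrow> 0"
proof (rule L2_sq_dominated_tendsto[OF _ f])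
  show "(\<lambda>x. truncate n f x - f x) \<in> borel_measurable lebesgue" for n
    by (intro borel_measurable_diff truncate_measurable square_integrable_measurable[OF f])
  show "cmod (truncate n f x - f x) \<le> cmod (f x)" for n x
    by (auto simp: truncate_def indicator_def)
  show "AE x in lebesgue. (\<lambda>n. truncate n f x - f x) \<longlonglongrightarrow> 0"
    using truncate_tendsto by (auto intro!: AE_I2 simp: LIM_zero)
qed

lemma tendsto_zero_cmult_ennreal:
  fixes u :: "nat \<Rightarrow> ennreal"
  shows "u \<longlonglongrightarrow> 0 \<Longrightarrow> c < top \<Longrightarrow> (\<lambda>n. c * u n) \<longlonglongrightarrow> 0"
  using ennreal_tendsto_cmult[of c u 0] by simp

lemma tendsto_zero_sandwich_ennreal:
  fixes u v :: "nat \<Rightarrow> ennreal"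
  shows "v \<longlonglongrightarrow> 0 \<Longrightarrow> (\<And>n. u n \<le> v n) \<Longrightarrow> u \<longlonglongrightarrow> 0"
  by (rule tendsto_sandwich[of "\<lambda>_. 0" _ _ v]) auto

lemma fourier_measurable_lebesgue:
  "f \<in> borel_measurable lebesgue \<Longrightarrow> fourier_integral f \<in> borel_measurable lebesgue"
  by (rule measurable_completion) (simp add: borel_measurable_fourier_integral)

lemma bessel_diff:
  assumes "integrable lebesgue f" "integrable lebesgue g"
  shows "L2_sq (\<lambda>\<xi>. fourier_integral f \<xi> - fourier_integral g \<xi>)
    \<le> ennreal ((2 * pi) ^ 3) * L2_sq (\<lambda>x. f x - g x)"
proof -
  have "fourier_integral (\<lambda>x. f x - g x) = (\<lambda>\<xi>. fourier_integral f \<xi> - fourier_integral g \<xi>)"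
    by (rule ext) (rule fourier_integral_diff[OF assms])
  then show ?thesis
    using bessel_inequality[of "\<lambda>x. f x - g x"] assms by simp
qed

text \<open>For \<open>m \<le> n\<close> two truncations differ by at most the tail of
  \<open>f\<close> outside radius \<open>m\<close>, so Bessel makes their transforms a Cauchy
  sequence with rate \<open>e\<close>.\<close>

lemma L2_fourier_exists:
  assumes f: "square_integrable f"
  shows "\<exists>F. is_L2_fourier f F"
proof -
  define e where "e m = ennreal ((2 * pi) ^ 3) * L2_sq (\<lambda>x. truncate m f x - f x)" for m
  have e: "e \<longlonglongrightarrow> 0"
    unfolding e_def[abs_def] by (intro tendsto_zero_cmult_ennreal L2_sq_truncate_tendsto f) simp
  have m: "fourier_integral (truncate n f) \<in> borel_measurable lebesgue" for n
    by (intro fourier_measurable_lebesgue truncate_measurable square_integrable_measurable f)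
  have ge: "L2_sq (\<lambda>x. fourier_integral (truncate n f) x - fourier_integral (truncate m f) x) \<le> e m"
    if mn: "m \<le> n" for m n
  proof -
    have "L2_sq (\<lambda>x. truncate n f x - truncate m f x) \<le> L2_sq (\<lambda>x. truncate m f x - f x)"
      by (rule L2_sq_mono) (use mn in \<open>auto simp: truncate_def indicator_def\<close>)
    then show ?thesis
      unfolding e_def by (intro order_trans[OF bessel_diff] mult_left_mono integrable_truncate f) auto
  qed
  obtain F where F: "F \<in> borel_measurable lebesgue"
    "\<And>m. L2_sq (\<lambda>x. fourier_integral (truncate m f) x - F x) \<le> e m"
    using L2_sq_complete[OF m ge e] by blast
  \<comment> \<open>\<open>F\<close> is at finite distance from the transform of the truncation of
    radius 0, which is square integrable by Bessel.\<close>
  have "square_integrable F"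
  proof (rule square_integrable_from_diff[OF _ F(1)])
    show "square_integrable (fourier_integral (truncate 0 f))"
      using bessel_inequality[OF integrable_truncate[OF f, of 0]] m[of 0] square_integrable_truncate[OF f, of 0]
      by (auto simp: square_integrable_iff ennreal_mult_less_top intro: le_less_trans)
    have "L2_sq (\<lambda>x. truncate 0 f x - f x) \<le> L2_sq f"
      by (rule L2_sq_mono) (simp add: truncate_def indicator_def)
    then have "e 0 < \<infinity>"
      using f by (auto simp: e_def square_integrable_iff ennreal_mult_less_top intro: le_less_trans)
    then show "L2_sq (\<lambda>x. F x - fourier_integral (truncate 0 f) x) < \<infinity>"
      using F(2)[of 0] L2_sq_minus_commute[of F] by (auto intro: le_less_trans)
  qed
  then have "is_L2_fourier f F"
    unfolding is_L2_fourier_L2_sq using tendsto_zero_sandwich_ennreal[OF e F(2)] by simp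
  then show ?thesis by blast
qed

lemma is_L2_fourier_L2_fourier: "square_integrable f \<Longrightarrow> is_L2_fourier f (L2_fourier f)"
  unfolding L2_fourier_def using someI_ex[OF L2_fourier_exists] .

lemma square_integrable_L2_fourier: "square_integrable f \<Longrightarrow> square_integrable (L2_fourier f)"
  using is_L2_fourier_L2_fourier is_L2_fourier_def by blast

text \<open>Bessel holds for the truncations and survives the limit. Stated for arbitrary
  representatives, this Lipschitz bound yields uniqueness when \<open>f = g\<close> and otherwise
  transports approximations, so that linearity of the chosen transforms is never invoked. The 4
  comes from two squared triangle inequalities.\<close>

lemma is_L2_fourier_diff:
  assumes f: "square_integrable f" "is_L2_fourier f F" and g: "square_integrable g" "is_L2_fourier g G"
  shows "L2_sq (\<lambda>x. F x - G x) \<le> 4 * ennreal ((2 * pi) ^ 3) * L2_sq (\<lambda>x. f x - g x)"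
proof -
  let ?F = "\<lambda>n. fourier_integral (truncate n f)" and ?G = "\<lambda>n. fourier_integral (truncate n g)"
  let ?D = "4 * ennreal ((2 * pi) ^ 3) * L2_sq (\<lambda>x. f x - g x)"
  let ?a = "\<lambda>n. 2 * L2_sq (\<lambda>x. ?F n x - F x)" and ?b = "\<lambda>n. 4 * L2_sq (\<lambda>x. ?G n x - G x)"
  have meas: "F \<in> borel_measurable lebesgue" "G \<in> borel_measurable lebesgue"
    "?F n \<in> borel_measurable lebesgue" "?G n \<in> borel_measurable lebesgue" for n
    using f g by (auto simp: is_L2_fourier_def square_integrable_def
        intro!: fourier_measurable_lebesgue truncate_measurable)
  have le: "L2_sq (\<lambda>x. F x - G x) \<le> ?a n + (?D + ?b n)" for n
  proof -
    have "L2_sq (\<lambda>x. ?F n x - ?G n x) \<le> ennreal ((2 * pi) ^ 3) * L2_sq (\<lambda>x. truncate n f x - truncate n g x)"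
      by (intro bessel_diff integrable_truncate f g)
    also have "\<dots> \<le> ennreal ((2 * pi) ^ 3) * L2_sq (\<lambda>x. f x - g x)"
      by (intro mult_left_mono L2_sq_mono) (auto simp: truncate_def indicator_def)
    finally have 1: "4 * L2_sq (\<lambda>x. ?F n x - ?G n x) \<le> ?D"
      using mult_left_mono[of _ _ "4::ennreal"] by (simp add: mult.assoc)
    have 2: "L2_sq (\<lambda>x. ?F n x - G x) \<le> 2 * L2_sq (\<lambda>x. ?F n x - ?G n x) + 2 * L2_sq (\<lambda>x. ?G n x - G x)"
      by (rule L2_sq_triangle) (rule meas)+
    have "L2_sq (\<lambda>x. F x - G x) \<le> 2 * L2_sq (\<lambda>x. F x - ?F n x) + 2 * L2_sq (\<lambda>x. ?F n x - G x)"
      by (rule L2_sq_triangle) (rule meas)+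
    also have "\<dots> \<le> ?a n + 2 * (2 * L2_sq (\<lambda>x. ?F n x - ?G n x) + 2 * L2_sq (\<lambda>x. ?G n x - G x))"
      using L2_sq_minus_commute[of F "?F n"] by (intro add_mono mult_left_mono 2) auto
    also have "\<dots> = ?a n + (4 * L2_sq (\<lambda>x. ?F n x - ?G n x) + ?b n)"
      by (simp add: distrib_left mult.assoc[symmetric])
    also have "\<dots> \<le> ?a n + (?D + ?b n)"
      by (intro add_mono 1) auto
    finally show ?thesis .
  qed
  have "(\<lambda>n. ?a n + (?D + ?b n)) \<longlonglongrightarrow> 0 + (?D + 0)"
    using f(2) g(2) unfolding is_L2_fourier_L2_sq
    by (intro tendsto_add tendsto_const tendsto_zero_cmult_ennreal) auto
  then show ?thesis
    using le by (intro LIMSEQ_le_const[of _ ?D]) auto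
qed

lemma is_L2_fourier_unique:
  assumes "square_integrable f" "is_L2_fourier f F" "is_L2_fourier f G"
  shows "AE x in lebesgue. F x = G x"
proof (rule L2_sq_diff_eq_0_AE)
  have "L2_sq (\<lambda>x. f x - f x) = 0" by (simp add: L2_sq_def)
  then show "L2_sq (\<lambda>x. F x - G x) = 0"
    using is_L2_fourier_diff[OF assms(1,2) assms(1,3)] by simp
qed (use assms in \<open>auto simp: is_L2_fourier_def square_integrable_def\<close>)

text \<open>The equality is exact, not almost everywhere: both functions have the same truncated
  Fourier integrals, so \<open>SOME\<close> chooses from the same predicate.\<close>

lemma L2_fourier_cong_AE:
  assumes "f \<in> borel_measurable lebesgue" "AE x in lebesgue. f x = g x"
  shows "L2_fourier f = L2_fourier g"
proof -
  have "fourier_integral (truncate n f) = fourier_integral (truncate n g)" for n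
    by (rule fourier_integral_cong_AE) (use assms in \<open>auto simp: truncate_def intro!: truncate_measurable[unfolded truncate_def]\<close>)
  then show ?thesis
    by (simp add: L2_fourier_def is_L2_fourier_L2_sq)
qed

text \<open>The truncations converge to \<open>f\<close> in L2, and Bessel carries this over to the
  classical integrals; uniqueness then identifies the chosen representative.\<close>

lemma L2_fourier_eq_fourier_integral:
  assumes f: "square_integrable f" and i: "integrable lebesgue f"
  shows "is_L2_fourier f (fourier_integral f)"
    and "AE x in lebesgue. L2_fourier f x = fourier_integral f x"
proof -
  have m: "fourier_integral f \<in> borel_measurable lebesgue"
    by (intro fourier_measurable_lebesgue square_integrable_measurable f)
  have "square_integrable (fourier_integral f)"
    using bessel_inequality[OF i] f m by (auto simp: square_integrable_iff ennreal_mult_less_top intro: le_less_trans)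
  moreover have "(\<lambda>n. L2_sq (\<lambda>\<xi>. fourier_integral (truncate n f) \<xi> - fourier_integral f \<xi>)) \<longlonglongrightarrow> 0"
    by (rule tendsto_zero_sandwich_ennreal[OF tendsto_zero_cmult_ennreal[OF L2_sq_truncate_tendsto[OF f]]])
       (auto intro: bessel_diff integrable_truncate f i)
  ultimately show *: "is_L2_fourier f (fourier_integral f)"
    by (simp add: is_L2_fourier_L2_sq)
  show "AE x in lebesgue. L2_fourier f x = fourier_integral f x"
    by (rule is_L2_fourier_unique[OF f is_L2_fourier_L2_fourier[OF f] *])
qed

section \<open>Fourier inversion on \<open>L\<^sup>2\<close>\<close>

lemma measurable_lebesgue_uminus: "(uminus :: 'a::euclidean_space \<Rightarrow> 'a) \<in> lebesgue \<rightarrow>\<^sub>M lebesgue"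
proof -
  have "scaleR (-1) = (uminus :: 'a \<Rightarrow> 'a)" by auto
  then show ?thesis using lebesgue_measurable_scaling[of "-1", where 'a='a] by simp
qed

lemma distr_lebesgue_uminus: "distr lebesgue lebesgue (uminus :: 'a::euclidean_space \<Rightarrow> 'a) = lebesgue"
proof -
  have T: "(\<lambda>x::'a. 0 + (\<Sum>j\<in>Basis. (- 1 * (x \<bullet> j)) *\<^sub>R j)) = uminus"
    by (auto simp: fun_eq_iff sum_negf euclidean_representation)
  have "lebesgue = density (distr lebesgue lebesgue (uminus :: 'a \<Rightarrow> 'a)) (\<lambda>_. (\<Prod>j\<in>(Basis :: 'a set). \<bar>- 1 :: real\<bar>))"
    using lebesgue_affine_euclidean[of "\<lambda>_. -1" "0::'a"] unfolding T by simp
  then show ?thesis by (simp add: density_1)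
qed

lemma AE_lebesgue_uminus:
  fixes P :: "'a::euclidean_space \<Rightarrow> bool"
  assumes "AE x in lebesgue. P x" shows "AE x in lebesgue. P (- x)"
  by (rule AE_distrD[OF measurable_lebesgue_uminus]) (unfold distr_lebesgue_uminus, rule assms)

lemma measurable_reflect:
  fixes f :: "'a::euclidean_space \<Rightarrow> 'b::topological_space"
  assumes "f \<in> borel_measurable lebesgue"
  shows "(\<lambda>x. f (- x)) \<in> borel_measurable lebesgue"
  using measurable_compose[OF measurable_lebesgue_uminus assms] by simp

lemma integral_reflect:
  fixes f :: "'a::euclidean_space \<Rightarrow> 'b::{banach, second_countable_topology}"
  assumes "f \<in> borel_measurable lebesgue"
  shows "(\<integral>x. f (- x) \<partial>lebesgue) = (\<integral>x. f x \<partial>lebesgue)"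
proof -
  have "(\<integral>x. f x \<partial>distr lebesgue lebesgue uminus) = (\<integral>x. f (- x) \<partial>lebesgue)"
    by (rule integral_distr[OF measurable_lebesgue_uminus assms])
  then show ?thesis by (simp add: distr_lebesgue_uminus)
qed

lemma L2_sq_reflect:
  assumes [measurable]: "f \<in> borel_measurable lebesgue"
  shows "L2_sq (\<lambda>x. f (- x)) = L2_sq f"
proof -
  have "(\<integral>\<^sup>+x. ennreal ((cmod (f x))\<^sup>2) \<partial>distr lebesgue lebesgue uminus) = L2_sq (\<lambda>x. f (- x))"
    unfolding L2_sq_def by (rule nn_integral_distr[OF measurable_lebesgue_uminus]) measurable
  then show ?thesis by (simp add: distr_lebesgue_uminus L2_sq_def)
qed

text \<open>The passage from transform to inverse transform in \<open>L2_inverse_fourier\<close>,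
  isolated so that it also applies to explicit representatives such as
  \<open>fourier_integral h\<close>.\<close>

definition reflect_scaled :: "(real^3 \<Rightarrow> complex) \<Rightarrow> real^3 \<Rightarrow> complex" where
  "reflect_scaled F x = F (- x) /\<^sub>R (2 * pi) ^ 3"

lemma norm_divideR: "0 < c \<Longrightarrow> norm (z /\<^sub>R c) = norm z / c"
  by (simp add: divide_inverse mult.commute)

lemma cmod_reflect_scaled: "cmod (reflect_scaled F x) = cmod (F (- x)) / (2 * pi) ^ 3"
  unfolding reflect_scaled_def by (rule norm_divideR) simp

lemma L2_inverse_fourier_eq: "L2_inverse_fourier G = reflect_scaled (L2_fourier G)"
  by (auto simp: fun_eq_iff L2_inverse_fourier_def reflect_scaled_def)

lemma reflect_scaled_measurable:
  "F \<in> borel_measurable lebesgue \<Longrightarrow> reflect_scaled F \<in> borel_measurable lebesgue"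
  unfolding reflect_scaled_def[abs_def]
  by (intro borel_measurable_scaleR borel_measurable_const measurable_reflect)

lemma two_pi_cube_ge_1: "1 \<le> (2 * pi) ^ 3"
  using pi_gt3 by (intro one_le_power) simp

text \<open>Reflection preserves the measure, and the factor \<open>1 / (2 * pi) ^ 3\<close> is at
  most 1 and is discarded.\<close>

lemma L2_sq_reflect_scaled_le:
  assumes "F \<in> borel_measurable lebesgue" "G \<in> borel_measurable lebesgue"
  shows "L2_sq (\<lambda>x. reflect_scaled F x - reflect_scaled G x) \<le> L2_sq (\<lambda>x. F x - G x)"
proof -
  have "L2_sq (\<lambda>x. reflect_scaled F x - reflect_scaled G x) \<le> L2_sq (\<lambda>x. F (- x) - G (- x))"
  proof (rule L2_sq_mono)
    fix x
    have "cmod (reflect_scaled F x - reflect_scaled G x) = cmod (F (- x) - G (- x)) / (2 * pi) ^ 3"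
    proof -
      have "reflect_scaled F x - reflect_scaled G x = reflect_scaled (\<lambda>x. F x - G x) x"
        unfolding reflect_scaled_def by (rule scaleR_diff_right[symmetric])
      then show ?thesis by (simp only: cmod_reflect_scaled)
    qed
    also have "\<dots> \<le> cmod (F (- x) - G (- x)) / 1"
      by (rule divide_left_mono) (use two_pi_cube_ge_1 in auto)
    finally show "cmod (reflect_scaled F x - reflect_scaled G x) \<le> cmod (F (- x) - G (- x))" by simp
  qed
  also have "\<dots> = L2_sq (\<lambda>x. F x - G x)"
    by (rule L2_sq_reflect[of "\<lambda>x. F x - G x"]) (use assms in measurable)
  finally show ?thesis .
qed

lemma square_integrable_reflect_scaled:
  assumes "square_integrable F" shows "square_integrable (reflect_scaled F)"
proof -
  have [simp]: "reflect_scaled (\<lambda>x. 0) x = 0" for x by (simp add: reflect_scaled_def)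
  show ?thesis
    using L2_sq_reflect_scaled_le[of F "\<lambda>x. 0"] reflect_scaled_measurable[of F] assms
    by (auto simp: square_integrable_iff intro: le_less_trans)
qed

lemma square_integrable_bounded:
  assumes "f \<in> borel_measurable lebesgue" "\<And>x. cmod (f x) \<le> B" "\<And>x. x \<notin> cball 0 r \<Longrightarrow> f x = 0"
  shows "square_integrable f"
  unfolding square_integrable_def
proof
  show "integrable lebesgue (\<lambda>x. (cmod (f x))\<^sup>2)"
  proof (rule Bochner_Integration.integrable_bound)
    show "integrable lebesgue (\<lambda>x. B\<^sup>2 * indicator (cball 0 r :: (real^3) set) x)"
      by (intro integrable_mult_right) (auto simp: lmeasurable_iff_integrable[symmetric])
    show "AE x in lebesgue. norm ((cmod (f x))\<^sup>2) \<le> norm (B\<^sup>2 * indicator (cball 0 r :: (real^3) set) x)"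
      using assms(2,3) by (auto simp: indicator_def intro!: AE_I2 power_mono)
  qed (use assms(1) in measurable)
qed (rule assms(1))

lemma tendsto_zero_ex_less:
  fixes u :: "nat \<Rightarrow> ennreal"
  assumes "u \<longlonglongrightarrow> 0" "0 < e" obtains n where "u n < e"
  using order_tendstoD(2)[OF assms] by (auto simp: eventually_sequentially)

text \<open>Cutting in space and in values leaves a bounded \<open>g n\<close> near
  \<open>G\<close>. A measurable function is an almost everywhere limit of continuous ones; forcing
  these into a fixed ball and a fixed range makes dominated convergence applicable.\<close>

lemma continuous_dense_L2:
  fixes e :: ennreal
  assumes G: "square_integrable G" and e: "0 < e"
  obtains h r where "continuous_on UNIV h" "\<And>x. x \<notin> cball 0 r \<Longrightarrow> h x = 0"
    "L2_sq (\<lambda>x. G x - h x) \<le> 4 * e"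
proof -
  have Gm [measurable]: "G \<in> borel_measurable lebesgue"
    using G by (rule square_integrable_measurable)
  have [measurable]: "(\<lambda>x::real^3. norm x) \<in> borel_measurable lebesgue"
    by (rule measurable_completion) measurable
  define g where "g n x = (if norm x \<le> real n \<and> cmod (G x) \<le> real n then G x else 0)" for n x
  have gm [measurable]: "g n \<in> borel_measurable lebesgue" for n
    unfolding g_def by measurable
  have gG: "(\<lambda>n. L2_sq (\<lambda>x. g n x - G x)) \<longlonglongrightarrow> 0"
  proof (rule L2_sq_dominated_tendsto[OF _ G])
    show "AE x in lebesgue. (\<lambda>n. g n x - G x) \<longlonglongrightarrow> 0"
    proof (rule AE_I2, rule tendsto_eventually)
      fix x
      obtain N :: nat where "max (norm x) (cmod (G x)) \<le> real N"
        using real_arch_simple by blast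
      then show "\<forall>\<^sub>F n in sequentially. g n x - G x = 0"
        by (auto simp: eventually_sequentially g_def intro!: exI[of _ N])
    qed
  qed (auto simp: g_def)
  then obtain n where n: "L2_sq (\<lambda>x. g n x - G x) < e"
    using tendsto_zero_ex_less[OF _ e] by blast
  have "g n measurable_on UNIV"
    using measurable_on_iff_borel_measurable[of UNIV "g n"] gm[of n] by (simp add: lebesgue_on_UNIV_eq)
  then obtain N c where N: "negligible N" and c: "\<And>k. continuous_on UNIV (c k)"
    and lim: "\<And>x. x \<notin> N \<Longrightarrow> (\<lambda>k. c k x) \<longlonglongrightarrow> g n x"
    unfolding measurable_on_def by auto
  \<comment> \<open>The extra 1 leaves room for \<open>\<phi>\<close> to descend from 1 on the ball
    of radius \<open>n\<close>, where \<open>g n\<close> lives, to 0 at radius \<open>B\<close>.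
    Hence cutting and clamping leave \<open>g n\<close> itself unchanged.\<close>
  define B where "B = real n + 1"
  define clamp where "clamp z = (B / max B (cmod z)) *\<^sub>R z" for z
  define \<phi> where "\<phi> x = max 0 (min 1 (B - norm x))" for x :: "real^3"
  define h where "h k x = \<phi> x *\<^sub>R clamp (c k x)" for k x
  have B: "B > 0" by (simp add: B_def)
  then have Bmax: "max B y \<noteq> 0" for y by (simp add: max_def)
  have clamp_le: "cmod (clamp z) \<le> B" for z
    using B by (auto simp: clamp_def field_simps max_def)
  have cont: "continuous_on UNIV (h k)" for k
    unfolding h_def clamp_def \<phi>_def using c Bmax
    by (intro continuous_intros) auto
  have hm [measurable]: "h k \<in> borel_measurable lebesgue" for k
    by (intro measurable_completion) (use borel_measurable_continuous_onI[OF cont] in simp)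
  have h0: "x \<notin> cball 0 B \<Longrightarrow> h k x = 0" for k x
    by (simp add: h_def \<phi>_def max_def min_def)
  have \<phi>: "0 \<le> \<phi> x" "\<phi> x \<le> 1" for x by (auto simp: \<phi>_def)
  have hB: "cmod (h k x) \<le> B" for k x
    using mult_mono[OF \<phi>(2)[of x] clamp_le[of "c k x"]] \<phi>[of x] by (simp add: h_def)
  have gB: "cmod (g n x) \<le> B" for x
    by (simp add: g_def B_def)
  have gfix: "\<phi> x *\<^sub>R clamp (g n x) = g n x" for x
    by (auto simp: g_def clamp_def \<phi>_def B_def max_def min_def)
  have "(\<lambda>k. L2_sq (\<lambda>x. h k x - g n x)) \<longlonglongrightarrow> 0"
  proof (rule L2_sq_dominated_tendsto)
    show "square_integrable (\<lambda>x. complex_of_real (2 * B * indicator (cball 0 B) x))"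
    proof (rule square_integrable_bounded[where r = B])
      show "(\<lambda>x::real^3. complex_of_real (2 * B * indicator (cball 0 B) x)) \<in> borel_measurable lebesgue"
      proof -
        have [measurable]: "cball (0 :: real^3) B \<in> sets borel" by simp
        show ?thesis by (rule measurable_completion, unfold measurable_lborel2) measurable
      qed
      show "cmod (complex_of_real (2 * B * indicator (cball 0 B) x)) \<le> 2 * B" for x :: "real^3"
        using B by (simp add: indicator_def)
    qed (simp add: indicator_def)
    show "cmod (h k x - g n x) \<le> cmod (complex_of_real (2 * B * indicator (cball 0 B) x))" for k x
    proof (cases "x \<in> cball 0 B")
      case True
      then show ?thesis
        using norm_triangle_ineq4[of "h k x" "g n x"] hB[of k x] gB[of x] B by simp
    next
      case False
      then have "g n x = 0" by (auto simp: g_def B_def)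
      then show ?thesis using h0[OF False] by simp
    qed
    have "AE x in lebesgue. x \<notin> N"
      using N by (auto simp: negligible_iff_null_sets intro: AE_not_in)
    then show "AE x in lebesgue. (\<lambda>k. h k x - g n x) \<longlonglongrightarrow> 0"
    proof eventually_elim
      fix x assume "x \<notin> N"
      then have "(\<lambda>k. h k x) \<longlonglongrightarrow> \<phi> x *\<^sub>R clamp (g n x)"
        unfolding h_def clamp_def using Bmax by (intro tendsto_intros lim) auto
      then show "(\<lambda>k. h k x - g n x) \<longlonglongrightarrow> 0"
        unfolding gfix by (simp add: LIM_zero)
    qed
  qed measurable
  then obtain k where k: "L2_sq (\<lambda>x. h k x - g n x) < e"
    using tendsto_zero_ex_less[OF _ e] by blast
  have "L2_sq (\<lambda>x. G x - h k x) \<le> 2 * L2_sq (\<lambda>x. G x - g n x) + 2 * L2_sq (\<lambda>x. g n x - h k x)"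
    by (rule L2_sq_triangle) measurable
  also have "\<dots> \<le> 2 * e + 2 * e"
    using n k L2_sq_minus_commute[of G "g n"] L2_sq_minus_commute[of "h k" "g n"]
    by (intro add_mono mult_left_mono) auto
  also have "\<dots> = 4 * e"
    by (simp add: distrib_right[symmetric])
  finally show thesis
    using that[OF cont h0] by blast
qed

text \<open>The substitution \<open>y = x - s z\<close> turns the kernel of width \<open>s\<close> into the kernel of width 1.\<close>

lemma gauss_mollifier_tendsto:
  fixes h :: "real^3 \<Rightarrow> complex"
  assumes h: "continuous_on UNIV h" and B: "\<And>x. cmod (h x) \<le> B"
    and s: "s \<longlonglongrightarrow> 0" "\<And>n. s n > 0"
  shows "(\<lambda>n. \<integral>y. h y * complex_of_real (gauss_kernel (s n) (x - y)) \<partial>lborel)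
    \<longlonglongrightarrow> complex_of_real ((2 * pi) ^ 3) * h x"
proof -
  have [measurable]: "h \<in> borel_measurable borel"
    using h by (rule borel_measurable_continuous_onI)
  have eq: "(\<integral>y. h y * complex_of_real (gauss_kernel \<sigma> (x - y)) \<partial>lborel)
     = (\<integral>z. complex_of_real (gauss_kernel 1 z) * h (x - \<sigma> *\<^sub>R z) \<partial>lborel)" if "\<sigma> > 0" for \<sigma>
  proof -
    have k: "\<sigma> ^ 3 * gauss_kernel \<sigma> (\<sigma> *\<^sub>R z) = gauss_kernel 1 z" for z
      using that by (simp add: gauss_kernel_def power_divide)
    have "(\<integral>y. h y * complex_of_real (gauss_kernel \<sigma> (x - y)) \<partial>lborel)
      = (\<integral>y. h y * complex_of_real (gauss_kernel \<sigma> (x - y))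
          \<partial>density (distr lborel borel (\<lambda>z. x + (- \<sigma>) *\<^sub>R z)) (\<lambda>_. ennreal (\<bar>- \<sigma>\<bar> ^ DIM(real^3))))"
      using that by (subst lborel_affine[of "- \<sigma>" x]) (auto simp: ennreal_power)
    also have "\<dots> = (\<integral>z. (\<sigma> ^ 3) *\<^sub>R (h (x - \<sigma> *\<^sub>R z) * complex_of_real (gauss_kernel \<sigma> (\<sigma> *\<^sub>R z))) \<partial>lborel)"
      using that by (subst integral_density) (auto simp: integral_distr)
    also have "\<dots> = (\<integral>z. complex_of_real (gauss_kernel 1 z) * h (x - \<sigma> *\<^sub>R z) \<partial>lborel)"
      unfolding k[symmetric] by (simp add: scaleR_conv_of_real ac_simps)
    finally show ?thesis .
  qed
  have "(\<lambda>n. \<integral>z. complex_of_real (gauss_kernel 1 z) * h (x - s n *\<^sub>R z) \<partial>lborel)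
    \<longlonglongrightarrow> (\<integral>z. complex_of_real (gauss_kernel 1 z) * h x \<partial>lborel)"
  proof (rule integral_dominated_convergence)
    show "integrable lborel (\<lambda>z. gauss_kernel 1 z * B)"
      by (intro integrable_mult_left integrable_gauss_kernel) simp
    have "(\<lambda>n. x - s n *\<^sub>R z) \<longlonglongrightarrow> x - 0 *\<^sub>R z" for z
      by (intro tendsto_intros s)
    then have "(\<lambda>n. h (x - s n *\<^sub>R z)) \<longlonglongrightarrow> h (x - 0 *\<^sub>R z)" for z
      by (rule continuous_on_tendsto_compose[OF h]) auto
    then show "AE z in lborel. (\<lambda>n. complex_of_real (gauss_kernel 1 z) * h (x - s n *\<^sub>R z))
      \<longlonglongrightarrow> complex_of_real (gauss_kernel 1 z) * h x"
      by (auto intro!: AE_I2 tendsto_intros)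
    show "AE z in lborel. norm (complex_of_real (gauss_kernel 1 z) * h (x - s n *\<^sub>R z)) \<le> gauss_kernel 1 z * B" for n
      using B gauss_kernel_nonneg[of 1] by (auto intro!: AE_I2 mult_left_mono simp: norm_mult)
  qed measurable
  also have "(\<integral>z. complex_of_real (gauss_kernel 1 z) * h x \<partial>lborel) = complex_of_real ((2 * pi) ^ 3) * h x"
    using integral_gauss_kernel[of 1] by simp
  finally show ?thesis
    using eq s(2) by simp
qed

text \<open>The transform of \<open>h\<close> need not be integrable, so it is damped. The damped
  functions \<open>w n\<close> have classical transforms that are mollifications of \<open>h\<close>
  and converge to \<open>h\<close> everywhere, while L2 stability makes them converge to the
  transform of \<open>?u\<close>; Fatou identifies the two limits.\<close>

lemma fourier_inversion_continuous:
  assumes h: "continuous_on UNIV h" and h0: "\<And>x. x \<notin> cball 0 r \<Longrightarrow> h x = 0"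
  shows "AE x in lebesgue. L2_fourier (reflect_scaled (fourier_integral h)) x = h x"
proof -
  have [measurable]: "h \<in> borel_measurable borel"
    using h by (rule borel_measurable_continuous_onI)
  then have hm: "h \<in> borel_measurable lebesgue"
    by (intro measurable_completion) simp
  have "compact (h ` cball 0 r)"
    by (intro compact_continuous_image continuous_on_subset[OF h]) auto
  then obtain B where "\<And>x. x \<in> cball 0 r \<Longrightarrow> cmod (h x) \<le> B"
    by (meson bounded_iff compact_imp_bounded imageI)
  then have B: "cmod (h x) \<le> max 0 B" for x
    using h0[of x] by (cases "x \<in> cball 0 r") (auto simp: le_max_iff_disj)
  have hsq: "square_integrable h"
    by (rule square_integrable_bounded[OF hm B h0])
  have hint: "integrable lebesgue h"
    by (rule square_integrable_bounded_support[OF hsq]) (use h0 in auto)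
  then have hint': "integrable lborel h"
    by (simp add: integrable_completion)
  let ?H = "fourier_integral h" and ?u = "reflect_scaled (fourier_integral h)"
  have Hm [measurable]: "?H \<in> borel_measurable borel"
    by (rule borel_measurable_fourier_integral[OF hm])
  have Hsq: "square_integrable ?H"
    using L2_fourier_eq_fourier_integral(1)[OF hsq hint] by (simp add: is_L2_fourier_def)
  have usq: "square_integrable ?u"
    by (rule square_integrable_reflect_scaled[OF Hsq])
  have um [measurable]: "?u \<in> borel_measurable borel"
    unfolding reflect_scaled_def[abs_def] by measurable
  let ?V = "L2_fourier ?u"
  have V: "is_L2_fourier ?u ?V"
    by (rule is_L2_fourier_L2_fourier[OF usq])
  have Vm [measurable]: "?V \<in> borel_measurable lebesgue"
    using V by (simp add: is_L2_fourier_def square_integrable_def)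
  define s where "s n = inverse (real (Suc n))" for n
  have s: "s \<longlonglongrightarrow> 0" "\<And>n. s n > 0"
    using LIMSEQ_inverse_real_of_nat by (simp_all add: s_def[abs_def])
  define w where "w n x = complex_of_real (exp (- (s n * norm x)\<^sup>2 / 2)) * ?u x" for n x
  have wm [measurable]: "w n \<in> borel_measurable borel" for n
    unfolding w_def by measurable
  have wl: "w n \<in> borel_measurable lebesgue" for n
    by (rule measurable_completion) simp
  have w_le: "cmod (w n x) \<le> cmod (?u x)" for n x
    by (simp add: w_def norm_mult mult_left_le_one_le)
  have wsq: "square_integrable (w n)" for n
    by (rule square_integrable_mono[OF usq wl w_le])
  have u_bd: "cmod (?u x) \<le> (\<integral>x. cmod (h x) \<partial>lebesgue)" for x
  proof -
    have "cmod (?u x) = cmod (?H (- x)) / (2 * pi) ^ 3"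
      by (rule cmod_reflect_scaled)
    also have "\<dots> \<le> cmod (?H (- x)) / 1"
      by (rule divide_left_mono) (use two_pi_cube_ge_1 in auto)
    also have "\<dots> \<le> (\<integral>x. cmod (h x) \<partial>lebesgue)"
      using norm_fourier_integral_le[of h "- x"] by simp
    finally show ?thesis .
  qed
  have wint: "integrable lborel (w n)" for n
  proof (rule Bochner_Integration.integrable_bound)
    show "integrable lborel (\<lambda>x::real^3. exp (- (s n * norm x)\<^sup>2 / 2) * (\<integral>x. cmod (h x) \<partial>lebesgue))"
      by (intro integrable_mult_left integrable_gaussian s)
    show "AE x in lborel. norm (w n x) \<le> norm (exp (- (s n * norm x)\<^sup>2 / 2) * (\<integral>x. cmod (h x) \<partial>lebesgue))"
      using u_bd by (auto simp: w_def norm_mult intro!: AE_I2 mult_left_mono)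
  qed measurable
  have wintl: "integrable lebesgue (w n)" for n
    using wint by (simp add: integrable_completion)
  have fw: "fourier_integral (w n) x
     = (\<integral>y. h y * complex_of_real (gauss_kernel (s n) (x - y)) \<partial>lborel) /\<^sub>R (2 * pi) ^ 3" for n x
  proof -
    let ?g = "\<lambda>\<xi>. cis (x \<bullet> \<xi>) * complex_of_real (exp (- (s n * norm \<xi>)\<^sup>2 / 2)) * ?H \<xi>"
    have gm: "?g \<in> borel_measurable lebesgue"
      by (rule measurable_completion) measurable
    \<comment> \<open>Replacing \<open>\<xi>\<close> by \<open>- \<xi>\<close> turns the forward
      transform of \<open>w n\<close> into the damped inverse transform of
      \<open>?H\<close>.\<close>
    have "fourier_integral (w n) x = (\<integral>\<xi>. ?g (- \<xi>) /\<^sub>R (2 * pi) ^ 3 \<partial>lebesgue)"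
      unfolding fourier_integral_def[of "w n"]
      by (intro Bochner_Integration.integral_cong refl)
        (simp add: w_def reflect_scaled_def inner_commute)
    also have "\<dots> = (\<integral>\<xi>. ?g \<xi> \<partial>lebesgue) /\<^sub>R (2 * pi) ^ 3"
      using integral_reflect[OF gm] by simp
    also have "(\<integral>\<xi>. ?g \<xi> \<partial>lebesgue) = (\<integral>\<xi>. ?g \<xi> \<partial>lborel)"
      by (rule integral_completion) measurable
    also have "\<dots> = (\<integral>y. h y * complex_of_real (gauss_kernel (s n) (x - y)) \<partial>lborel)"
      by (rule damped_inversion[OF hint' s(2)])
    finally show ?thesis .
  qed
  have lim: "(\<lambda>n. fourier_integral (w n) x) \<longlonglongrightarrow> h x" for x
  proof -
    have "(\<lambda>n. fourier_integral (w n) x) \<longlonglongrightarrow> (complex_of_real ((2 * pi) ^ 3) * h x) /\<^sub>R (2 * pi) ^ 3"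
      unfolding fw by (intro tendsto_intros gauss_mollifier_tendsto[OF h B s])
    then show ?thesis by (simp add: scaleR_conv_of_real field_simps)
  qed
  have "(\<lambda>n. L2_sq (\<lambda>x. w n x - ?u x)) \<longlonglongrightarrow> 0"
  proof (rule L2_sq_dominated_tendsto[OF _ usq])
    show "(\<lambda>x. w n x - ?u x) \<in> borel_measurable lebesgue" for n
      by (rule measurable_completion) measurable
    show "cmod (w n x - ?u x) \<le> cmod (?u x)" for n x
    proof -
      have "w n x - ?u x = complex_of_real (exp (- (s n * norm x)\<^sup>2 / 2) - 1) * ?u x"
        by (simp add: w_def algebra_simps)
      moreover have "\<bar>exp (- (s n * norm x)\<^sup>2 / 2) - 1\<bar> \<le> 1"
        by (simp add: abs_if)
      ultimately show ?thesis
        by (simp add: norm_mult mult_left_le_one_le del: of_real_diff)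
    qed
    have "(\<lambda>n. w n x) \<longlonglongrightarrow> complex_of_real (exp (- (0 * norm x)\<^sup>2 / 2)) * ?u x" for x
      unfolding w_def by (intro tendsto_intros s) auto
    then show "AE x in lebesgue. (\<lambda>n. w n x - ?u x) \<longlonglongrightarrow> 0"
      by (auto intro!: AE_I2 LIM_zero)
  qed
  then have lim0: "(\<lambda>n. 4 * ennreal ((2 * pi) ^ 3) * L2_sq (\<lambda>x. w n x - ?u x)) \<longlonglongrightarrow> 0"
    by (rule tendsto_zero_cmult_ennreal) (simp add: ennreal_mult_less_top)
  have [measurable]: "fourier_integral (w n) \<in> borel_measurable lebesgue" for n
    by (rule fourier_measurable_lebesgue[OF wl])
  have "L2_sq (\<lambda>x. h x - ?V x) \<le> 0"
    unfolding L2_sq_def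
  proof (rule nn_integral_le_of_tendsto[OF _ _ _ lim0])
    show "AE x in lebesgue. (\<lambda>n. ennreal ((cmod (fourier_integral (w n) x - ?V x))\<^sup>2))
       \<longlonglongrightarrow> ennreal ((cmod (h x - ?V x))\<^sup>2)"
      by (intro AE_I2 tendsto_ennrealI tendsto_intros lim)
    show "(\<integral>\<^sup>+ x. ennreal ((cmod (fourier_integral (w n) x - ?V x))\<^sup>2) \<partial>lebesgue)
       \<le> 4 * ennreal ((2 * pi) ^ 3) * L2_sq (\<lambda>x. w n x - ?u x)" for n
      using is_L2_fourier_diff[OF wsq L2_fourier_eq_fourier_integral(1)[OF wsq wintl] usq V]
      by (simp add: L2_sq_def)
  qed measurable
  then have "AE x in lebesgue. h x = ?V x"
    by (intro L2_sq_diff_eq_0_AE) (use hm in auto)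
  then show ?thesis by eventually_elim simp
qed

text \<open>\<open>G\<close> is replaced by a continuous \<open>h\<close> of bounded support at cost
  \<open>4 * e\<close>; the Lipschitz bound is applied twice, once for each transform. This order of
  the transforms is the one that occurs between two composed multipliers.\<close>

theorem L2_fourier_inversion:
  assumes G: "square_integrable G"
  shows "AE x in lebesgue. L2_fourier (L2_inverse_fourier G) x = G x"
proof -
  let ?c = "4 * ennreal ((2 * pi) ^ 3)"
  let ?U = "L2_fourier G" let ?u = "reflect_scaled ?U" let ?V = "L2_fourier ?u"
  have Usq: "square_integrable ?U" by (rule square_integrable_L2_fourier[OF G])
  have usq: "square_integrable ?u" by (rule square_integrable_reflect_scaled[OF Usq])
  have Vsq: "square_integrable ?V" by (rule square_integrable_L2_fourier[OF usq])
  note meas = square_integrable_measurable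
  have le: "L2_sq (\<lambda>x. ?V x - G x) \<le> (2 * (?c * (?c * 4)) + 8) * e" if e: "0 < e" for e
  proof -
    obtain h r where h: "continuous_on UNIV h" "\<And>x. x \<notin> cball 0 r \<Longrightarrow> h x = 0"
      and Gh: "L2_sq (\<lambda>x. G x - h x) \<le> 4 * e"
      using continuous_dense_L2[OF G e] by blast
    have hm: "h \<in> borel_measurable lebesgue"
      by (rule measurable_completion) (use borel_measurable_continuous_onI[OF h(1)] in simp)
    have "compact (h ` cball 0 r)"
      by (intro compact_continuous_image continuous_on_subset[OF h(1)]) auto
    then obtain B where "\<And>x. x \<in> cball 0 r \<Longrightarrow> cmod (h x) \<le> B"
      by (meson bounded_iff compact_imp_bounded imageI)
    then have B: "cmod (h x) \<le> max 0 B" for x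
      using h(2)[of x] by (cases "x \<in> cball 0 r") (auto simp: le_max_iff_disj)
    have hsq: "square_integrable h"
      by (rule square_integrable_bounded[OF hm B h(2)])
    have hint: "integrable lebesgue h"
      by (rule square_integrable_bounded_support[OF hsq]) (use h(2) in auto)
    let ?H = "fourier_integral h" let ?v = "reflect_scaled ?H"
    note H = L2_fourier_eq_fourier_integral(1)[OF hsq hint]
    have Hsq: "square_integrable ?H" using H by (simp add: is_L2_fourier_def)
    have vsq: "square_integrable ?v" by (rule square_integrable_reflect_scaled[OF Hsq])
    have inv: "AE x in lebesgue. L2_fourier ?v x = h x"
      by (rule fourier_inversion_continuous) (use h in auto)
    have "L2_sq (\<lambda>x. ?V x - h x) = L2_sq (\<lambda>x. ?V x - L2_fourier ?v x)"
      by (rule L2_sq_cong_AE) (use inv in \<open>eventually_elim, simp\<close>)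
    also have "\<dots> \<le> ?c * L2_sq (\<lambda>x. ?u x - ?v x)"
      by (intro is_L2_fourier_diff usq vsq is_L2_fourier_L2_fourier)
    also have "\<dots> \<le> ?c * L2_sq (\<lambda>x. ?U x - ?H x)"
      by (intro mult_left_mono L2_sq_reflect_scaled_le meas Usq Hsq) simp
    also have "\<dots> \<le> ?c * (?c * L2_sq (\<lambda>x. G x - h x))"
      by (intro mult_left_mono is_L2_fourier_diff G hsq is_L2_fourier_L2_fourier H) simp
    also have "\<dots> \<le> ?c * (?c * (4 * e))"
      by (intro mult_left_mono Gh) simp_all
    finally have Vh: "L2_sq (\<lambda>x. ?V x - h x) \<le> ?c * (?c * (4 * e))" .
    have "L2_sq (\<lambda>x. ?V x - G x) \<le> 2 * L2_sq (\<lambda>x. ?V x - h x) + 2 * L2_sq (\<lambda>x. h x - G x)"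
      by (intro L2_sq_triangle meas Vsq hm G)
    also have "\<dots> \<le> 2 * (?c * (?c * (4 * e))) + 2 * (4 * e)"
      using Gh L2_sq_minus_commute[of h G] by (intro add_mono mult_left_mono Vh) auto
    also have "\<dots> = (2 * (?c * (?c * 4)) + 8) * e"
      by (simp add: distrib_right mult.assoc[symmetric])
    finally show ?thesis .
  qed
  have "(\<lambda>n. ennreal (inverse (real (Suc n)))) \<longlonglongrightarrow> ennreal 0"
    by (intro tendsto_ennrealI LIMSEQ_inverse_real_of_nat)
  then have "(\<lambda>n. (2 * (?c * (?c * 4)) + 8) * ennreal (inverse (real (Suc n)))) \<longlonglongrightarrow> 0"
    by (intro tendsto_zero_cmult_ennreal) (auto simp: ennreal_mult_less_top)
  then have "L2_sq (\<lambda>x. ?V x - G x) \<le> 0"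
    by (rule LIMSEQ_le_const) (intro exI allI impI le, simp)
  then show ?thesis
    unfolding L2_inverse_fourier_eq
    by (intro L2_sq_diff_eq_0_AE) (auto intro: meas Vsq G)
qed

section \<open>Multipliers with a bounded kernel\<close>

text \<open>\<open>ess_support\<close> removes a possibly uncountable union of open sets, each with
  its own exceptional null set; by Lindelof countably many of them have the same union.\<close>

lemma AE_zero_off_ess_support:
  assumes "ess_support f \<subseteq> S"
  shows "AE x in lebesgue. x \<notin> S \<longrightarrow> f x = 0"
proof -
  let ?\<F> = "{U. open U \<and> (AE x in lebesgue. x \<in> U \<longrightarrow> f x = 0)}"
  obtain \<G> where \<G>: "\<G> \<subseteq> ?\<F>" "countable \<G>" "\<Union>\<G> = \<Union>?\<F>"
    using Lindelof[of ?\<F>] by auto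
  have "AE x in lebesgue. \<forall>U\<in>\<G>. x \<in> U \<longrightarrow> f x = 0"
    using \<G> by (subst AE_ball_countable) auto
  then show ?thesis
  proof eventually_elim
    fix x assume *: "\<forall>U\<in>\<G>. x \<in> U \<longrightarrow> f x = 0"
    show "x \<notin> S \<longrightarrow> f x = 0"
    proof
      assume "x \<notin> S"
      then have "x \<in> \<Union>\<G>"
        using assms unfolding ess_support_def \<G>(3) by blast
      then show "f x = 0" using * by blast
    qed
  qed
qed

text \<open>The inverse Fourier integral of the symbol without its factor
  \<open>1 / (2 * pi) ^ 3\<close>, which reappears in the convolution formula.\<close>

definition multiplier_kernel :: "(real^3 \<Rightarrow> real) \<Rightarrow> real^3 \<Rightarrow> complex" where
  "multiplier_kernel m z = (\<integral>\<xi>. cis (z \<bullet> \<xi>) * complex_of_real (m \<xi>) \<partial>lborel)"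

lemma borel_measurable_multiplier_kernel [measurable]:
  assumes [measurable]: "m \<in> borel_measurable borel"
  shows "multiplier_kernel m \<in> borel_measurable borel"
  unfolding multiplier_kernel_def[abs_def] by measurable

lemma measurable_lebesgueI: "f \<in> borel_measurable borel \<Longrightarrow> f \<in> borel_measurable lebesgue"
  by (rule measurable_completion) simp

lemma square_integrable_scaleR_bounded:
  assumes "square_integrable f" and m: "m \<in> borel_measurable borel" and b: "\<And>x. \<bar>m x\<bar> \<le> M"
  shows "square_integrable (\<lambda>x. m x *\<^sub>R f x)"
proof -
  have [measurable]: "f \<in> borel_measurable lebesgue" "m \<in> borel_measurable lebesgue"
    using assms(1) measurable_lebesgueI[OF m] by (auto simp: square_integrable_def)
  have "integrable lebesgue (\<lambda>x. M\<^sup>2 * (cmod (f x))\<^sup>2)"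
    using assms(1) by (simp add: square_integrable_def)
  then have "integrable lebesgue (\<lambda>x. (cmod (m x *\<^sub>R f x))\<^sup>2)"
  proof (rule Bochner_Integration.integrable_bound)
    have "(m x)\<^sup>2 \<le> M\<^sup>2" for x
      using power_mono[OF b[of x], of 2] by simp
    then show "AE x in lebesgue. norm ((cmod (m x *\<^sub>R f x))\<^sup>2) \<le> norm (M\<^sup>2 * (cmod (f x))\<^sup>2)"
      by (auto intro!: AE_I2 mult_right_mono simp: power_mult_distrib)
  qed measurable
  then show ?thesis by (simp add: square_integrable_def)
qed

text \<open>The inner symbol \<open>m\<close> is only bounded, so
  \<open>fourier_multiplier m f\<close> is handled in L2. Inversion cancels its inverse transform
  against the next transform and leaves the single symbol \<open>p \<xi> * m \<xi>\<close>;
  boundedness and compact support of this product make \<open>Q\<close> and \<open>q\<close>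
  integrable, and the rest is classical.\<close>

lemma fourier_multiplier_compose_kernel:
  assumes f: "square_integrable f" and fR: "AE x in lebesgue. x \<notin> cball 0 R \<longrightarrow> f x = 0"
    and m: "m \<in> borel_measurable borel" "\<And>\<xi>. \<bar>m \<xi>\<bar> \<le> M"
    and p: "p \<in> borel_measurable borel" "\<And>\<xi>. \<bar>p \<xi>\<bar> \<le> P" "\<And>\<xi>. \<xi> \<notin> cball 0 \<rho> \<Longrightarrow> p \<xi> = 0"
    and g: "g \<in> borel_measurable borel" "AE x in lebesgue. f x = g x"
  shows "AE x in lebesgue. fourier_multiplier p (fourier_multiplier m f) x =
     (\<integral>y. g y * multiplier_kernel (\<lambda>\<xi>. p \<xi> * m \<xi>) (x - y) \<partial>lborel) /\<^sub>R (2 * pi) ^ 3"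
    and "fourier_multiplier p (fourier_multiplier m f) \<in> borel_measurable lebesgue"
proof -
  note [measurable] = m(1) p(1) g(1)
  let ?F = "fourier_integral g"
  have fm: "f \<in> borel_measurable lebesgue" using f by (rule square_integrable_measurable)
  have gm: "g \<in> borel_measurable lebesgue" by (rule measurable_lebesgueI[OF g(1)])
  have gsq: "square_integrable g"
    using f L2_sq_cong_AE[OF g(2)] gm by (simp add: square_integrable_iff)
  have gint: "integrable lebesgue g"
    by (rule square_integrable_bounded_support[OF gsq, of R]) (use fR g(2) in eventually_elim, auto)
  then have gint': "integrable lborel g" by (simp add: integrable_completion)
  have Fm [measurable]: "?F \<in> borel_measurable borel"
    by (rule borel_measurable_fourier_integral[OF gm])
  have F: "AE \<xi> in lebesgue. L2_fourier f \<xi> = ?F \<xi>"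
    using L2_fourier_eq_fourier_integral(2)[OF gsq gint] L2_fourier_cong_AE[OF fm g(2)] by simp
  let ?G = "\<lambda>\<xi>. m \<xi> *\<^sub>R L2_fourier f \<xi>" and ?u = "fourier_multiplier m f"
  have Gsq: "square_integrable ?G"
    by (rule square_integrable_scaleR_bounded[OF square_integrable_L2_fourier[OF f] m])
  have u: "?u = L2_inverse_fourier ?G" by (simp add: fourier_multiplier_def)
  have usq: "square_integrable ?u"
    unfolding u L2_inverse_fourier_eq
    by (intro square_integrable_reflect_scaled square_integrable_L2_fourier Gsq)
  define q where "q \<xi> = p \<xi> * m \<xi>" for \<xi>
  have [measurable]: "q \<in> borel_measurable borel" unfolding q_def by measurable
  define Q where "Q \<xi> = q \<xi> *\<^sub>R ?F \<xi>" for \<xi>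
  have [measurable]: "Q \<in> borel_measurable borel" unfolding Q_def by measurable
  have Qm: "Q \<in> borel_measurable lebesgue" by (rule measurable_lebesgueI) simp
  have M: "0 \<le> M" "0 \<le> P"
    using m(2)[of 0] p(2)[of 0] by linarith+
  have q: "\<bar>q \<xi>\<bar> \<le> P * M" for \<xi>
    using mult_mono[OF p(2) m(2)] M by (simp add: q_def abs_mult)
  have q0: "\<xi> \<notin> cball 0 \<rho> \<Longrightarrow> q \<xi> = 0" for \<xi> by (simp add: q_def p(3))
  have Fsq: "square_integrable ?F"
    using L2_fourier_eq_fourier_integral(1)[OF gsq gint] by (simp add: is_L2_fourier_def)
  have Qsq: "square_integrable Q"
    unfolding Q_def by (rule square_integrable_scaleR_bounded[OF Fsq _ q]) measurable
  have Qint: "integrable lebesgue Q"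
    by (rule square_integrable_bounded_support[OF Qsq, of \<rho>]) (auto simp: Q_def q_def p(3))
  have pu: "AE \<xi> in lebesgue. p \<xi> *\<^sub>R L2_fourier ?u \<xi> = Q \<xi>"
    using L2_fourier_inversion[OF Gsq, folded u] F
    by eventually_elim (simp add: Q_def q_def)
  have "L2_fourier (\<lambda>\<xi>. p \<xi> *\<^sub>R L2_fourier ?u \<xi>) = L2_fourier Q"
    using pu by (intro L2_fourier_cong_AE[OF square_integrable_measurable]
       square_integrable_scaleR_bounded[OF square_integrable_L2_fourier[OF usq] p(1,2)])
  then have eq: "fourier_multiplier p ?u = reflect_scaled (L2_fourier Q)"
    by (simp add: fourier_multiplier_def[of p] L2_inverse_fourier_eq)
  show "fourier_multiplier p ?u \<in> borel_measurable lebesgue"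
    unfolding eq by (intro reflect_scaled_measurable square_integrable_measurable square_integrable_L2_fourier Qsq)
  have "integrable lborel (\<lambda>\<xi>. P * M * indicator (cball 0 \<rho> :: (real^3) set) \<xi>)"
    using emeasure_lborel_cball_finite[of "0::real^3" \<rho>]
    by (intro integrable_mult_right integrable_real_indicator) auto
  then have qint: "integrable lborel (\<lambda>\<xi>. complex_of_real (q \<xi>))"
    by (rule Bochner_Integration.integrable_bound)
       (use q q0 M in \<open>auto simp: indicator_def intro!: AE_I2\<close>)
  have val: "reflect_scaled (fourier_integral Q) x
     = (\<integral>y. g y * multiplier_kernel q (x - y) \<partial>lborel) /\<^sub>R (2 * pi) ^ 3" for x
  proof -
    have "fourier_integral Q (- x) = (\<integral>\<xi>. cis (x \<bullet> \<xi>) * complex_of_real (q \<xi>) * ?F \<xi> \<partial>lborel)"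
      by (subst fourier_integral_lborel, measurable)
        (intro Bochner_Integration.integral_cong refl, simp add: Q_def scaleR_conv_of_real inner_commute)
    also have "\<dots> = (\<integral>y. g y * multiplier_kernel q (x - y) \<partial>lborel)"
      unfolding multiplier_kernel_def by (rule integral_cis_mult_fourier_integral[OF gint' qint])
    finally show ?thesis by (simp add: reflect_scaled_def)
  qed
  have "AE x in lebesgue. L2_fourier Q (- x) = fourier_integral Q (- x)"
    by (rule AE_lebesgue_uminus[OF L2_fourier_eq_fourier_integral(2)[OF Qsq Qint]])
  then show "AE x in lebesgue. fourier_multiplier p ?u x =
     (\<integral>y. g y * multiplier_kernel (\<lambda>\<xi>. p \<xi> * m \<xi>) (x - y) \<partial>lborel) /\<^sub>R (2 * pi) ^ 3"
  proof eventually_elim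
    fix x assume *: "L2_fourier Q (- x) = fourier_integral Q (- x)"
    have "q = (\<lambda>\<xi>. p \<xi> * m \<xi>)" by (simp add: q_def fun_eq_iff)
    then show "fourier_multiplier p ?u x =
      (\<integral>y. g y * multiplier_kernel (\<lambda>\<xi>. p \<xi> * m \<xi>) (x - y) \<partial>lborel) /\<^sub>R (2 * pi) ^ 3"
      using val[of x] * by (simp add: eq reflect_scaled_def)
  qed
qed

text \<open>Cauchy-Schwarz on the ball that carries \<open>f\<close>: the kernel enters only through
  its L2 mass over a translated ball, uniformly in the translation. The factor
  \<open>1 / (2 * pi) ^ 3\<close> is at most 1 and is dropped.\<close>

lemma Linf_norm_multiplier_le:
  assumes f: "square_integrable f" and fR: "AE x in lebesgue. x \<notin> cball 0 R \<longrightarrow> f x = 0"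
    and m: "m \<in> borel_measurable borel" "\<And>\<xi>. \<bar>m \<xi>\<bar> \<le> M"
    and p: "p \<in> borel_measurable borel" "\<And>\<xi>. \<bar>p \<xi>\<bar> \<le> P" "\<And>\<xi>. \<xi> \<notin> cball 0 \<rho> \<Longrightarrow> p \<xi> = 0"
    and A: "0 \<le> A" "\<And>x. (\<integral>\<^sup>+y. indicator (cball 0 R) y *
        ennreal ((cmod (multiplier_kernel (\<lambda>\<xi>. p \<xi> * m \<xi>) (x - y)))\<^sup>2) \<partial>lborel) \<le> ennreal (A\<^sup>2)"
  shows "Linf_norm (fourier_multiplier p (fourier_multiplier m f)) \<le> ereal (A * L2_norm f)"
proof -
  let ?K = "multiplier_kernel (\<lambda>\<xi>. p \<xi> * m \<xi>)"
  note [measurable] = m(1) p(1)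
  obtain g where g [measurable]: "g \<in> borel_measurable borel" and fg: "AE x in lebesgue. f x = g x"
    using complex_lebesgue_borel_version[OF square_integrable_measurable[OF f]] by blast
  have rep: "AE x in lebesgue. fourier_multiplier p (fourier_multiplier m f) x =
      (\<integral>y. g y * ?K (x - y) \<partial>lborel) /\<^sub>R (2 * pi) ^ 3"
    "fourier_multiplier p (fourier_multiplier m f) \<in> borel_measurable lebesgue"
    by (rule fourier_multiplier_compose_kernel[OF f fR m p(1,2) _ g fg], erule p(3))+
  have gR: "AE x in lborel. x \<notin> cball 0 R \<longrightarrow> g x = 0"
  proof -
    have "AE x in lebesgue. x \<notin> cball 0 R \<longrightarrow> g x = 0"
      using fR fg by eventually_elim auto
    then show ?thesis by (simp add: AE_completion_iff)
  qed
  have L2: "(\<integral>\<^sup>+x. ennreal (cmod (g x)) ^ 2 \<partial>lborel) = ennreal ((L2_norm f)\<^sup>2)"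
  proof -
    have "(\<integral>\<^sup>+x. ennreal (cmod (g x)) ^ 2 \<partial>lborel) = L2_sq f"
      using L2_sq_cong_AE[OF fg] by (simp add: L2_sq_lborel ennreal_power)
    also have "\<dots> = ennreal (\<integral>x. (cmod (f x))\<^sup>2 \<partial>lebesgue)"
      unfolding L2_sq_def using f by (intro nn_integral_eq_integral) (auto simp: square_integrable_def)
    finally show ?thesis by (simp add: L2_norm_def)
  qed
  have L0: "0 \<le> L2_norm f" by (simp add: L2_norm_def)
  have bd: "cmod (\<integral>y. g y * ?K (x - y) \<partial>lborel) \<le> A * L2_norm f" for x
  proof -
    let ?k = "\<lambda>y. indicator (cball 0 R) y * ennreal (cmod (?K (x - y)))"
    have [measurable]: "cball (0 :: real^3) R \<in> sets borel" by simp
    have k: "?k \<in> borel_measurable lborel"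
      unfolding measurable_lborel2 by measurable
    have "ennreal (cmod (\<integral>y. g y * ?K (x - y) \<partial>lborel)) \<le> (\<integral>\<^sup>+y. ennreal (cmod (g y * ?K (x - y))) \<partial>lborel)"
      by (rule ennreal_norm_integral_le)
    also have "\<dots> = (\<integral>\<^sup>+y. ennreal (cmod (g y)) * ?k y \<partial>lborel)"
      by (rule nn_integral_cong_AE)
        (use gR in \<open>eventually_elim, auto simp: norm_mult ennreal_mult indicator_def\<close>)
    finally have "(ennreal (cmod (\<integral>y. g y * ?K (x - y) \<partial>lborel)))\<^sup>2 \<le> (\<integral>\<^sup>+y. ennreal (cmod (g y)) * ?k y \<partial>lborel)\<^sup>2"
      by (rule power_mono) simp
    also have "\<dots> \<le> (\<integral>\<^sup>+y. ennreal (cmod (g y)) ^ 2 \<partial>lborel) * (\<integral>\<^sup>+y. ?k y ^ 2 \<partial>lborel)"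
      by (rule Cauchy_Schwarz_nn_integral[OF _ k]) measurable
    also have "(\<integral>\<^sup>+y. ?k y ^ 2 \<partial>lborel) = (\<integral>\<^sup>+y. indicator (cball 0 R) y * ennreal ((cmod (?K (x - y)))\<^sup>2) \<partial>lborel)"
      by (rule nn_integral_cong) (simp add: indicator_def ennreal_power)
    also have "(\<integral>\<^sup>+y. ennreal (cmod (g y)) ^ 2 \<partial>lborel) * \<dots> \<le> ennreal ((L2_norm f)\<^sup>2) * ennreal (A\<^sup>2)"
      unfolding L2 by (intro mult_left_mono A) simp
    finally have "ennreal ((cmod (\<integral>y. g y * ?K (x - y) \<partial>lborel))\<^sup>2) \<le> ennreal ((A * L2_norm f)\<^sup>2)"
      by (simp add: ennreal_power ennreal_mult[symmetric] power_mult_distrib mult.commute)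
    then have "(cmod (\<integral>y. g y * ?K (x - y) \<partial>lborel))\<^sup>2 \<le> (A * L2_norm f)\<^sup>2"
      by (subst (asm) ennreal_le_iff) (rule zero_le_power2)
    then show ?thesis
      by (rule power2_le_imp_le) (rule mult_nonneg_nonneg[OF A(1) L0])
  qed
  show ?thesis
    unfolding Linf_norm_def
  proof (rule esssup_I)
    show "(\<lambda>x. ereal (cmod (fourier_multiplier p (fourier_multiplier m f) x))) \<in> borel_measurable lebesgue"
      using rep(2) by measurable
    show "AE x in lebesgue. ereal (cmod (fourier_multiplier p (fourier_multiplier m f) x)) \<le> ereal (A * L2_norm f)"
      using rep(1)
    proof eventually_elim
      fix x
      assume eq: "fourier_multiplier p (fourier_multiplier m f) x = (\<integral>y. g y * ?K (x - y) \<partial>lborel) /\<^sub>R (2 * pi) ^ 3"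
      have "cmod (fourier_multiplier p (fourier_multiplier m f) x) = cmod (\<integral>y. g y * ?K (x - y) \<partial>lborel) / (2 * pi) ^ 3"
        unfolding eq by (rule norm_divideR) simp
      also have "\<dots> \<le> cmod (\<integral>y. g y * ?K (x - y) \<partial>lborel) / 1"
        by (rule divide_left_mono) (use two_pi_cube_ge_1 in auto)
      finally show "ereal (cmod (fourier_multiplier p (fourier_multiplier m f) x)) \<le> ereal (A * L2_norm f)"
        using bd[of x] by simp
    qed
  qed
qed

section \<open>Integrals over spherical shells\<close>

lemma borel_measurable_axes: "(\<lambda>(x, y, z). axis i x + axis j y + axis k z :: real^'n) \<in> borel_measurable borel"
proof -
  have sc: "axis q x = x *\<^sub>R (axis q 1 :: real^'n)" for q x
    by (simp add: axis_def vec_eq_iff)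
  have eq: "(\<lambda>(x, y, z). axis i x + axis j y + axis k z :: real^'n)
     = (\<lambda>(x, y, z). x *\<^sub>R axis i 1 + y *\<^sub>R axis j 1 + z *\<^sub>R axis k 1)"
    by (rule ext, clarify) (intro arg_cong2[where f="(+)"] sc)
  show ?thesis
    unfolding eq split_beta by (intro borel_measurable_continuous_onI continuous_intros)
qed

lemma emeasure_lborel_Times:
  fixes A :: "'a::euclidean_space set" and B :: "'b::euclidean_space set"
  assumes "A \<in> sets borel" "B \<in> sets borel"
  shows "emeasure lborel (A \<times> B) = emeasure lborel A * emeasure lborel B"
  unfolding lborel_prod[symmetric] by (rule lborel.emeasure_pair_measure_Times) (use assms in auto)

lemma nn_integral_lborel_pair:
  fixes f :: "'a::euclidean_space \<times> 'b::euclidean_space \<Rightarrow> ennreal"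
  assumes "f \<in> borel_measurable borel"
  shows "(\<integral>\<^sup>+v. f v \<partial>lborel) = (\<integral>\<^sup>+x. \<integral>\<^sup>+y. f (x, y) \<partial>lborel \<partial>lborel)"
  using lborel.nn_integral_fst[of f lborel] assms by (simp add: lborel_prod)

text \<open>The order of the axes is left free so that the coordinate integrated innermost can be
  chosen; distinctness makes \<open>{i, j, k}\<close> the whole index type.\<close>

lemma distr_axis_sum_lborel:
  fixes i j k :: 3
  assumes ijk: "i \<noteq> j" "i \<noteq> k" "j \<noteq> k"
  shows "distr lborel borel (\<lambda>(x, y, z). axis i x + axis j y + axis k z :: real^3) = lborel"
    (is "distr _ _ ?T = _")
proof (rule sym, rule lborel_eqI)
  have [measurable]: "?T \<in> borel_measurable borel"
    by (rule borel_measurable_axes)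
  have U: "(UNIV :: 3 set) = {i, j, k}"
  proof -
    have "card {i, j, k} = CARD(3)" using ijk by simp
    then have "{i, j, k} = UNIV" by (intro card_subset_eq) auto
    then show ?thesis by simp
  qed
  fix l u :: "real^3" assume lu: "\<And>b. b \<in> Basis \<Longrightarrow> l \<bullet> b \<le> u \<bullet> b"
  have le: "l $ q \<le> u $ q" for q
    using lu[of "axis q 1"] by (simp add: inner_axis axis_in_Basis_iff)
  have T: "?T (x, y, z) $ i = x" "?T (x, y, z) $ j = y" "?T (x, y, z) $ k = z" for x y z
    using ijk ijk[symmetric] by (simp_all add: axis_def)
  have "?T (x, y, z) \<in> box l u \<longleftrightarrow> (x, y, z) \<in> {l$i<..<u$i} \<times> {l$j<..<u$j} \<times> {l$k<..<u$k}" for x y z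
  proof -
    have "?T (x, y, z) \<in> box l u \<longleftrightarrow> (\<forall>q\<in>{i, j, k}. l $ q < ?T (x, y, z) $ q \<and> ?T (x, y, z) $ q < u $ q)"
      unfolding U[symmetric] by (simp add: mem_box_cart)
    then show ?thesis using ijk ijk[symmetric] by (simp add: axis_def)
  qed
  then have pre: "?T -` box l u = {l$i<..<u$i} \<times> {l$j<..<u$j} \<times> {l$k<..<u$k}"
    by auto
  have "emeasure (distr lborel borel ?T) (box l u) = emeasure lborel ({l$i<..<u$i} \<times> {l$j<..<u$j} \<times> {l$k<..<u$k})"
    by (subst emeasure_distr) (auto simp: pre)
  also have "\<dots> = ennreal (u$i - l$i) * (ennreal (u$j - l$j) * ennreal (u$k - l$k))"
    by (simp add: emeasure_lborel_Times borel_Times le)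
  also have "\<dots> = ennreal (\<Prod>q\<in>UNIV. u $ q - l $ q)"
    unfolding U using ijk le by (simp add: ennreal_mult[symmetric])
  also have "\<dots> = ennreal (\<Prod>b\<in>Basis. (u - l) \<bullet> b)"
  proof -
    have "(\<Prod>b\<in>Basis. (u - l) \<bullet> b) = (\<Prod>q\<in>UNIV. (u - l) \<bullet> axis q 1)"
      unfolding Basis_vec_def by (subst prod.UNION_disjoint) (auto simp: axis_eq_axis)
    then show ?thesis by (simp add: inner_axis)
  qed
  finally show "emeasure (distr lborel borel ?T) (box l u) = ennreal (\<Prod>b\<in>Basis. (u - l) \<bullet> b)" .
qed simp

lemma nn_integral_lborel_axes:
  fixes i j k :: 3 and f :: "real^3 \<Rightarrow> ennreal"
  assumes ijk: "i \<noteq> j" "i \<noteq> k" "j \<noteq> k" and f [measurable]: "f \<in> borel_measurable borel"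
  shows "(\<integral>\<^sup>+v. f v \<partial>lborel) =
    (\<integral>\<^sup>+x. \<integral>\<^sup>+y. \<integral>\<^sup>+z. f (axis i x + axis j y + axis k z) \<partial>lborel \<partial>lborel \<partial>lborel)"
proof -
  have [measurable]: "(\<lambda>(x, y, z). axis i x + axis j y + axis k z :: real^3) \<in> borel_measurable borel"
    by (rule borel_measurable_axes)
  have m: "(\<lambda>(x, y, z). f (axis i x + axis j y + axis k z)) \<in> borel_measurable borel"
    using measurable_compose[OF _ f, of "\<lambda>(x, y, z). axis i x + axis j y + axis k z :: real^3" borel]
    by (simp add: split_beta)
  have m': "(\<lambda>v. f (axis i x + axis j (fst v) + axis k (snd v))) \<in> borel_measurable borel" for x
  proof -
    have "(\<lambda>v::real \<times> real. (x, fst v, snd v)) \<in> borel_measurable borel"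
      by (intro borel_measurable_continuous_onI continuous_intros)
    from measurable_compose[OF this m] show ?thesis by (simp add: split_beta)
  qed
  have "(\<integral>\<^sup>+v. f v \<partial>lborel) = (\<integral>\<^sup>+w. (\<lambda>(x, y, z). f (axis i x + axis j y + axis k z)) w \<partial>lborel)"
    unfolding distr_axis_sum_lborel[OF ijk, symmetric]
    by (subst nn_integral_distr) (simp_all add: borel_measurable_axes, simp add: case_prod_unfold)
  also have "\<dots> = (\<integral>\<^sup>+x. \<integral>\<^sup>+v. f (axis i x + axis j (fst v) + axis k (snd v)) \<partial>lborel \<partial>lborel)"
    using nn_integral_lborel_pair[OF m] by (simp add: split_beta)
  also have "\<dots> = (\<integral>\<^sup>+x. \<integral>\<^sup>+y. \<integral>\<^sup>+z. f (axis i x + axis j y + axis k z) \<partial>lborel \<partial>lborel \<partial>lborel)"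
    using nn_integral_lborel_pair[OF m'] by simp
  finally show ?thesis .
qed

lemma norm_axes:
  fixes i j k :: 3
  assumes "i \<noteq> j" "i \<noteq> k" "j \<noteq> k"
  shows "norm (axis i x + axis j y + axis k z :: real^3) = sqrt (x\<^sup>2 + y\<^sup>2 + z\<^sup>2)"
  using assms by (simp add: norm_eq_sqrt_inner inner_add_left inner_add_right inner_axis_axis power2_eq_square)

text \<open>For \<open>x \<ge> a\<close> the condition on \<open>S\<close> makes
  \<open>sqrt (S + x\<^sup>2)\<close> grow at rate at least 1/2. So the weight is dominated by the
  derivative \<open>A'\<close> of a multiple of an arctangent, whose total variation does not depend
  on \<open>t\<close>.\<close>

lemma shell_halfline_integral:
  fixes a S \<mu> t :: real
  assumes a: "0 \<le> a" and S: "0 < S" "S \<le> 2 * a\<^sup>2" and l: "0 < \<mu>"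
  shows "(\<integral>\<^sup>+x. ennreal (1 / (1 + (\<mu> * (sqrt (S + x\<^sup>2) - t))\<^sup>2)) * indicator {a..} x \<partial>lborel) \<le> ennreal (2 * pi / \<mu>)"
proof -
  define s where "s x = sqrt (S + x\<^sup>2)" for x
  have spos: "S + x\<^sup>2 > 0" for x using S(1) by (simp add: add_pos_nonneg)
  define A where "A x = 2 / \<mu> * arctan (\<mu> * (s x - t))" for x
  define A' where "A' x = 2 * (x / s x) * (1 / (1 + (\<mu> * (s x - t))\<^sup>2))" for x
  have "(\<integral>\<^sup>+x. ennreal (1 / (1 + (\<mu> * (sqrt (S + x\<^sup>2) - t))\<^sup>2)) * indicator {a..} x \<partial>lborel)
     \<le> (\<integral>\<^sup>+x. ennreal (A' x) * indicator {a..} x \<partial>lborel)"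
  proof (rule nn_integral_mono)
    fix x :: real
    show "ennreal (1 / (1 + (\<mu> * (sqrt (S + x\<^sup>2) - t))\<^sup>2)) * indicator {a..} x \<le> ennreal (A' x) * indicator {a..} x"
    proof (cases "a \<le> x")
      case True
      \<comment> \<open>The hypotheses give even 3 in place of 4; 4 has a rational square
        root.\<close>
      have "S + x\<^sup>2 \<le> 4 * x\<^sup>2"
        using S(2) power_mono[OF True a, of 2] zero_le_power2[of x] by linarith
      then have "s x \<le> 2 * x"
        unfolding s_def using True a by (intro real_le_lsqrt) (auto simp: power_mult_distrib)
      then have "1 \<le> 2 * (x / s x)"
        using spos[of x] by (simp add: s_def field_simps)
      then have "1 * (1 / (1 + (\<mu> * (s x - t))\<^sup>2)) \<le> A' x"
        unfolding A'_def by (rule mult_right_mono) simp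
      then show ?thesis using True by (auto simp: s_def intro!: ennreal_leI)
    qed simp
  qed
  also have "\<dots> = ennreal (2 / \<mu> * (pi / 2) - A a)"
  proof (rule nn_integral_FTC_atLeast)
    show "A' \<in> borel_measurable borel" unfolding A'_def s_def by measurable
    show "0 \<le> A' x" if "a \<le> x" for x
      using that a less_imp_le[OF spos[of x]] by (auto simp: A'_def s_def intro!: mult_nonneg_nonneg divide_nonneg_nonneg)
    show "(A has_real_derivative A' x) (at x)" for x
      unfolding A_def A'_def s_def
      by (rule derivative_eq_intros refl | use spos[of x] l in \<open>simp add: divide_simps\<close>)+
    have "filterlim (\<lambda>x. x * x :: real) at_top at_top"
      by (intro filterlim_at_top_mult_at_top filterlim_ident)
    then have "filterlim (\<lambda>x. S + x\<^sup>2 :: real) at_top at_top"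
      unfolding power2_eq_square by (rule filterlim_tendsto_add_at_top[OF tendsto_const])
    then have "filterlim s at_top at_top"
      unfolding s_def[abs_def] by (rule filterlim_compose[OF sqrt_at_top])
    then have "filterlim (\<lambda>x. - t + s x) at_top at_top"
      by (rule filterlim_tendsto_add_at_top[OF tendsto_const])
    then have "filterlim (\<lambda>x. \<mu> * (- t + s x)) at_top at_top"
      by (rule filterlim_tendsto_pos_mult_at_top[OF tendsto_const l])
    then have "filterlim (\<lambda>x. \<mu> * (s x - t)) at_top at_top" by simp
    then have "((\<lambda>x. arctan (\<mu> * (s x - t))) \<longlongrightarrow> pi / 2) at_top"
      by (rule filterlim_compose[OF tendsto_arctan_at_top])
    then show "(A \<longlongrightarrow> 2 / \<mu> * (pi / 2)) at_top"
      unfolding A_def[abs_def] by (intro tendsto_mult tendsto_const)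
  qed
  also have "\<dots> \<le> ennreal (2 * pi / \<mu>)"
  proof (rule ennreal_leI)
    have "2 / \<mu> * (- (pi / 2)) \<le> A a"
      unfolding A_def using l arctan_lbound[of "\<mu> * (s a - t)"] by (intro mult_left_mono) auto
    then show "2 / \<mu> * (pi / 2) - A a \<le> 2 * pi / \<mu>" by simp
  qed
  finally show ?thesis .
qed

text \<open>With \<open>a\<close> the larger of the two moduli,
  \<open>b\<^sup>2 + c\<^sup>2 \<le> 2 * a\<^sup>2\<close>, and the two half-lines are mirror
  images. The condition \<open>b \<noteq> 0\<close> keeps the norm differentiable along the
  line.\<close>

lemma shell_line_integral:
  fixes b c \<mu> t :: real
  assumes b: "b \<noteq> 0" and l: "0 < \<mu>"
  shows "(\<integral>\<^sup>+x. ennreal (1 / (1 + (\<mu> * (sqrt (b\<^sup>2 + c\<^sup>2 + x\<^sup>2) - t))\<^sup>2)) *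
       indicator {x. \<bar>b\<bar> \<le> \<bar>x\<bar> \<and> \<bar>c\<bar> \<le> \<bar>x\<bar>} x \<partial>lborel) \<le> ennreal (4 * pi / \<mu>)"
proof -
  define a where "a = max \<bar>b\<bar> \<bar>c\<bar>"
  define w where "w x = ennreal (1 / (1 + (\<mu> * (sqrt (b\<^sup>2 + c\<^sup>2 + x\<^sup>2) - t))\<^sup>2))" for x
  have [measurable]: "w \<in> borel_measurable borel" unfolding w_def by measurable
  have "b\<^sup>2 \<le> a\<^sup>2" "c\<^sup>2 \<le> a\<^sup>2"
    unfolding a_def by (simp_all add: abs_le_square_iff[symmetric])
  then have half: "(\<integral>\<^sup>+x. w x * indicator {a..} x \<partial>lborel) \<le> ennreal (2 * pi / \<mu>)"
    unfolding w_def using b l by (intro shell_halfline_integral) (auto simp: a_def add_pos_nonneg)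
  have "(\<integral>\<^sup>+x. w x * indicator {x. \<bar>b\<bar> \<le> \<bar>x\<bar> \<and> \<bar>c\<bar> \<le> \<bar>x\<bar>} x \<partial>lborel)
      \<le> (\<integral>\<^sup>+x. w x * indicator {a..} x + w (- x) * indicator {a..} (- x) \<partial>lborel)"
    by (intro nn_integral_mono) (auto simp: indicator_def a_def w_def)
  also have "\<dots> = (\<integral>\<^sup>+x. w x * indicator {a..} x \<partial>lborel) + (\<integral>\<^sup>+x. w (- x) * indicator {a..} (- x) \<partial>lborel)"
    by (rule nn_integral_add) measurable
  also have "(\<integral>\<^sup>+x. w (- x) * indicator {a..} (- x) \<partial>lborel) = (\<integral>\<^sup>+x. w x * indicator {a..} x \<partial>lborel)"
    using nn_integral_real_affine[of "\<lambda>x. w x * indicator {a..} x" "-1" 0] by simp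
  also have "(\<integral>\<^sup>+x. w x * indicator {a..} x \<partial>lborel) + (\<integral>\<^sup>+x. w x * indicator {a..} x \<partial>lborel)
      \<le> ennreal (2 * pi / \<mu>) + ennreal (2 * pi / \<mu>)"
    by (intro add_mono half)
  also have "\<dots> = ennreal (4 * pi / \<mu>)"
    using l by (simp add: ennreal_plus[symmetric] del: ennreal_plus)
  finally show ?thesis unfolding w_def .
qed

text \<open>
  Where \<open>z $ k\<close> is the largest coordinate, \<open>norm z\<close> increases along the \<open>k\<close>-axis at rate at least
  \<open>1 / sqrt 3\<close>. So each line in this direction meets the shell in a segment of bounded length.
\<close>

lemma shell_sector_integral:
  fixes i j k :: 3 and x :: "real^3"
  assumes ijk: "i \<noteq> j" "i \<noteq> k" "j \<noteq> k" and l: "0 < \<mu>" and R: "0 \<le> R"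
  shows "(\<integral>\<^sup>+z. indicator {z. \<bar>x$i - z$i\<bar> \<le> R \<and> \<bar>x$j - z$j\<bar> \<le> R \<and> \<bar>z$i\<bar> \<le> \<bar>z$k\<bar> \<and> \<bar>z$j\<bar> \<le> \<bar>z$k\<bar>} z *
        ennreal (1 / (1 + (\<mu> * (norm z - t))\<^sup>2)) \<partial>lborel) \<le> ennreal (16 * pi * R\<^sup>2 / \<mu>)"
proof -
  let ?V = "\<lambda>z. indicator {z. \<bar>x$i - z$i\<bar> \<le> R \<and> \<bar>x$j - z$j\<bar> \<le> R \<and> \<bar>z$i\<bar> \<le> \<bar>z$k\<bar> \<and> \<bar>z$j\<bar> \<le> \<bar>z$k\<bar>} z *
        ennreal (1 / (1 + (\<mu> * (norm z - t))\<^sup>2))"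
  have [measurable]: "(\<lambda>z::real^3. z $ q) \<in> borel_measurable borel" for q
    by (intro borel_measurable_continuous_onI continuous_intros)
  have [measurable]: "?V \<in> borel_measurable borel" by measurable
  have coord: "(axis i b + axis j c + axis k a :: real^3) $ i = b" "(axis i b + axis j c + axis k a :: real^3) $ j = c"
     "(axis i b + axis j c + axis k a :: real^3) $ k = a" for a b c
    using ijk by (simp_all add: axis_def)
  have "(\<integral>\<^sup>+z. ?V z \<partial>lborel) = (\<integral>\<^sup>+b. \<integral>\<^sup>+c. \<integral>\<^sup>+a. ?V (axis i b + axis j c + axis k a) \<partial>lborel \<partial>lborel \<partial>lborel)"
    by (rule nn_integral_lborel_axes[OF ijk]) measurable
  also have "\<dots> = (\<integral>\<^sup>+b. \<integral>\<^sup>+c. (indicator {x$i - R..x$i + R} b * indicator {x$j - R..x$j + R} c) *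
      (\<integral>\<^sup>+a. ennreal (1 / (1 + (\<mu> * (sqrt (b\<^sup>2 + c\<^sup>2 + a\<^sup>2) - t))\<^sup>2)) *
       indicator {a. \<bar>b\<bar> \<le> \<bar>a\<bar> \<and> \<bar>c\<bar> \<le> \<bar>a\<bar>} a \<partial>lborel) \<partial>lborel \<partial>lborel)"
  proof (intro nn_integral_cong)
    fix b c :: real
    let ?w = "\<lambda>a. ennreal (1 / (1 + (\<mu> * (sqrt (b\<^sup>2 + c\<^sup>2 + a\<^sup>2) - t))\<^sup>2)) *
       indicator {a. \<bar>b\<bar> \<le> \<bar>a\<bar> \<and> \<bar>c\<bar> \<le> \<bar>a\<bar>} a"
    have iv: "\<bar>u - v\<bar> \<le> R \<longleftrightarrow> v \<in> {u - R..u + R}" for u v :: real by auto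
    have "?V (axis i b + axis j c + axis k a)
      = (indicator {x$i - R..x$i + R} b * indicator {x$j - R..x$j + R} c) * ?w a" for a
      unfolding norm_axes[OF ijk] indicator_def mem_Collect_eq coord iv by simp
    then have "(\<integral>\<^sup>+a. ?V (axis i b + axis j c + axis k a) \<partial>lborel)
      = (\<integral>\<^sup>+a. (indicator {x$i - R..x$i + R} b * indicator {x$j - R..x$j + R} c) * ?w a \<partial>lborel)"
      by (simp only:)
    also have "\<dots> = (indicator {x$i - R..x$i + R} b * indicator {x$j - R..x$j + R} c) * (\<integral>\<^sup>+a. ?w a \<partial>lborel)"
      by (rule nn_integral_cmult) measurable
    finally show "(\<integral>\<^sup>+a. ?V (axis i b + axis j c + axis k a) \<partial>lborel)
      = (indicator {x$i - R..x$i + R} b * indicator {x$j - R..x$j + R} c) * (\<integral>\<^sup>+a. ?w a \<partial>lborel)" .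
  qed
  also have "\<dots> \<le> (\<integral>\<^sup>+b. \<integral>\<^sup>+c. (indicator {x$i - R..x$i + R} b * indicator {x$j - R..x$j + R} c) *
      ennreal (4 * pi / \<mu>) \<partial>lborel \<partial>lborel)"
  proof (rule nn_integral_mono_AE)
    \<comment> \<open>The plane \<open>b = 0\<close> is null, which supplies the hypothesis of
      \<open>shell_line_integral\<close>.\<close>
    have "AE b in lborel. b \<noteq> (0::real)" by (rule AE_lborel_singleton)
    then show "AE b in lborel. (\<integral>\<^sup>+c. (indicator {x$i - R..x$i + R} b * indicator {x$j - R..x$j + R} c) *
      (\<integral>\<^sup>+a. ennreal (1 / (1 + (\<mu> * (sqrt (b\<^sup>2 + c\<^sup>2 + a\<^sup>2) - t))\<^sup>2)) *
       indicator {a. \<bar>b\<bar> \<le> \<bar>a\<bar> \<and> \<bar>c\<bar> \<le> \<bar>a\<bar>} a \<partial>lborel) \<partial>lborel)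
      \<le> (\<integral>\<^sup>+c. (indicator {x$i - R..x$i + R} b * indicator {x$j - R..x$j + R} c) * ennreal (4 * pi / \<mu>) \<partial>lborel)"
      by eventually_elim (intro nn_integral_mono mult_left_mono shell_line_integral l, auto)
  qed
  also have "\<dots> = ennreal (2 * R) * (ennreal (2 * R) * ennreal (4 * pi / \<mu>))"
    using R by (simp add: mult.assoc nn_integral_cmult nn_integral_multc)
  also have "\<dots> = ennreal (16 * pi * R\<^sup>2 / \<mu>)"
    using R l by (simp add: ennreal_mult[symmetric] power2_eq_square)
  finally show ?thesis .
qed

text \<open>At every point some coordinate has the largest modulus, so three sectors cover the ball;
  overlaps only increase the upper bound.\<close>

lemma shell_ball_integral:
  fixes x :: "real^3"
  assumes l: "0 < \<mu>" and R: "0 \<le> R"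
  shows "(\<integral>\<^sup>+z. indicator (cball x R) z * ennreal (1 / (1 + (\<mu> * (norm z - t))\<^sup>2)) \<partial>lborel) \<le> ennreal (48 * pi * R\<^sup>2 / \<mu>)"
proof -
  let ?V = "\<lambda>i j k z. indicator {z. \<bar>x$i - z$i\<bar> \<le> R \<and> \<bar>x$j - z$j\<bar> \<le> R \<and> \<bar>z$i\<bar> \<le> \<bar>z$k\<bar> \<and> \<bar>z$j\<bar> \<le> \<bar>z$k\<bar>} z *
        ennreal (1 / (1 + (\<mu> * (norm z - t))\<^sup>2))"
  have [measurable]: "(\<lambda>z::real^3. z $ q) \<in> borel_measurable borel" for q
    by (intro borel_measurable_continuous_onI continuous_intros)
  have V [measurable]: "?V i j k \<in> borel_measurable borel" for i j k by measurable
  have "(\<integral>\<^sup>+z. indicator (cball x R) z * ennreal (1 / (1 + (\<mu> * (norm z - t))\<^sup>2)) \<partial>lborel)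
      \<le> (\<integral>\<^sup>+z. ?V 1 2 3 z + (?V 1 3 2 z + ?V 2 3 1 z) \<partial>lborel)"
  proof (rule nn_integral_mono)
    fix z :: "real^3"
    have "\<bar>x$q - z$q\<bar> \<le> R" if "z \<in> cball x R" for q
      using component_le_norm_cart[of "x - z" q] that by (simp add: dist_norm)
    moreover have "(\<bar>z$1\<bar> \<le> \<bar>z$3\<bar> \<and> \<bar>z$2\<bar> \<le> \<bar>z$3\<bar>) \<or> (\<bar>z$1\<bar> \<le> \<bar>z$2\<bar> \<and> \<bar>z$3\<bar> \<le> \<bar>z$2\<bar>) \<or> (\<bar>z$2\<bar> \<le> \<bar>z$1\<bar> \<and> \<bar>z$3\<bar> \<le> \<bar>z$1\<bar>)"
      by linarith
    ultimately show "indicator (cball x R) z * ennreal (1 / (1 + (\<mu> * (norm z - t))\<^sup>2)) \<le> ?V 1 2 3 z + (?V 1 3 2 z + ?V 2 3 1 z)"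
      by (auto simp: indicator_def add_increasing2 add_increasing)
  qed
  also have "\<dots> = (\<integral>\<^sup>+z. ?V 1 2 3 z \<partial>lborel) + ((\<integral>\<^sup>+z. ?V 1 3 2 z \<partial>lborel) + (\<integral>\<^sup>+z. ?V 2 3 1 z \<partial>lborel))"
    by (subst nn_integral_add, simp, simp, subst nn_integral_add) simp_all
  also have "\<dots> \<le> ennreal (16 * pi * R\<^sup>2 / \<mu>) + (ennreal (16 * pi * R\<^sup>2 / \<mu>) + ennreal (16 * pi * R\<^sup>2 / \<mu>))"
    by (intro add_mono shell_sector_integral l R) simp_all
  also have "\<dots> = ennreal (48 * pi * R\<^sup>2 / \<mu>)"
    using l by (simp add: ennreal_plus[symmetric] del: ennreal_plus)
  finally show ?thesis .
qed

section \<open>Fourier transforms of radial functions\<close>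

text \<open>A disc of radius \<open>sqrt x\<close> has area \<open>pi * x\<close>, linear in the
  squared radius; half-lines generate the Borel sets, so this determines the image measure.\<close>

lemma distr_norm_squared_plane:
  "distr lborel borel (\<lambda>\<eta>::real \<times> real. (norm \<eta>)\<^sup>2) = density lborel (\<lambda>s. ennreal (pi * indicator {0..} s))"
    (is "?M = ?N")
proof (rule measure_eqI_generator_eq[where E="range atMost" and \<Omega>=UNIV and A="\<lambda>n. {..real n}"])
  have N: "emeasure ?N {..x} = ennreal (if 0 \<le> x then pi * x else 0)" for x :: real
  proof -
    have "emeasure ?N {..x} = (\<integral>\<^sup>+s. ennreal pi * indicator {0..x} s \<partial>lborel)"
      by (subst emeasure_density) (auto intro!: nn_integral_cong simp: indicator_def)
    then show ?thesis
      by (simp add: nn_integral_cmult emeasure_lborel_Icc_eq ennreal_mult[symmetric])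
  qed
  have M: "emeasure ?M {..x} = ennreal (if 0 \<le> x then pi * x else 0)" for x :: real
  proof -
    have "emeasure ?M {..x} = emeasure lborel {\<eta>::real \<times> real. (norm \<eta>)\<^sup>2 \<le> x}"
      by (subst emeasure_distr) (auto simp: vimage_def)
    also have "{\<eta>::real \<times> real. (norm \<eta>)\<^sup>2 \<le> x} = (if 0 \<le> x then cball 0 (sqrt x) else {})"
    proof (cases "0 \<le> x")
      case True
      have "(norm \<eta>)\<^sup>2 \<le> x \<longleftrightarrow> norm \<eta> \<le> sqrt x" for \<eta> :: "real \<times> real"
        using power_mono[of "norm \<eta>" "sqrt x" 2] real_le_rsqrt[of "norm \<eta>" x] True by auto
      then show ?thesis using True by auto
    next
      case False
      then have "\<not> (norm \<eta>)\<^sup>2 \<le> x" for \<eta> :: "real \<times> real"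
        using zero_le_power2[of "norm \<eta>"] by linarith
      then show ?thesis using False by auto
    qed
    also have "emeasure lborel \<dots> = ennreal (if 0 \<le> x then pi * x else 0)"
      by (simp add: emeasure_cball unit_ball_vol_2)
    finally show ?thesis .
  qed
  show "Int_stable (range atMost :: real set set)"
    by (auto simp: Int_stable_def)
  show "emeasure ?M X = emeasure ?N X" if "X \<in> range atMost" for X
    using that M N by auto
  show "sets ?M = sigma_sets UNIV (range atMost)" "sets ?N = sigma_sets UNIV (range atMost)"
    by (simp_all add: borel_eq_atMost)
  show "(\<Union>i. {..real i}) = UNIV"
    using real_arch_simple by auto
  show "emeasure ?M {..real i} \<noteq> \<infinity>" for i
    unfolding M by simp
qed auto

lemma distr_orthogonal_lborel:
  fixes Q :: "real^3 \<Rightarrow> real^3"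
  assumes Q: "orthogonal_transformation Q"
  shows "distr lborel borel Q = lborel"
proof (rule sym, rule lborel_eqI)
  have "linear Q" using Q by (rule orthogonal_transformation_linear)
  then have [measurable]: "Q \<in> borel_measurable borel"
    by (intro borel_measurable_continuous_onI linear_continuous_on linear_conv_bounded_linear[THEN iffD1])
  fix l u :: "real^3" assume lu: "\<And>b. b \<in> Basis \<Longrightarrow> l \<bullet> b \<le> u \<bullet> b"
  have "bij Q" using Q by (rule orthogonal_transformation_bij)
  then have pre: "Q -` box l u = inv Q ` box l u"
    by (simp add: bij_vimage_eq_inv_image)
  have Q': "orthogonal_transformation (inv Q)" using Q by (rule orthogonal_transformation_inv)
  have box: "box l u \<in> lmeasurable" by simp
  have lm: "inv Q ` box l u \<in> lmeasurable"
    by (rule measurable_orthogonal_image[OF Q' box])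
  have "emeasure (distr lborel borel Q) (box l u) = emeasure lborel (Q -` box l u)"
    by (subst emeasure_distr) auto
  also have "\<dots> = emeasure lebesgue (Q -` box l u)"
    using measurable_sets[of Q borel borel "box l u"] by simp
  also have "\<dots> = ennreal (measure lebesgue (inv Q ` box l u))"
    unfolding pre by (rule emeasure_eq_measure2[OF lm])
  also have "\<dots> = ennreal (measure lebesgue (box l u))"
    using measure_orthogonal_image[OF Q' box] by simp
  also have "\<dots> = ennreal (\<Prod>b\<in>Basis. (u - l) \<bullet> b)"
    using lu by (simp add: measure_lborel_box_eq)
  finally show "emeasure (distr lborel borel Q) (box l u) = ennreal (\<Prod>b\<in>Basis. (u - l) \<bullet> b)" .
qed simp

lemma integral_cis_symmetric_interval:
  fixes r b :: real
  assumes r: "r > 0" and b: "0 \<le> b"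
  shows "(\<integral>a. indicator {-b..b} a *\<^sub>R cis (r * a) \<partial>lborel) = complex_of_real (2 * sin (r * b) / r)"
proof -
  have "(\<integral>a. indicator {-b..b} a *\<^sub>R cis (r * a) \<partial>lborel)
      = cis (r * b) / (\<i> * r) - cis (r * (- b)) / (\<i> * r)"
  proof (rule integral_FTC_Icc)
    show "((\<lambda>a. cis (r * a) / (\<i> * r)) has_vector_derivative cis (r * x)) (at x within {-b..b})" for x
    proof -
      have "((\<lambda>w. exp (\<i> * r * w) / (\<i> * r)) has_field_derivative exp (\<i> * r * complex_of_real x)) (at (complex_of_real x))"
        by (rule derivative_eq_intros refl)+ (use r in auto)
      from has_vector_derivative_real_field[OF this] show ?thesis
        by (simp add: cis_conv_exp mult.assoc)
    qed
    show "continuous_on {-b..b} (\<lambda>a. cis (r * a))" by (intro continuous_intros)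
  qed (use b in auto)
  also have "\<dots> = complex_of_real (2 * sin (r * b) / r)"
    using r by (simp add: complex_eq_iff Re_divide Im_divide power2_eq_square)
  finally show ?thesis .
qed

text \<open>
  After a rotation \<open>z = r e\<^sub>1\<close>. The plane orthogonal to \<open>e\<^sub>1\<close> is integrated by means of the variable
  \<open>s = \<eta>\<^sub>1\<^sup>2 + \<eta>\<^sub>2\<^sup>2\<close>, in which the Lebesgue measure of the plane is \<open>\<pi> ds\<close>.
\<close>

lemma fourier_radial:
  fixes F :: "real \<Rightarrow> real" and z :: "real^3"
  assumes F [measurable]: "F \<in> borel_measurable borel" and B: "\<And>\<rho>. \<bar>F \<rho>\<bar> \<le> B"
    and F0: "\<And>\<rho>. \<rho> \<notin> {c..d} \<Longrightarrow> F \<rho> = 0" and cd: "0 < c" "c \<le> d" and z: "z \<noteq> 0"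
  shows "(\<integral>\<xi>. cis (z \<bullet> \<xi>) * complex_of_real (F (norm \<xi>)) \<partial>lborel)
    = complex_of_real (4 * pi / norm z * (\<integral>\<rho>. F \<rho> * \<rho> * sin (norm z * \<rho>) * indicator {c..d} \<rho> \<partial>lborel))"
proof -
  define r where "r = norm z"
  have r: "r > 0" using z by (simp add: r_def)
  have B0: "0 \<le> B" using B[of 0] by simp
  have d: "0 < d" using cd by simp
  have F0': "\<rho> < c \<Longrightarrow> F \<rho> = 0" "d < \<rho> \<Longrightarrow> F \<rho> = 0" for \<rho> using F0[of \<rho>] by auto
  define g where "g a s = cis (r * a) * complex_of_real (F (sqrt (a\<^sup>2 + s)))" for a s
  have [measurable]: "(\<lambda>(a, s). g a s) \<in> borel_measurable (borel \<Otimes>\<^sub>M borel)"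
    unfolding g_def by measurable
  have [measurable]: "g a \<in> borel_measurable borel" for a
    unfolding g_def[abs_def] by measurable
  let ?T = "\<lambda>(x, y, z). axis 1 x + axis 2 y + axis 3 z :: real^3"
  obtain Q :: "real^3 \<Rightarrow> real^3" where Q: "orthogonal_transformation Q" "Q (axis 1 r) = z"
  proof (rule orthogonal_transformation_exists[of "axis 1 r :: real^3" z])
    show "norm (axis 1 r :: real^3) = norm z"
    proof -
      have "norm (axis 1 r :: real^3) = sqrt (r * r)"
        unfolding norm_eq_sqrt_inner inner_axis_axis by simp
      then show ?thesis using r by (simp add: r_def)
    qed
  qed
  have "linear Q" using Q(1) by (rule orthogonal_transformation_linear)
  then have [measurable]: "Q \<in> borel_measurable borel"
    by (intro borel_measurable_continuous_onI linear_continuous_on linear_conv_bounded_linear[THEN iffD1])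
  have Qi: "z \<bullet> Q \<xi> = r * \<xi> $ 1" "norm (Q \<xi>) = norm \<xi>" for \<xi>
  proof -
    have "z \<bullet> Q \<xi> = axis 1 r \<bullet> \<xi>"
      using Q by (metis orthogonal_transformation_def)
    then show "z \<bullet> Q \<xi> = r * \<xi> $ 1" by (simp add: inner_axis' )
    show "norm (Q \<xi>) = norm \<xi>" using Q(1) by (simp add: orthogonal_transformation_norm)
  qed
  have [measurable]: "(\<lambda>\<xi>::real^3. \<xi> $ 1) \<in> borel_measurable borel"
    by (intro borel_measurable_continuous_onI continuous_intros)
  have "(\<integral>\<xi>. cis (z \<bullet> \<xi>) * complex_of_real (F (norm \<xi>)) \<partial>lborel)
      = (\<integral>\<xi>. cis (z \<bullet> \<xi>) * complex_of_real (F (norm \<xi>)) \<partial>distr lborel borel Q)"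
    by (simp add: distr_orthogonal_lborel[OF Q(1)])
  also have "\<dots> = (\<integral>(\<xi>::real^3). cis (r * \<xi> $ 1) * complex_of_real (F (norm \<xi>)) \<partial>lborel)"
    by (subst integral_distr) (simp_all add: Qi)
  also have "\<dots> = (\<integral>(\<xi>::real^3). cis (r * \<xi> $ 1) * complex_of_real (F (norm \<xi>))
      \<partial>distr lborel borel ?T)"
    by (subst distr_axis_sum_lborel) simp_all
  also have "\<dots> = (\<integral>(v::real \<times> real \<times> real). g (fst v) ((norm (snd v))\<^sup>2) \<partial>lborel)"
  proof (subst integral_distr)
    show "?T \<in> lborel \<rightarrow>\<^sub>M borel"
      using borel_measurable_axes by simp
    have "cis (r * (axis 1 x + axis 2 y + axis 3 w :: real^3) $ 1) * complex_of_real (F (norm (axis 1 x + axis 2 y + axis 3 w :: real^3)))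
       = g x ((norm (y, w))\<^sup>2)" for x y w
      unfolding g_def by (subst norm_axes) (simp_all add: axis_def norm_Pair add.assoc)
    then have "cis (r * (?T v) $ 1) * complex_of_real (F (norm (?T v))) = g (fst v) ((norm (snd v))\<^sup>2)" for v
      by (cases v) (simp only: split_conv fst_conv snd_conv)
    then show "(\<integral>v. cis (r * (?T v) $ 1) *
         complex_of_real (F (norm (?T v))) \<partial>lborel)
       = (\<integral>(v::real \<times> real \<times> real). g (fst v) ((norm (snd v))\<^sup>2) \<partial>lborel)"
      by (simp only:)
  qed measurable
  also have "\<dots> = (\<integral>a. (\<integral>(\<eta>::real \<times> real). g a ((norm \<eta>)\<^sup>2) \<partial>lborel) \<partial>lborel)"
  proof -
    have gm: "(\<lambda>v. g (fst v) ((norm (snd v :: real \<times> real))\<^sup>2)) \<in> borel_measurable borel"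
    proof -
      have [measurable]: "fst \<in> borel_measurable (borel :: (real \<times> real \<times> real) measure)"
        "snd \<in> borel_measurable (borel :: (real \<times> real \<times> real) measure)"
        by (intro borel_measurable_continuous_onI continuous_intros)+
      show ?thesis unfolding g_def by measurable
    qed
    have "integrable lborel (\<lambda>v. B * indicator (cball 0 d :: (real \<times> real \<times> real) set) v)"
      using emeasure_lborel_cball_finite[of "0 :: real \<times> real \<times> real" d]
      by (intro integrable_mult_right integrable_real_indicator) auto
    then have int: "integrable lborel (\<lambda>v. g (fst v) ((norm (snd v :: real \<times> real))\<^sup>2))"
    proof (rule Bochner_Integration.integrable_bound)
      have "cmod (g (fst v) ((norm (snd v))\<^sup>2)) \<le> B * indicator (cball 0 d) v" for v :: "real \<times> real \<times> real"
      proof -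
        have "sqrt ((fst v)\<^sup>2 + (norm (snd v))\<^sup>2) = norm v" by (simp add: norm_prod_def)
        then have "cmod (g (fst v) ((norm (snd v))\<^sup>2)) = \<bar>F (norm v)\<bar>"
          by (simp add: g_def norm_mult)
        then show ?thesis using B[of "norm v"] F0'(2)[of "norm v"] by (auto simp: indicator_def not_le)
      qed
      then show "AE v in lborel. norm (g (fst v) ((norm (snd v :: real \<times> real))\<^sup>2)) \<le> norm (B * indicator (cball 0 d) v)"
        using B0 by (auto intro!: AE_I2)
    qed (use gm in simp)
    show ?thesis
      using lborel_pair.integral_fst'[of "\<lambda>v. g (fst v) ((norm (snd v :: real \<times> real))\<^sup>2)"] int
      by (simp add: lborel_prod)
  qed
  \<comment> \<open>The variable \<open>u = a\<^sup>2 + s\<close> is the squared norm, so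
    \<open>F (sqrt u)\<close> no longer depends on \<open>a\<close>. After the exchange of
    integrals, \<open>a\<close> runs over \<open>{- sqrt u..sqrt u}\<close> and its phase integrates
    to a sine.\<close>
  also have "\<dots> = (\<integral>a. (\<integral>u. (pi * indicator {a\<^sup>2..} u * F (sqrt u)) *\<^sub>R cis (r * a) \<partial>lborel) \<partial>lborel)"
  proof (rule Bochner_Integration.integral_cong[OF refl])
    fix a
    have "(\<integral>(\<eta>::real \<times> real). g a ((norm \<eta>)\<^sup>2) \<partial>lborel) = (\<integral>s. g a s \<partial>distr lborel borel (\<lambda>\<eta>::real \<times> real. (norm \<eta>)\<^sup>2))"
      by (subst integral_distr) auto
    also have "\<dots> = (\<integral>s. (pi * indicator {0..} s) *\<^sub>R g a s \<partial>lborel)"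
      unfolding distr_norm_squared_plane by (subst integral_density) auto
    also have "\<dots> = (\<integral>u. (pi * indicator {0..} (- a\<^sup>2 + 1 * u)) *\<^sub>R g a (- a\<^sup>2 + 1 * u) \<partial>lborel)"
      by (subst lborel_integral_real_affine[where c=1 and t="- a\<^sup>2"]) auto
    also have "\<dots> = (\<integral>u. (pi * indicator {a\<^sup>2..} u * F (sqrt u)) *\<^sub>R cis (r * a) \<partial>lborel)"
      by (intro Bochner_Integration.integral_cong refl)
         (auto simp: g_def indicator_def scaleR_conv_of_real)
    finally show "(\<integral>(\<eta>::real \<times> real). g a ((norm \<eta>)\<^sup>2) \<partial>lborel)
      = (\<integral>u. (pi * indicator {a\<^sup>2..} u * F (sqrt u)) *\<^sub>R cis (r * a) \<partial>lborel)" .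
  qed
  also have "\<dots> = (\<integral>u. (\<integral>a. (pi * indicator {a\<^sup>2..} u * F (sqrt u)) *\<^sub>R cis (r * a) \<partial>lborel) \<partial>lborel)"
  proof (rule lborel_pair.Fubini_integral[symmetric])
    have [measurable]: "(\<lambda>v::real \<times> real. indicator {(fst v)\<^sup>2..} (snd v) :: real) \<in> borel_measurable (borel \<Otimes>\<^sub>M borel)"
      unfolding indicator_def atLeast_iff by measurable
    have m: "(\<lambda>v. (pi * indicator {(fst v)\<^sup>2..} (snd v) * F (sqrt (snd v))) *\<^sub>R cis (r * fst v)) \<in> borel_measurable (borel \<Otimes>\<^sub>M borel)"
      by measurable
    \<comment> \<open>On the support \<open>\<bar>a\<bar> \<le> sqrt u \<le> d\<close>, so the point
      \<open>(a, u)\<close> lies in the ball of radius \<open>d + d\<^sup>2\<close>.\<close>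
    have "integrable lborel (\<lambda>v. (pi * B) * indicator (cball 0 (d + d\<^sup>2) :: (real \<times> real) set) v)"
      using emeasure_lborel_cball_finite[of "0 :: real \<times> real" "d + d\<^sup>2"]
      by (intro integrable_mult_right integrable_real_indicator) auto
    then have "integrable lborel (\<lambda>v. (pi * indicator {(fst v)\<^sup>2..} (snd v) * F (sqrt (snd v))) *\<^sub>R cis (r * fst v))"
    proof (rule Bochner_Integration.integrable_bound)
      have "norm ((pi * indicator {(fst v)\<^sup>2..} (snd v) * F (sqrt (snd v))) *\<^sub>R cis (r * fst v))
        \<le> pi * B * indicator (cball 0 (d + d\<^sup>2)) v" for v :: "real \<times> real"
      proof (cases "(fst v)\<^sup>2 \<le> snd v \<and> sqrt (snd v) \<le> d")
        case True
        then have "\<bar>fst v\<bar> \<le> sqrt (snd v)" by (intro real_le_rsqrt) auto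
        then have 1: "\<bar>fst v\<bar> \<le> d" using True by simp
        have 2: "0 \<le> snd v" using True order_trans[OF zero_le_power2] by blast
        then have "snd v \<le> d\<^sup>2" using True power_mono[of "sqrt (snd v)" d 2] by simp
        then have "norm v \<le> d + d\<^sup>2"
          using 1 2 norm_Pair_le[of "fst v" "snd v"] by simp
        then show ?thesis using True B[of "sqrt (snd v)"] by (simp add: indicator_def abs_mult)
      next
        case False
        then have "indicator {(fst v)\<^sup>2..} (snd v) * F (sqrt (snd v)) = 0"
          using F0'(2) by (auto simp: indicator_def)
        then show ?thesis using B0 by (simp add: indicator_def)
      qed
      then show "AE v in lborel. norm ((pi * indicator {(fst v)\<^sup>2..} (snd v) * F (sqrt (snd v))) *\<^sub>R cis (r * fst v))
        \<le> norm (pi * B * indicator (cball 0 (d + d\<^sup>2)) v)"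
        using B0 by (auto intro!: AE_I2)
    qed (use m in \<open>simp add: borel_prod\<close>)
    then show "integrable (lborel \<Otimes>\<^sub>M lborel) (\<lambda>(a, u). (pi * indicator {a\<^sup>2..} u * F (sqrt u)) *\<^sub>R cis (r * a))"
      by (simp add: lborel_prod case_prod_unfold)
  qed
  also have "\<dots> = (\<integral>u. complex_of_real (2 * pi / r * (F (sqrt u) * sin (r * sqrt u))) \<partial>lborel)"
  proof (rule Bochner_Integration.integral_cong[OF refl])
    fix u
    show "(\<integral>a. (pi * indicator {a\<^sup>2..} u * F (sqrt u)) *\<^sub>R cis (r * a) \<partial>lborel)
      = complex_of_real (2 * pi / r * (F (sqrt u) * sin (r * sqrt u)))"
    proof (cases "0 \<le> u")
      case True
      have ind: "indicator {a\<^sup>2..} u = (indicator {- sqrt u..sqrt u} a :: real)" for a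
        using True real_sqrt_le_iff[of "a\<^sup>2" u] by (auto simp: indicator_def abs_le_iff)
      have "(\<integral>a. (pi * indicator {a\<^sup>2..} u * F (sqrt u)) *\<^sub>R cis (r * a) \<partial>lborel)
        = (\<integral>a. (pi * F (sqrt u)) *\<^sub>R (indicator {- sqrt u..sqrt u} a *\<^sub>R cis (r * a)) \<partial>lborel)"
        unfolding ind by (simp add: ac_simps)
      also have "\<dots> = (pi * F (sqrt u)) *\<^sub>R (\<integral>a. indicator {- sqrt u..sqrt u} a *\<^sub>R cis (r * a) \<partial>lborel)"
        by (rule integral_scaleR_right)
      also have "\<dots> = complex_of_real (2 * pi / r * (F (sqrt u) * sin (r * sqrt u)))"
        using True by (subst integral_cis_symmetric_interval[OF r]) (simp_all add: scaleR_conv_of_real)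
      finally show ?thesis .
    next
      case False
      \<comment> \<open>\<open>sqrt\<close> of a negative number is negative here, hence below
        \<open>c\<close>, where \<open>F\<close> vanishes.\<close>
      then have "F (sqrt u) = 0" using cd by (intro F0'(1)) (simp add: order.strict_trans[of _ 0])
      then show ?thesis by simp
    qed
  qed
  also have "\<dots> = complex_of_real (2 * pi / r * (\<integral>u. F (sqrt u) * sin (r * sqrt u) \<partial>lborel))"
    by (simp only: integral_complex_of_real integral_mult_right_zero)
  also have "(\<integral>u. F (sqrt u) * sin (r * sqrt u) \<partial>lborel)
      = (\<integral>u. F (sqrt u) * sin (r * sqrt u) * indicator {c\<^sup>2..d\<^sup>2} u \<partial>lborel)"
  proof (intro Bochner_Integration.integral_cong refl)
    fix u :: real
    have "F (sqrt u) = 0" if "u \<notin> {c\<^sup>2..d\<^sup>2}"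
    proof -
      have "sqrt u < c \<or> d < sqrt u"
        using that cd real_less_rsqrt[of d u] real_less_lsqrt[of c u]
        by (cases "0 \<le> u") (auto simp: not_le order.strict_trans[of _ 0] real_sqrt_lt_0_iff)
      then show ?thesis using F0' by auto
    qed
    then show "F (sqrt u) * sin (r * sqrt u) = F (sqrt u) * sin (r * sqrt u) * indicator {c\<^sup>2..d\<^sup>2} u"
      by (auto simp: indicator_def)
  qed
  \<comment> \<open>The Jacobian \<open>2 * \<rho>\<close> of \<open>u = \<rho>\<^sup>2\<close> is
    the origin of the weight \<open>\<rho>\<close> in the formula.\<close>
  also have "\<dots> = (\<integral>\<rho>. F (sqrt (\<rho>\<^sup>2)) * sin (r * sqrt (\<rho>\<^sup>2)) * (2 * \<rho>) * indicator {c..d} \<rho> \<partial>lborel)"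
  proof (rule integral_substitution(2))
    have "integrable lborel (\<lambda>u. B * indicator {c\<^sup>2..d\<^sup>2} u)"
      by (intro integrable_mult_right integrable_real_indicator) (auto simp: emeasure_lborel_Icc_eq)
    then show "set_integrable lborel {c\<^sup>2..d\<^sup>2} (\<lambda>u. F (sqrt u) * sin (r * sqrt u))"
      unfolding set_integrable_def
    proof (rule Bochner_Integration.integrable_bound)
      have "\<bar>F (sqrt u) * sin (r * sqrt u)\<bar> \<le> B" for u
        using mult_mono[OF B[of "sqrt u"] abs_sin_le_one[of "r * sqrt u"]] B0 by (simp add: abs_mult)
      then show "AE u in lborel. norm (indicator {c\<^sup>2..d\<^sup>2} u *\<^sub>R (F (sqrt u) * sin (r * sqrt u))) \<le> norm (B * indicator {c\<^sup>2..d\<^sup>2} u)"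
        using B0 by (auto intro!: AE_I2 simp: indicator_def)
    qed measurable
    show "((\<lambda>\<rho>. \<rho>\<^sup>2) has_real_derivative 2 * x) (at x)" for x :: real
      by (auto intro!: derivative_eq_intros)
    show "continuous_on {c..d} (\<lambda>\<rho>. 2 * \<rho>)" by (intro continuous_intros)
  qed (use cd in auto)
  also have "\<dots> = (\<integral>\<rho>. 2 * (F \<rho> * \<rho> * sin (r * \<rho>) * indicator {c..d} \<rho>) \<partial>lborel)"
    using cd by (intro Bochner_Integration.integral_cong refl) (auto simp: indicator_def)
  also have "\<dots> = 2 * (\<integral>\<rho>. F \<rho> * \<rho> * sin (r * \<rho>) * indicator {c..d} \<rho> \<partial>lborel)"
    by (rule integral_mult_right_zero)
  finally show ?thesis by (simp add: r_def mult.commute mult.left_commute)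
qed

section \<open>Oscillatory integrals\<close>

text \<open>The derivatives are explicit arguments, and the vanishing of \<open>P\<close> and
  \<open>P'\<close> at both ends removes the boundary terms of two integrations by parts.\<close>

definition C2_bump :: "(real \<Rightarrow> real) \<Rightarrow> (real \<Rightarrow> real) \<Rightarrow> (real \<Rightarrow> real) \<Rightarrow> real \<Rightarrow> bool" where
  "C2_bump P P' P'' M \<longleftrightarrow>
     (\<forall>x\<in>{1/2..2}. (P has_real_derivative P' x) (at x) \<and> (P' has_real_derivative P'' x) (at x) \<and>
        isCont P'' x \<and> \<bar>P x\<bar> \<le> M \<and> \<bar>P' x\<bar> \<le> M \<and> \<bar>P'' x\<bar> \<le> M) \<and>
     P (1/2) = 0 \<and> P 2 = 0 \<and> P' (1/2) = 0 \<and> P' 2 = 0"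

lemma C2_bumpD:
  assumes "C2_bump P P' P'' M" "1/2 \<le> x" "x \<le> 2"
  shows "(P has_real_derivative P' x) (at x)" "(P' has_real_derivative P'' x) (at x)"
    "isCont P x" "isCont P' x" "isCont P'' x" "\<bar>P x\<bar> \<le> M" "\<bar>P' x\<bar> \<le> M" "\<bar>P'' x\<bar> \<le> M"
  using assms unfolding C2_bump_def by (auto intro: DERIV_isCont)

lemma C2_bump_nonneg: "C2_bump P P' P'' M \<Longrightarrow> 0 \<le> M"
  using C2_bumpD(6)[of P P' P'' M 1] by simp

lemma integrable_continuous_Icc:
  fixes f :: "real \<Rightarrow> real"
  assumes "\<And>x. a \<le> x \<Longrightarrow> x \<le> b \<Longrightarrow> isCont f x"
  shows "integrable lborel (\<lambda>x. f x * indicator {a..b} x)"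
  using borel_integrable_atLeastAtMost[of a b f] assms by (simp add: indicator_def if_distrib cong: if_cong)

lemma abs_integral_Icc_le:
  fixes f :: "real \<Rightarrow> real"
  assumes "a \<le> b" and f: "\<And>x. a \<le> x \<Longrightarrow> x \<le> b \<Longrightarrow> isCont f x" "\<And>x. a \<le> x \<Longrightarrow> x \<le> b \<Longrightarrow> \<bar>f x\<bar> \<le> K"
  shows "\<bar>\<integral>x. f x * indicator {a..b} x \<partial>lborel\<bar> \<le> K * (b - a)"
proof -
  have "norm (\<integral>x. f x * indicator {a..b} x \<partial>lborel) \<le> (\<integral>x. K * indicator {a..b} x \<partial>lborel)"
  proof (rule Bochner_Integration.integral_norm_bound_integral)
    show "integrable lborel (\<lambda>x. K * indicator {a..b} x)"
      by (rule integrable_continuous_Icc) simp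
    show "norm (f x * indicator {a..b} x) \<le> K * indicator {a..b} x" for x
      using f(2)[of x] by (simp add: indicator_def)
  qed (rule integrable_continuous_Icc[OF f(1)])
  also have "\<dots> = K * (b - a)"
    using assms(1) by simp
  finally show ?thesis by simp
qed

text \<open>Two integrations by parts, carried out with an explicit antiderivative.\<close>

lemma oscillatory_integral_bound:
  assumes P: "C2_bump P P' P'' M"
  shows "\<bar>\<integral>x. P x * cos (a * x) * indicator {1/2..2} x \<partial>lborel\<bar> \<le> 3 * M / (1 + a\<^sup>2)"
    and "\<bar>\<integral>x. P x * sin (a * x) * indicator {1/2..2} x \<partial>lborel\<bar> \<le> 3 * M / (1 + a\<^sup>2)"
proof -
  note D = C2_bumpD[OF P]
  have ends: "P (1/2) = 0" "P 2 = 0" "P' (1/2) = 0" "P' 2 = 0"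
    using P by (auto simp: C2_bump_def)
  have pos: "0 < 1 + a\<^sup>2" by (simp add: add_pos_nonneg)
  have main: "\<bar>\<integral>x. P x * T x * indicator {1/2..2} x \<partial>lborel\<bar> \<le> 3 * M / (1 + a\<^sup>2)"
    if T: "\<And>x. isCont T x" "\<And>x. \<bar>T x\<bar> \<le> 1"
      and G: "\<And>x. 1/2 \<le> x \<Longrightarrow> x \<le> 2 \<Longrightarrow> (G has_real_derivative (a\<^sup>2 * P x * T x + P'' x * T x)) (at x)"
        "G (1/2) = 0" "G 2 = 0" for T G
  proof -
    have c: "isCont (\<lambda>x. P x * T x) x" "isCont (\<lambda>x. P'' x * T x) x" if "1/2 \<le> x" "x \<le> 2" for x
      using D[OF that] T(1) by (auto intro!: continuous_intros)
    let ?I = "\<integral>x. P x * T x * indicator {1/2..2} x \<partial>lborel"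
    let ?J = "\<integral>x. P'' x * T x * indicator {1/2..2} x \<partial>lborel"
    have int: "integrable lborel (\<lambda>x. P x * T x * indicator {1/2..2} x)"
      "integrable lborel (\<lambda>x. P'' x * T x * indicator {1/2..2} x)"
      by (rule integrable_continuous_Icc, erule (1) c)+
    have "(\<integral>x. (a\<^sup>2 * P x * T x + P'' x * T x) * indicator {1/2..2} x \<partial>lborel) = G 2 - G (1/2)"
    proof (rule integral_FTC_Icc_real)
      show "isCont (\<lambda>x. a\<^sup>2 * P x * T x + P'' x * T x) x" if "1/2 \<le> x" "x \<le> 2" for x
        using D[OF that] T(1) by (auto intro!: continuous_intros)
    qed (use G in auto)
    moreover have "(\<integral>x. (a\<^sup>2 * P x * T x + P'' x * T x) * indicator {1/2..2} x \<partial>lborel)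
      = (\<integral>x. a\<^sup>2 * (P x * T x * indicator {1/2..2} x) + P'' x * T x * indicator {1/2..2} x \<partial>lborel)"
      by (intro Bochner_Integration.integral_cong refl) (simp add: algebra_simps)
    moreover have "\<dots> = a\<^sup>2 * ?I + ?J"
      by (subst Bochner_Integration.integral_add) (use int in auto)
    \<comment> \<open>Adding \<open>?I\<close> to \<open>a\<^sup>2 * ?I = - ?J\<close> treats small
      and large \<open>a\<close> together and produces \<open>1 + a\<^sup>2\<close>. Two integrals
      over an interval of length 3/2 give the constant 3.\<close>
    ultimately have "(1 + a\<^sup>2) * ?I = ?I - ?J"
      using G by (simp add: algebra_simps)
    then have "\<bar>(1 + a\<^sup>2) * ?I\<bar> = \<bar>?I - ?J\<bar>"
      by (rule arg_cong)
    then have eq: "(1 + a\<^sup>2) * \<bar>?I\<bar> = \<bar>?I - ?J\<bar>"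
      unfolding abs_mult abs_of_pos[OF pos] .
    have PT: "\<bar>P x * T x\<bar> \<le> M" "\<bar>P'' x * T x\<bar> \<le> M" if "1/2 \<le> x" "x \<le> 2" for x
      using mult_mono[OF D(6)[OF that] T(2)[of x]] mult_mono[OF D(8)[OF that] T(2)[of x]] C2_bump_nonneg[OF P]
      by (simp_all add: abs_mult)
    have IJ: "\<bar>?I\<bar> \<le> M * (2 - 1/2)" "\<bar>?J\<bar> \<le> M * (2 - 1/2)"
      by (rule abs_integral_Icc_le; use c PT in force)+
    have "\<bar>?I - ?J\<bar> \<le> \<bar>?I\<bar> + \<bar>?J\<bar>"
      by (rule abs_triangle_ineq4)
    also have "\<dots> \<le> M * (2 - 1/2) + M * (2 - 1/2)"
      by (rule add_mono[OF IJ])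
    finally have "(1 + a\<^sup>2) * \<bar>?I\<bar> \<le> 3 * M"
      unfolding eq by simp
    then show ?thesis using pos by (simp add: field_simps)
  qed
  show "\<bar>\<integral>x. P x * cos (a * x) * indicator {1/2..2} x \<partial>lborel\<bar> \<le> 3 * M / (1 + a\<^sup>2)"
  proof (rule main[where G="\<lambda>x. a * P x * sin (a * x) + P' x * cos (a * x)"])
    show "((\<lambda>x. a * P x * sin (a * x) + P' x * cos (a * x)) has_real_derivative
        (a\<^sup>2 * P x * cos (a * x) + P'' x * cos (a * x))) (at x)" if "1/2 \<le> x" "x \<le> 2" for x
      by (rule derivative_eq_intros D[OF that] refl)+ (simp add: algebra_simps power2_eq_square)
  qed (use ends in \<open>auto intro!: continuous_intros\<close>)
  show "\<bar>\<integral>x. P x * sin (a * x) * indicator {1/2..2} x \<partial>lborel\<bar> \<le> 3 * M / (1 + a\<^sup>2)"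
  proof (rule main[where G="\<lambda>x. - (a * P x * cos (a * x)) + P' x * sin (a * x)"])
    show "((\<lambda>x. - (a * P x * cos (a * x)) + P' x * sin (a * x)) has_real_derivative
        (a\<^sup>2 * P x * sin (a * x) + P'' x * sin (a * x))) (at x)" if "1/2 \<le> x" "x \<le> 2" for x
      by (rule derivative_eq_intros D[OF that] refl)+ (simp add: algebra_simps power2_eq_square)
  qed (use ends in \<open>auto intro!: continuous_intros\<close>)
qed

lemma abs_sin_div_le:
  fixes r x :: real
  assumes "0 < r" "0 \<le> x" shows "\<bar>sin (r * x) / r\<bar> \<le> x"
  using abs_sin_x_le_abs_x[of "r * x"] assms by (simp add: abs_mult field_simps)

text \<open>For \<open>r \<le> 1\<close> the quotient \<open>sin (r * x) / r\<close> is an amplitude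
  bounded by \<open>x \<le> 2\<close>, with derivatives bounded uniformly as \<open>r\<close> tends
  to 0. The constant 5 is 2 + 2 + 1, from the three terms of the second derivative.\<close>

lemma C2_bump_mult_sin:
  assumes P: "C2_bump P P' P'' M" and r: "0 < r" "r \<le> 1"
  shows "C2_bump (\<lambda>x. P x * (sin (r * x) / r)) (\<lambda>x. P' x * (sin (r * x) / r) + P x * cos (r * x))
    (\<lambda>x. P'' x * (sin (r * x) / r) + 2 * (P' x * cos (r * x)) - P x * (r * sin (r * x))) (5 * M)"
  unfolding C2_bump_def
proof (intro conjI ballI)
  fix x :: real assume "x \<in> {1/2..2}"
  then have x: "1/2 \<le> x" "x \<le> 2" by auto
  note D = C2_bumpD[OF P x]
  have rn: "r \<noteq> 0" using r by simp
  have M: "0 \<le> M" by (rule C2_bump_nonneg[OF P])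
  have s: "\<bar>sin (r * x) / r\<bar> \<le> 2"
    using abs_sin_div_le[OF r(1), of x] x by linarith
  have rs: "\<bar>r * sin (r * x)\<bar> \<le> 1"
    using mult_mono[of r 1 "\<bar>sin (r * x)\<bar>" 1] r by (simp add: abs_mult)
  have b: "\<bar>u * v\<bar> \<le> M * K" if "\<bar>u\<bar> \<le> M" "\<bar>v\<bar> \<le> K" for u v K :: real
    using mult_mono[OF that] M by (simp add: abs_mult)
  note b0 = b[OF D(6) s] b[OF D(7) s] b[OF D(8) s]
  note b1 = b[OF D(6) abs_cos_le_one[of "r * x"]] b[OF D(7) abs_cos_le_one[of "r * x"]] b[OF D(6) rs]
  show "((\<lambda>x. P x * (sin (r * x) / r)) has_real_derivative P' x * (sin (r * x) / r) + P x * cos (r * x)) (at x)"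
    by (rule derivative_eq_intros D rn refl)+ (use r in \<open>auto simp: field_simps\<close>)
  show "((\<lambda>x. P' x * (sin (r * x) / r) + P x * cos (r * x)) has_real_derivative
     P'' x * (sin (r * x) / r) + 2 * (P' x * cos (r * x)) - P x * (r * sin (r * x))) (at x)"
    by (rule derivative_eq_intros D rn refl)+ (use r in \<open>auto simp: field_simps\<close>)
  show "isCont (\<lambda>x. P'' x * (sin (r * x) / r) + 2 * (P' x * cos (r * x)) - P x * (r * sin (r * x))) x"
    using D r by (auto intro!: continuous_intros)
  show "\<bar>P x * (sin (r * x) / r)\<bar> \<le> 5 * M"
    using b0 M by linarith
  show "\<bar>P' x * (sin (r * x) / r) + P x * cos (r * x)\<bar> \<le> 5 * M"
    using b0 b1 M by linarith
  show "\<bar>P'' x * (sin (r * x) / r) + 2 * (P' x * cos (r * x)) - P x * (r * sin (r * x))\<bar> \<le> 5 * M"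
    using b0 b1 M by linarith
qed (use P in \<open>auto simp: C2_bump_def\<close>)

lemma cross_mult_frac_le:
  fixes a b x y :: real
  shows "0 < a \<Longrightarrow> 0 < b \<Longrightarrow> x * b \<le> y * a \<Longrightarrow> x / a \<le> y / b"
  by (simp add: field_simps)

text \<open>For \<open>r \<le> 1\<close> the factor \<open>sin (r * x) / r\<close> joins the
  amplitude. For \<open>r > 1\<close> the product formulas combine it with \<open>T\<close> into the
  phases \<open>t - r\<close> and \<open>t + r\<close>, and \<open>1 / r\<close> is left over for
  the decay in \<open>t\<close>.\<close>

lemma spherical_wave_bound:
  fixes t r :: real
  assumes P: "C2_bump P P' P'' M" and t: "0 \<le> t" and r: "0 < r" and T: "T = sin \<or> T = cos"
  shows "\<bar>\<integral>x. P x * T (t * x) * (sin (r * x) / r) * indicator {1/2..2} x \<partial>lborel\<bar>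
     \<le> 60 * M / ((1 + t) * sqrt (1 + (t - r)\<^sup>2))" (is "\<bar>?J\<bar> \<le> _")
proof -
  have M: "0 \<le> M" by (rule C2_bump_nonneg[OF P])
  define w where "w = sqrt (1 + (t - r)\<^sup>2)"
  have w2: "w\<^sup>2 = 1 + (t - r)\<^sup>2" unfolding w_def by (simp add: add_nonneg_nonneg)
  have w1: "1 \<le> w" unfolding w_def by simp
  have pos: "0 < (1 + t) * w" using t w1 by (intro mult_pos_pos) auto
  have wle: "w \<le> 1 + \<bar>t - r\<bar>"
    unfolding w_def by (intro real_le_lsqrt) (auto simp: power2_sum)
  have wge: "\<bar>t - r\<bar> \<le> w" unfolding w_def by (rule real_le_rsqrt) simp
  show ?thesis
  proof (cases "r \<le> 1")
    case True
    have "?J = (\<integral>x. (P x * (sin (r * x) / r)) * T (t * x) * indicator {1/2..2} x \<partial>lborel)"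
      by (intro Bochner_Integration.integral_cong refl) (simp add: ac_simps)
    then have "\<bar>?J\<bar> \<le> 3 * (5 * M) / (1 + t\<^sup>2)"
      using oscillatory_integral_bound[OF C2_bump_mult_sin[OF P r True], of t] T by auto
    also have "\<dots> \<le> 60 * M / ((1 + t) * w)"
    proof -
      \<comment> \<open>With \<open>w\<close> at most \<open>2 + t\<close>, the decay
        \<open>1 / (1 + t\<^sup>2)\<close> covers both factors; the 60 of the statement is 15 times
        4.\<close>
      have "w \<le> 2 + t" using wle t r True by (simp add: abs_if split: if_splits)
      then have "(1 + t) * w \<le> (1 + t) * (2 + t)" using t by (intro mult_left_mono) auto
      also have "\<dots> \<le> 4 * (1 + t\<^sup>2)"
        using zero_le_power2[of "t - 1/2"] zero_le_power2[of t] by (simp add: power2_eq_square algebra_simps)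
      finally have "15 * M * ((1 + t) * w) \<le> 15 * M * (4 * (1 + t\<^sup>2))"
        using M by (intro mult_left_mono) auto
      then show ?thesis using pos by (intro cross_mult_frac_le) (auto simp: add_pos_nonneg algebra_simps)
    qed
    finally show ?thesis unfolding w_def .
  next
    case False
    note ocos = oscillatory_integral_bound(1)[OF P] and osin = oscillatory_integral_bound(2)[OF P]
    have far: "3 * M / (1 + (t + r)\<^sup>2) \<le> 3 * M / w\<^sup>2"
    proof (rule divide_left_mono)
      have "\<bar>t - r\<bar> \<le> t + r" using t r by simp
      from power_mono[OF this, of 2] show "w\<^sup>2 \<le> 1 + (t + r)\<^sup>2" by (simp add: w2)
    qed (use M w1 in \<open>auto intro!: mult_pos_pos add_pos_nonneg\<close>)
    have c: "isCont (\<lambda>x. P x * cos (a * x)) x" "isCont (\<lambda>x. P x * sin (a * x)) x"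
      if "1/2 \<le> x" "x \<le> 2" for x a
      using C2_bumpD[OF P that] by (auto intro!: continuous_intros)
    have int: "integrable lborel (\<lambda>x. P x * cos (a * x) * indicator {1/2..2} x)"
       "integrable lborel (\<lambda>x. P x * sin (a * x) * indicator {1/2..2} x)" for a
      by (rule integrable_continuous_Icc, erule (1) c)+
    obtain I1 I2 where J: "?J = 1 / (2 * r) * (I1 + I2)" and I: "\<bar>I1\<bar> \<le> 3 * M / w\<^sup>2" "\<bar>I2\<bar> \<le> 3 * M / w\<^sup>2"
    proof (cases "T = sin")
      case True
      have "?J = (\<integral>x. 1 / (2 * r) * (P x * cos ((t - r) * x) * indicator {1/2..2} x
          + - (P x * cos ((t + r) * x) * indicator {1/2..2} x)) \<partial>lborel)"
        using r by (intro Bochner_Integration.integral_cong refl)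
          (simp add: True left_diff_distrib distrib_right cos_diff cos_add field_simps)
      also have "\<dots> = 1 / (2 * r) * ((\<integral>x. P x * cos ((t - r) * x) * indicator {1/2..2} x \<partial>lborel)
          + - (\<integral>x. P x * cos ((t + r) * x) * indicator {1/2..2} x \<partial>lborel))"
        using int by (subst integral_mult_right_zero, subst Bochner_Integration.integral_add) auto
      finally show ?thesis
        by (rule that) (use ocos[of "t - r"] order_trans[OF ocos[of "t + r"] far] in \<open>auto simp: w2\<close>)
    next
      case False
      then have Tc: "T = cos" using T by simp
      have "?J = (\<integral>x. 1 / (2 * r) * (P x * sin ((t + r) * x) * indicator {1/2..2} x
          + - (P x * sin ((t - r) * x) * indicator {1/2..2} x)) \<partial>lborel)"
        using r by (intro Bochner_Integration.integral_cong refl)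
          (simp add: Tc left_diff_distrib distrib_right sin_diff sin_add field_simps)
      also have "\<dots> = 1 / (2 * r) * ((\<integral>x. P x * sin ((t + r) * x) * indicator {1/2..2} x \<partial>lborel)
          + - (\<integral>x. P x * sin ((t - r) * x) * indicator {1/2..2} x \<partial>lborel))"
        using int by (subst integral_mult_right_zero, subst Bochner_Integration.integral_add) auto
      finally show ?thesis
        by (rule that) (use osin[of "t - r"] order_trans[OF osin[of "t + r"] far] in \<open>auto simp: w2\<close>)
    qed
    have "\<bar>?J\<bar> = 1 / (2 * r) * \<bar>I1 + I2\<bar>"
      unfolding J using r by (simp add: abs_mult)
    also have "\<dots> \<le> 1 / (2 * r) * (2 * (3 * M / w\<^sup>2))"
      by (intro mult_left_mono) (use I r in auto)
    also have "\<dots> = 3 * M / (r * w\<^sup>2)" using r by (simp add: field_simps)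
    also have "\<dots> \<le> 60 * M / ((1 + t) * w)"
    proof -
      \<comment> \<open>From \<open>1 < r\<close> and \<open>t \<le> r + w\<close>. As
        \<open>r\<close> and \<open>w\<close> are at least 1, the sum is at most
        \<open>3 * (r * w)\<close>: one power of the shell decay is traded for decay in
        \<open>t\<close>. The 20 below is generous, to match the 60 of the other case.\<close>
      have "1 + t \<le> 2 * r + w" using wge False t by linarith
      also have "\<dots> \<le> 3 * (r * w)"
      proof -
        have "r * 1 \<le> r * w" "1 * w \<le> r * w" using w1 r False by (auto intro: mult_left_mono mult_right_mono)
        then show ?thesis by linarith
      qed
      finally have "(1 + t) * w \<le> 3 * (r * w) * w" using w1 by (intro mult_right_mono) auto
      moreover have rw: "0 < r * w\<^sup>2" using r w1 by (intro mult_pos_pos) auto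
      ultimately have "(1 + t) * w \<le> 20 * (r * w\<^sup>2)" by (simp add: power2_eq_square)
      then have "3 * M * ((1 + t) * w) \<le> 3 * M * (20 * (r * w\<^sup>2))"
        using M by (intro mult_left_mono) auto
      moreover note rw
      ultimately show ?thesis using pos by (intro cross_mult_frac_le) auto
    qed
    finally show ?thesis unfolding w_def .
  qed
qed

section \<open>The dispersive estimate\<close>

lemma isCont_bounded_Icc:
  fixes f :: "real \<Rightarrow> real"
  assumes "\<And>x. isCont f x"
  shows "\<exists>M. \<forall>x\<in>{a..b}. \<bar>f x\<bar> \<le> M"
proof -
  have "bounded (f ` {a..b})"
    by (intro compact_imp_bounded compact_continuous_image continuous_at_imp_continuous_on) (use assms in auto)
  then show ?thesis by (auto simp: bounded_iff)
qed

lemma C2_bump_exists: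
  fixes P P' P'' :: "real \<Rightarrow> real"
  assumes "\<And>x. (P has_real_derivative P' x) (at x)" "\<And>x. (P' has_real_derivative P'' x) (at x)"
    and c: "\<And>x. isCont P'' x"
    and "P (1/2) = 0" "P 2 = 0" "P' (1/2) = 0" "P' 2 = 0"
  shows "\<exists>M>0. C2_bump P P' P'' M"
proof -
  have "\<And>x. isCont P x" "\<And>x. isCont P' x"
    using assms(1,2) by (auto intro: DERIV_isCont)
  then obtain A B D where *: "\<forall>x\<in>{1/2..2}. \<bar>P x\<bar> \<le> A" "\<forall>x\<in>{1/2..2}. \<bar>P' x\<bar> \<le> B" "\<forall>x\<in>{1/2..2}. \<bar>P'' x\<bar> \<le> D"
    using isCont_bounded_Icc c by metis
  define M where "M = 1 + \<bar>A\<bar> + \<bar>B\<bar> + \<bar>D\<bar>"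
  have M: "A \<le> M" "B \<le> M" "D \<le> M" "0 < M" by (simp_all add: M_def)
  have "C2_bump P P' P'' M"
    unfolding C2_bump_def
  proof (intro conjI ballI)
    fix x :: real assume x: "x \<in> {1/2..2}"
    show "\<bar>P x\<bar> \<le> M" "\<bar>P' x\<bar> \<le> M" "\<bar>P'' x\<bar> \<le> M"
      using * x M by (blast intro: order_trans)+
  qed (use assms in auto)
  then show ?thesis using M(4) by blast
qed

lemma deriv_zero_locally_const:
  fixes f :: "real \<Rightarrow> real"
  assumes "open S" "x \<in> S" "\<And>y. y \<in> S \<Longrightarrow> f y = c"
  shows "deriv f x = 0"
proof (rule DERIV_imp_deriv)
  show "(f has_real_derivative 0) (at x)"
    by (rule has_field_derivative_transform_within_open[OF DERIV_const[of c] assms(1,2)]) (use assms(3) in simp)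
qed

lemma admissible_cutoffD:
  assumes "admissible_cutoff \<psi>"
  shows "\<And>x. (\<psi> has_real_derivative deriv \<psi> x) (at x)"
    and "\<And>x. (deriv \<psi> has_real_derivative deriv (deriv \<psi>) x) (at x)"
    and "\<And>x. isCont (deriv (deriv \<psi>)) x"
    and "\<And>x. \<bar>\<psi> x - \<psi> y\<bar> \<le> 1"
    and "\<And>x. \<bar>x\<bar> \<le> 5/4 \<Longrightarrow> \<psi> x = 1" and "\<And>x. 8/5 < \<bar>x\<bar> \<Longrightarrow> \<psi> x = 0"
    and "\<And>x. \<bar>x\<bar> < 5/4 \<Longrightarrow> deriv \<psi> x = 0" and "\<And>x. 8/5 < x \<Longrightarrow> deriv \<psi> x = 0"
proof -
  have diff: "((deriv ^^ n) \<psi>) differentiable (at x)" for n x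
    using assms by (auto simp: admissible_cutoff_def)
  show "(\<psi> has_real_derivative deriv \<psi> x) (at x)" for x
    using diff[of 0 x] by (simp add: DERIV_deriv_iff_real_differentiable)
  show "(deriv \<psi> has_real_derivative deriv (deriv \<psi>) x) (at x)" for x
    using diff[of 1 x] by (simp add: DERIV_deriv_iff_real_differentiable)
  show "isCont (deriv (deriv \<psi>)) x" for x
    using diff[of 2 x] by (simp add: numeral_2_eq_2 differentiable_imp_continuous_within)
  have "0 \<le> \<psi> x \<and> \<psi> x \<le> 1" for x
    using assms by (auto simp: admissible_cutoff_def image_subset_iff)
  then show "\<bar>\<psi> x - \<psi> y\<bar> \<le> 1" for x
    by (smt (verit))
  show 1: "\<psi> x = 1" if "\<bar>x\<bar> \<le> 5/4" for x
  proof -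
    have "x \<in> {-5/4..5/4}" using that by (auto simp: abs_if split: if_splits)
    then show ?thesis using assms unfolding admissible_cutoff_def by blast
  qed
  show 0: "\<psi> x = 0" if "8/5 < \<bar>x\<bar>" for x
  proof -
    have "x \<notin> {-8/5..8/5}" using that by (auto simp: abs_if split: if_splits)
    then show ?thesis using assms unfolding admissible_cutoff_def by blast
  qed
  show "deriv \<psi> x = 0" if "\<bar>x\<bar> < 5/4" for x
    by (rule deriv_zero_locally_const[of "{-5/4<..<5/4}" x \<psi> 1]) (use that 1 in auto)
  show "deriv \<psi> x = 0" if "8/5 < x" for x
    by (rule deriv_zero_locally_const[of "{8/5<..}" x \<psi> 0]) (use that 0 in auto)
qed

text \<open>For positive \<open>s\<close> the difference lives in \<open>{5/8..8/5}\<close>,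
  strictly inside \<open>{1/2..2}\<close>, so it vanishes with its derivative at the ends. The
  second bump retains the weight \<open>\<rho>\<close> of the radial formula, which the sine symbol
  cancels and the cosine symbol does not.\<close>

lemma cutoff_difference_bumps:
  assumes "admissible_cutoff \<psi>"
  obtains P' P'' Q' Q'' M where "M > 0" "C2_bump (\<lambda>s. \<psi> s - \<psi> (2 * s)) P' P'' M"
    "C2_bump (\<lambda>s. s * (\<psi> s - \<psi> (2 * s))) Q' Q'' M"
proof -
  note D = admissible_cutoffD[OF assms]
  let ?P = "\<lambda>s. \<psi> s - \<psi> (2 * s)" and ?P' = "\<lambda>s. deriv \<psi> s - 2 * deriv \<psi> (2 * s)"
  let ?P'' = "\<lambda>s. deriv (deriv \<psi>) s - 4 * deriv (deriv \<psi>) (2 * s)"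
  have D1: "((\<lambda>s. \<psi> (2 * s)) has_real_derivative 2 * deriv \<psi> (2 * x)) (at x)" for x
  proof -
    have "((\<lambda>s. 2 * s :: real) has_real_derivative 2) (at x)" by (auto intro!: derivative_eq_intros)
    from DERIV_chain2[where f="\<psi>" and g="\<lambda>s. 2 * s", OF D(1) this] show ?thesis by (simp add: mult.commute)
  qed
  have D2: "((\<lambda>s. deriv \<psi> (2 * s)) has_real_derivative 2 * deriv (deriv \<psi>) (2 * x)) (at x)" for x
  proof -
    have "((\<lambda>s. 2 * s :: real) has_real_derivative 2) (at x)" by (auto intro!: derivative_eq_intros)
    from DERIV_chain2[where f="deriv \<psi>" and g="\<lambda>s. 2 * s", OF D(2) this] show ?thesis by (simp add: mult.commute)
  qed
  have P1: "(?P has_real_derivative ?P' x) (at x)" for x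
    by (intro DERIV_diff D D1)
  have P2: "(?P' has_real_derivative ?P'' x) (at x)" for x
    using DERIV_diff[OF D(2)[of x] DERIV_cmult[OF D2[of x], of 2]] by simp
  have c2: "isCont (\<lambda>s. deriv (deriv \<psi>) (2 * s)) x" for x
    by (rule isCont_o2[of _ "\<lambda>s. 2 * s"]) (use D(3) in \<open>auto intro!: continuous_intros\<close>)
  have P3: "isCont ?P'' x" for x
    using D(3) c2 by (auto intro!: continuous_intros)
  \<comment> \<open>Near 1/2 and 1 the cutoff is constantly 1, near 2 and 4 constantly 0.\<close>
  have z: "?P (1/2) = 0" "?P 2 = 0" "?P' (1/2) = 0" "?P' 2 = 0"
    using D(5)[of "1/2"] D(5)[of 1] D(6)[of 2] D(6)[of 4] D(7)[of "1/2"] D(7)[of 1] D(8)[of 2] D(8)[of 4] by simp_all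
  obtain M1 where M1: "M1 > 0" "C2_bump ?P ?P' ?P'' M1"
    using C2_bump_exists[OF P1 P2 P3 z] by blast
  let ?Q = "\<lambda>s. s * ?P s" and ?Q' = "\<lambda>s. ?P s + s * ?P' s" and ?Q'' = "\<lambda>s. 2 * ?P' s + s * ?P'' s"
  have Q1: "(?Q has_real_derivative ?Q' x) (at x)" for x
    using DERIV_mult[OF DERIV_ident P1[of x]] by (simp add: algebra_simps)
  have Q2: "(?Q' has_real_derivative ?Q'' x) (at x)" for x
    using DERIV_add[OF P1[of x] DERIV_mult[OF DERIV_ident P2[of x]]] by (simp add: algebra_simps)
  have Q3: "isCont ?Q'' x" for x
    by (rule isCont_add[OF isCont_mult[OF continuous_const DERIV_isCont[OF P2]] isCont_mult[OF continuous_ident P3]])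
  obtain M2 where M2: "M2 > 0" "C2_bump ?Q ?Q' ?Q'' M2"
    using C2_bump_exists[OF Q1 Q2 Q3] z by auto
  have mono: "C2_bump A A' A'' (max M1 M2)" if "C2_bump A A' A'' m" "m \<le> max M1 M2" for A A' A'' m
    using that unfolding C2_bump_def by (auto intro: order_trans)
  show thesis
    by (rule that[OF _ mono[OF M1(2)] mono[OF M2(2)]]) (use M1(1) in auto)
qed

text \<open>Substituting \<open>\<rho> = \<mu> * x\<close> reduces to
  \<open>spherical_wave_bound\<close> with time and radius multiplied by \<open>\<mu>\<close>. The
  parameter \<open>\<nu>\<close> lets one statement cover both symbols. The constant is
  \<open>4 * pi\<close> times 60.\<close>

lemma radial_kernel_bound:
  fixes F :: "real \<Rightarrow> real" and z :: "real^3"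
  assumes P: "C2_bump P P' P'' M" and T: "T = sin \<or> T = cos" and pos: "0 < \<mu>" "0 \<le> t" "0 \<le> \<nu>"
    and F: "F \<in> borel_measurable borel" "\<And>\<rho>. \<bar>F \<rho>\<bar> \<le> B" "\<And>\<rho>. \<rho> \<notin> {\<mu>/2..2 * \<mu>} \<Longrightarrow> F \<rho> = 0"
    and FP: "\<And>\<rho>. \<rho> \<in> {\<mu>/2..2 * \<mu>} \<Longrightarrow> F \<rho> * \<rho> = \<nu> * P (\<rho> / \<mu>) * T (t * \<rho>)"
    and z: "z \<noteq> 0"
  shows "cmod (multiplier_kernel (\<lambda>\<xi>. F (norm \<xi>)) z)
    \<le> 240 * pi * M * \<nu> * \<mu>\<^sup>2 / (1 + \<mu> * t) / sqrt (1 + (\<mu> * (norm z - t))\<^sup>2)"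
proof -
  define r where "r = norm z"
  have r: "0 < r" using z by (simp add: r_def)
  let ?J = "\<integral>x. P x * T (\<mu> * t * x) * (sin (\<mu> * r * x) / (\<mu> * r)) * indicator {1/2..2} x \<partial>lborel"
  have "(\<integral>\<rho>. F \<rho> * \<rho> * sin (r * \<rho>) * indicator {\<mu>/2..2 * \<mu>} \<rho> \<partial>lborel)
     = \<bar>\<mu>\<bar> *\<^sub>R (\<integral>x. F (0 + \<mu> * x) * (0 + \<mu> * x) * sin (r * (0 + \<mu> * x)) * indicator {\<mu>/2..2 * \<mu>} (0 + \<mu> * x) \<partial>lborel)"
    by (rule lborel_integral_real_affine) (use pos in simp)
  also have "(\<integral>x. F (0 + \<mu> * x) * (0 + \<mu> * x) * sin (r * (0 + \<mu> * x)) * indicator {\<mu>/2..2 * \<mu>} (0 + \<mu> * x) \<partial>lborel)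
     = (\<integral>x. (\<nu> * \<mu> * r) * (P x * T (\<mu> * t * x) * (sin (\<mu> * r * x) / (\<mu> * r)) * indicator {1/2..2} x) \<partial>lborel)"
  proof (intro Bochner_Integration.integral_cong refl)
    fix x
    have mem: "\<mu> * x \<in> {\<mu>/2..2 * \<mu>} \<longleftrightarrow> x \<in> {1/2..2}"
      using mult_le_cancel_left_pos[of \<mu> "1/2" x] mult_le_cancel_left_pos[of \<mu> x 2] pos by (simp add: mult.commute)
    show "F (0 + \<mu> * x) * (0 + \<mu> * x) * sin (r * (0 + \<mu> * x)) * indicator {\<mu>/2..2 * \<mu>} (0 + \<mu> * x)
      = (\<nu> * \<mu> * r) * (P x * T (\<mu> * t * x) * (sin (\<mu> * r * x) / (\<mu> * r)) * indicator {1/2..2} x)"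
    proof (cases "x \<in> {1/2..2}")
      case True
      then have "F (\<mu> * x) * (\<mu> * x) = \<nu> * P x * T (t * (\<mu> * x))"
        using FP[of "\<mu> * x"] mem pos by simp
      then show ?thesis
        using True mem pos r by (simp add: ac_simps)
    next
      case False
      then have "F (\<mu> * x) = 0" unfolding mem[symmetric] by (rule F(3))
      then show ?thesis using False by simp
    qed
  qed
  also have "\<dots> = (\<nu> * \<mu> * r) * ?J"
    by (rule integral_mult_right_zero)
  finally have I: "(\<integral>\<rho>. F \<rho> * \<rho> * sin (r * \<rho>) * indicator {\<mu>/2..2 * \<mu>} \<rho> \<partial>lborel) = \<mu> * ((\<nu> * \<mu> * r) * ?J)"
    using pos by simp
  have "multiplier_kernel (\<lambda>\<xi>. F (norm \<xi>)) z
      = complex_of_real (4 * pi / r * (\<integral>\<rho>. F \<rho> * \<rho> * sin (r * \<rho>) * indicator {\<mu>/2..2 * \<mu>} \<rho> \<partial>lborel))"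
    unfolding multiplier_kernel_def r_def
    by (rule fourier_radial[OF F(1,2) _ _ _ z]) (use F(3) pos in auto)
  also have "4 * pi / r * (\<integral>\<rho>. F \<rho> * \<rho> * sin (r * \<rho>) * indicator {\<mu>/2..2 * \<mu>} \<rho> \<partial>lborel) = 4 * pi * \<nu> * \<mu>\<^sup>2 * ?J"
    unfolding I using r by (simp add: power2_eq_square)
  finally have "cmod (multiplier_kernel (\<lambda>\<xi>. F (norm \<xi>)) z) = \<bar>4 * pi * \<nu> * \<mu>\<^sup>2 * ?J\<bar>"
    by (simp only: norm_of_real)
  also have "\<dots> = 4 * pi * \<nu> * \<mu>\<^sup>2 * \<bar>?J\<bar>"
    unfolding abs_mult[of _ ?J] using pos by simp
  also have "\<dots> \<le> 4 * pi * \<nu> * \<mu>\<^sup>2 * (60 * M / ((1 + \<mu> * t) * sqrt (1 + (\<mu> * t - \<mu> * r)\<^sup>2)))"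
    by (intro mult_left_mono spherical_wave_bound[OF P _ _ T]) (use pos r in auto)
  also have "(\<mu> * t - \<mu> * r)\<^sup>2 = (\<mu> * (norm z - t))\<^sup>2"
    by (simp add: r_def power2_eq_square algebra_simps)
  finally show ?thesis by (simp add: ac_simps)
qed

text \<open>The square of the kernel bound is integrated by \<open>shell_ball_integral\<close>; the
  root of that integral is the factor \<open>sqrt (48 * pi / \<mu>) * R\<close>.\<close>

lemma radial_multiplier_Linf_bound:
  fixes F :: "real \<Rightarrow> real" and p m :: "real^3 \<Rightarrow> real"
  assumes f: "square_integrable f" and fR: "ess_support f \<subseteq> cball 0 R" and R: "0 < R"
    and m: "m \<in> borel_measurable borel" "\<And>\<xi>. \<bar>m \<xi>\<bar> \<le> Bm"
    and p: "p \<in> borel_measurable borel" "\<And>\<xi>. \<bar>p \<xi>\<bar> \<le> Bp" "\<And>\<xi>. \<xi> \<notin> cball 0 (2 * \<mu>) \<Longrightarrow> p \<xi> = 0"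
    and pm: "\<And>\<xi>. p \<xi> * m \<xi> = F (norm \<xi>)"
    and P: "C2_bump P P' P'' M" and T: "T = sin \<or> T = cos" and pos: "0 < \<mu>" "0 \<le> t" "0 \<le> \<nu>"
    and F: "F \<in> borel_measurable borel" "\<And>\<rho>. \<bar>F \<rho>\<bar> \<le> B" "\<And>\<rho>. \<rho> \<notin> {\<mu>/2..2 * \<mu>} \<Longrightarrow> F \<rho> = 0"
    and FP: "\<And>\<rho>. \<rho> \<in> {\<mu>/2..2 * \<mu>} \<Longrightarrow> F \<rho> * \<rho> = \<nu> * P (\<rho> / \<mu>) * T (t * \<rho>)"
  shows "Linf_norm (fourier_multiplier p (fourier_multiplier m f))
    \<le> ereal (240 * pi * M * \<nu> * \<mu>\<^sup>2 / (1 + \<mu> * t) * (sqrt (48 * pi / \<mu>) * R) * L2_norm f)"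
proof -
  let ?K = "multiplier_kernel (\<lambda>\<xi>. p \<xi> * m \<xi>)"
  define A where "A = 240 * pi * M * \<nu> * \<mu>\<^sup>2 / (1 + \<mu> * t)"
  have M: "0 \<le> M" by (rule C2_bump_nonneg[OF P])
  have A: "0 \<le> A" using pos M by (auto simp: A_def intro!: divide_nonneg_nonneg mult_nonneg_nonneg)
  define h where "h z = 1 / (1 + (\<mu> * (norm z - t))\<^sup>2)" for z :: "real^3"
  have [measurable]: "h \<in> borel_measurable borel" unfolding h_def by measurable
  have h0: "0 \<le> h z" for z by (simp add: h_def)
  have K: "(cmod (?K z))\<^sup>2 \<le> A\<^sup>2 * h z" if "z \<noteq> 0" for z
  proof -
    have "cmod (?K z) \<le> A / sqrt (1 + (\<mu> * (norm z - t))\<^sup>2)"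
      unfolding pm A_def by (rule radial_kernel_bound[OF P T pos F(1,2) _ _ that]) (use F(3) FP in auto)
    then have "(cmod (?K z))\<^sup>2 \<le> (A / sqrt (1 + (\<mu> * (norm z - t))\<^sup>2))\<^sup>2"
      by (rule power_mono) simp
    then show ?thesis by (simp add: h_def power_divide)
  qed
  have [measurable]: "cball (x::real^3) s \<in> sets borel" for x s by simp
  have "(\<integral>\<^sup>+y. indicator (cball 0 R) y * ennreal ((cmod (?K (x - y)))\<^sup>2) \<partial>lborel) \<le> ennreal ((A * (sqrt (48 * pi / \<mu>) * R))\<^sup>2)" for x
  proof -
    \<comment> \<open>The kernel bound is available only off the origin, so the single point
      \<open>y = x\<close> is discarded.\<close>
    have "AE y in lborel. y \<noteq> x" by (rule AE_lborel_singleton)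
    then have "(\<integral>\<^sup>+y. indicator (cball 0 R) y * ennreal ((cmod (?K (x - y)))\<^sup>2) \<partial>lborel)
      \<le> (\<integral>\<^sup>+y. indicator (cball 0 R) y * ennreal (A\<^sup>2 * h (x - y)) \<partial>lborel)"
      by (intro nn_integral_mono_AE, eventually_elim) (intro mult_left_mono ennreal_leI K, auto)
    also have "\<dots> = (\<integral>\<^sup>+z. indicator (cball x R) z * ennreal (A\<^sup>2 * h z) \<partial>lborel)"
    proof -
      have ind: "indicator (cball x R) (x - y) = (indicator (cball 0 R) y :: ennreal)" for y
        by (simp add: indicator_def dist_norm)
      have "(\<integral>\<^sup>+z. indicator (cball x R) z * ennreal (A\<^sup>2 * h z) \<partial>lborel)
        = (\<integral>\<^sup>+y. indicator (cball x R) (x - y) * ennreal (A\<^sup>2 * h (x - y)) \<partial>lborel)"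
        by (subst lborel_affine[where c="-1" and t=x]) (simp_all add: nn_integral_density nn_integral_distr)
      then show ?thesis unfolding ind by simp
    qed
    also have "\<dots> = (\<integral>\<^sup>+z. ennreal (A\<^sup>2) * (indicator (cball x R) z * ennreal (h z)) \<partial>lborel)"
      by (intro nn_integral_cong) (simp add: ennreal_mult h0 ac_simps)
    also have "\<dots> = ennreal (A\<^sup>2) * (\<integral>\<^sup>+z. indicator (cball x R) z * ennreal (h z) \<partial>lborel)"
      by (rule nn_integral_cmult) measurable
    also have "\<dots> \<le> ennreal (A\<^sup>2) * ennreal (48 * pi * R\<^sup>2 / \<mu>)"
      unfolding h_def by (intro mult_left_mono shell_ball_integral) (use pos R in auto)
    also have "\<dots> = ennreal ((A * (sqrt (48 * pi / \<mu>) * R))\<^sup>2)"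
      using pos by (simp add: ennreal_mult[symmetric] power_mult_distrib)
    finally show ?thesis .
  qed
  then have "Linf_norm (fourier_multiplier p (fourier_multiplier m f)) \<le> ereal (A * (sqrt (48 * pi / \<mu>) * R) * L2_norm f)"
    by (intro Linf_norm_multiplier_le[OF f AE_zero_off_ess_support[OF fR] m p(1,2)])
      (use p(3) A R pos in auto)
  then show ?thesis unfolding A_def .
qed

theorem lemma3p4:
  fixes \<psi> :: "real \<Rightarrow> real" and \<delta> :: real
  assumes "admissible_cutoff \<psi>"
    and "0 < \<delta>" and "\<delta> < 1/2"
  shows "\<exists>C::real. C > 0 \<and>
    (\<forall>(R::real) (f::real^3 \<Rightarrow> complex) (t::real) (k::int).
       R > 0 \<longrightarrow> square_integrable f \<longrightarrow> ess_support f \<subseteq> cball 0 R \<longrightarrow> t > 0 \<longrightarrow>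
       Linf_norm (LP_projection \<psi> k (sin_multiplier t f))
         \<le> ereal (C * 2 powr (1/2 * real_of_int k) * inverse (1 + 2 powi k * t)
                    * japanese_bracket (2 powi k * R) powr (1 + \<delta>) * L2_norm f) \<and>
       Linf_norm (LP_projection \<psi> k (cos_multiplier t f))
         \<le> ereal (C * 2 powr (3/2 * real_of_int k) * inverse (1 + 2 powi k * t)
                    * japanese_bracket (2 powi k * R) powr (1 + \<delta>) * L2_norm f))"
proof -
  note D = admissible_cutoffD[OF assms(1)]
  obtain P' P'' Q' Q'' M where M: "M > 0" and P: "C2_bump (\<lambda>s. \<psi> s - \<psi> (2 * s)) P' P'' M"
    and Q: "C2_bump (\<lambda>s. s * (\<psi> s - \<psi> (2 * s))) Q' Q'' M"
    by (rule cutoff_difference_bumps[OF assms(1)])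
  have [measurable]: "\<psi> \<in> borel_measurable borel"
    by (intro borel_measurable_continuous_onI continuous_at_imp_continuous_on ballI) (rule DERIV_isCont[OF D(1)])
  have cutoff0: "\<psi> s - \<psi> (2 * s) = 0" if "0 \<le> s" "s < 1/2 \<or> 2 < s" for s
    using that D(5)[of s] D(5)[of "2 * s"] D(6)[of s] D(6)[of "2 * s"] by auto
  \<comment> \<open>The kernel constant times the root of the shell constant; \<open>M\<close> is
    fixed by \<open>\<psi>\<close> before \<open>R\<close>, \<open>f\<close>, \<open>t\<close> and
    \<open>k\<close> are chosen.\<close>
  define C where "C = 240 * pi * M * sqrt (48 * pi)"
  have C: "C > 0" using M by (simp add: C_def)
  \<comment> \<open>In \<open>\<mu>\<^sup>2 / sqrt \<mu> = sqrt \<mu> * \<mu>\<close> the last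
    factor joins \<open>R\<close>. Then \<open>\<mu> * R\<close> is at most the bracket, which is at
    least 1 and so does not decrease under the power \<open>1 + \<delta>\<close>. The values
    \<open>\<nu> = 1\<close> and \<open>\<nu> = \<mu>\<close> give the two powers of 2.\<close>
  have final: "Linf_norm u \<le> ereal (C * \<nu> * sqrt \<mu> * inverse (1 + \<mu> * t) * japanese_bracket (\<mu> * R) powr (1 + \<delta>) * L2_norm f)"
    if u: "Linf_norm u \<le> ereal (240 * pi * M * \<nu> * \<mu>\<^sup>2 / (1 + \<mu> * t) * (sqrt (48 * pi / \<mu>) * R) * L2_norm f)"
      and pos: "0 < \<mu>" "0 < t" "0 < R" "0 \<le> \<nu>" for u f and \<nu> \<mu> t R :: real
  proof -
    let ?b = "japanese_bracket (\<mu> * R)"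
    have b1: "1 \<le> ?b" by (simp add: japanese_bracket_def)
    have "\<mu> * R \<le> ?b" unfolding japanese_bracket_def by (rule real_le_rsqrt) simp
    also have "?b = ?b powr 1" using b1 by simp
    also have "\<dots> \<le> ?b powr (1 + \<delta>)" using b1 assms(2) by (intro powr_mono) auto
    finally have b: "\<mu> * R \<le> ?b powr (1 + \<delta>)" .
    have s: "\<mu>\<^sup>2 * sqrt (48 * pi / \<mu>) = sqrt (48 * pi) * sqrt \<mu> * \<mu>"
      using pos by (simp add: real_sqrt_divide field_simps power2_eq_square)
    have "240 * pi * M * \<nu> * \<mu>\<^sup>2 / (1 + \<mu> * t) * (sqrt (48 * pi / \<mu>) * R)
      = 240 * pi * M * \<nu> * inverse (1 + \<mu> * t) * R * (\<mu>\<^sup>2 * sqrt (48 * pi / \<mu>))"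
      by (simp add: divide_inverse ac_simps)
    also have "\<dots> = C * \<nu> * sqrt \<mu> * inverse (1 + \<mu> * t) * (\<mu> * R)"
      unfolding s C_def by (simp add: ac_simps)
    also have "\<dots> \<le> C * \<nu> * sqrt \<mu> * inverse (1 + \<mu> * t) * ?b powr (1 + \<delta>)"
      by (intro mult_left_mono b) (use C pos in auto)
    finally have "240 * pi * M * \<nu> * \<mu>\<^sup>2 / (1 + \<mu> * t) * (sqrt (48 * pi / \<mu>) * R) * L2_norm f
      \<le> C * \<nu> * sqrt \<mu> * inverse (1 + \<mu> * t) * ?b powr (1 + \<delta>) * L2_norm f"
      by (rule mult_right_mono) (simp add: L2_norm_def)
    with u show ?thesis by (auto intro: order_trans)
  qed
  show ?thesis
  proof (intro exI[of _ C] conjI C allI impI)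
    fix R t :: real and f :: "real^3 \<Rightarrow> complex" and k :: int
    assume R: "R > 0" and f: "square_integrable f" and fR: "ess_support f \<subseteq> cball 0 R" and t: "t > 0"
    define \<mu> :: real where "\<mu> = 2 powi k"
    have \<mu>: "\<mu> > 0" by (simp add: \<mu>_def)
    have half: "2 powi (k - 1) = \<mu> / 2" by (simp add: \<mu>_def power_int_diff)
    have \<mu>_powr: "\<mu> = 2 powr real_of_int k" by (simp add: \<mu>_def powr_real_of_int')
    have sq1: "2 powr (1/2 * real_of_int k) = sqrt \<mu>"
      by (simp add: \<mu>_powr powr_half_sqrt[symmetric] powr_powr)
    have sq3: "2 powr (3/2 * real_of_int k) = \<mu> * sqrt \<mu>"
      unfolding sq1[symmetric] by (simp add: \<mu>_powr powr_add[symmetric])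
    define p where "p \<xi> = \<psi> (norm \<xi> / 2 powi k) - \<psi> (norm \<xi> / 2 powi (k - 1))" for \<xi> :: "real^3"
    have LP: "LP_projection \<psi> k = fourier_multiplier p"
      unfolding LP_projection_def p_def[abs_def] ..
    have p_eq: "p \<xi> = \<psi> (norm \<xi> / \<mu>) - \<psi> (2 * (norm \<xi> / \<mu>))" for \<xi>
      by (simp add: p_def half \<mu>_def[symmetric] mult.commute)
    have p_bd: "\<bar>p \<xi>\<bar> \<le> 1" for \<xi> unfolding p_def by (rule D(4))
    have pm: "p \<in> borel_measurable borel" unfolding p_def[abs_def] by measurable
    have p0: "p \<xi> = 0" if "norm \<xi> \<notin> {\<mu>/2..2 * \<mu>}" for \<xi>
    proof -
      have "norm \<xi> / \<mu> < 1/2 \<or> 2 < norm \<xi> / \<mu>" using that \<mu> by (auto simp: field_simps)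
      then show ?thesis unfolding p_eq by (intro cutoff0) (use \<mu> in auto)
    qed
    \<comment> \<open>The case distinction also removes negative \<open>\<rho>\<close>, where the
      difference of cutoffs can be nonzero although no \<open>norm \<xi>\<close> takes such a
      value.\<close>
    define G where "G w \<rho> = (if \<rho> \<in> {\<mu>/2..2 * \<mu>} then (\<psi> (\<rho> / \<mu>) - \<psi> (2 * (\<rho> / \<mu>))) * w \<rho> else 0)" for w :: "real \<Rightarrow> real" and \<rho>
    have Gm: "G w \<in> borel_measurable borel" if [measurable]: "w \<in> borel_measurable borel" for w
      unfolding G_def[abs_def] by measurable
    have G0: "\<rho> \<notin> {\<mu>/2..2 * \<mu>} \<Longrightarrow> G w \<rho> = 0" for w \<rho> unfolding G_def by (rule if_not_P)
    have Gp: "p \<xi> * w (norm \<xi>) = G w (norm \<xi>)" for w \<xi>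
      using p0[of \<xi>] by (simp only: G_def p_eq split: if_split) simp
    have Gb: "\<bar>G w \<rho>\<bar> \<le> B" if "\<And>x. \<bar>w x\<bar> \<le> B" for w \<rho> B
    proof -
      have "0 \<le> B" using that[of 0] by simp
      then show ?thesis
        using mult_mono[OF D(4)[of "\<rho> / \<mu>" "2 * (\<rho> / \<mu>)"] that[of \<rho>]] by (auto simp: G_def abs_mult)
    qed
    have pball: "p \<xi> = 0" if "\<xi> \<notin> cball 0 (2 * \<mu>)" for \<xi>
      by (rule p0) (use that in auto)
    \<comment> \<open>At \<open>x = 0\<close> the quotient is 0 by convention. The bound
      \<open>t\<close> only makes the symbol admissible; it does not enter the final
      constant.\<close>
    have sin_bd: "\<bar>sin (t * x) / x\<bar> \<le> t" for x
      using abs_sin_x_le_abs_x[of "t * x"] t by (cases "x = 0") (auto simp: abs_mult field_simps)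
    have "Linf_norm (fourier_multiplier p (fourier_multiplier (\<lambda>\<xi>. sin (t * norm \<xi>) / norm \<xi>) f))
      \<le> ereal (240 * pi * M * 1 * \<mu>\<^sup>2 / (1 + \<mu> * t) * (sqrt (48 * pi / \<mu>) * R) * L2_norm f)"
    proof (rule radial_multiplier_Linf_bound[where Bm = t, OF f fR R _ sin_bd pm p_bd pball Gp[of _ "\<lambda>x. sin (t * x) / x"] P _ \<mu> _ _ Gm Gb[of _ t] G0])
      \<comment> \<open>The \<open>1 / \<rho>\<close> of the symbol cancels the radial weight, so
        \<open>\<nu> = 1\<close> and the unweighted bump occurs.\<close>
      show "G (\<lambda>x. sin (t * x) / x) \<rho> * \<rho> = 1 * (\<psi> (\<rho> / \<mu>) - \<psi> (2 * (\<rho> / \<mu>))) * sin (t * \<rho>)"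
        if "\<rho> \<in> {\<mu>/2..2 * \<mu>}" for \<rho>
        using that \<mu> by (simp add: G_def)
    qed (use sin_bd t in simp_all)
    from final[OF this \<mu> t R]
    show "Linf_norm (LP_projection \<psi> k (sin_multiplier t f))
         \<le> ereal (C * 2 powr (1/2 * real_of_int k) * inverse (1 + 2 powi k * t)
                    * japanese_bracket (2 powi k * R) powr (1 + \<delta>) * L2_norm f)"
      unfolding LP sin_multiplier_def sq1 \<mu>_def[symmetric] by simp
    have "Linf_norm (fourier_multiplier p (fourier_multiplier (\<lambda>\<xi>. cos (t * norm \<xi>)) f))
      \<le> ereal (240 * pi * M * \<mu> * \<mu>\<^sup>2 / (1 + \<mu> * t) * (sqrt (48 * pi / \<mu>) * R) * L2_norm f)"
    proof (rule radial_multiplier_Linf_bound[where Bm = 1, OF f fR R _ _ pm p_bd pball Gp[of _ "\<lambda>x. cos (t * x)"] Q _ \<mu> _ _ Gm Gb[of _ 1] G0])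
      \<comment> \<open>The radial weight remains; written as
        \<open>\<mu> * (\<rho> / \<mu>)\<close> it supplies \<open>\<nu> = \<mu>\<close> and the
        weighted bump.\<close>
      show "G (\<lambda>x. cos (t * x)) \<rho> * \<rho> = \<mu> * (\<rho> / \<mu> * (\<psi> (\<rho> / \<mu>) - \<psi> (2 * (\<rho> / \<mu>)))) * cos (t * \<rho>)"
        if "\<rho> \<in> {\<mu>/2..2 * \<mu>}" for \<rho>
        using that \<mu> by (simp add: G_def)
    qed (use t \<mu> in auto)
    from final[OF this \<mu> t R]
    show "Linf_norm (LP_projection \<psi> k (cos_multiplier t f))
         \<le> ereal (C * 2 powr (3/2 * real_of_int k) * inverse (1 + 2 powi k * t)
                    * japanese_bracket (2 powi k * R) powr (1 + \<delta>) * L2_norm f)"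
      unfolding LP cos_multiplier_def sq3 \<mu>_def[symmetric]
      using \<mu> by (simp add: mult.assoc)
  qed
qed

end
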